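(* Let $\mathcal{A}$ and $\mathcal{B}$ be real (or complex) line arrangements in $\mathbb{P}^2$ which form a counterexample to Terao's conjecture, meaning that their intersection lattices are isomorphic, $L_{\mathcal{A}}\cong L_{\mathcal{B}}$, and $D_0(\mathcal{A})$ is free with splitting type $(a_1,a_2)$, whereas $D_0(\mathcal{B})$ is not free. Suppose furthermore that there is no pair of lines $(L,L')\in\mathcal{A}\times\mathcal{B}$ which can be removed to get subarrangements $\mathcal{A}'=\mathcal{A}\setminus\{L\}$ and $\mathcal{B}'=\mathcal{B}\setminus\{L'\}$ forming a smaller counterexample. Then, letting $Z=\mathcal{A}^{\perp}$ be the set of points dual to $\mathcal{A}$, for every $P\in Z$ we have $$|L_P(Z)|\leq a_1\leq\left\lfloor\frac{|Z|-1}{2}\right\rfloor.$$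
   Context: Arrangements are finite sets of lines in $\mathbb{P}^2$ over $\mathbb{C}$ (real arrangements are those whose lines have real equations). $S=\mathbb{C}[Y_0,Y_1,Y_2]$. $D(\mathcal{A})$ is the $S$-module of $\mathbb{C}$-linear derivations $\theta:S\to S$ with $\theta(I(H))\subseteq I(H)$ for all $H\in\mathcal{A}$, graded so that $\deg\theta=\deg\theta(\ell)$ for linear forms $\ell$. $\theta_e=\sum_iY_i\,\partial/\partial Y_i$ and $D_0(\mathcal{A})=D(\mathcal{A})/S\theta_e$; "free" means free as an $S$-module. The splitting type of $D_0(\mathcal{A})$ ($\mathcal{A}\ne\emptyset$) is the unique pair of integers $0\le a_1\leq a_2$ such that, for a general line $L$, the restriction of the sheaf $\widetilde{D_0(\mathcal{A})}$ to $L$ is isomorphic to $\mathcal{O}_L(-a_1)\oplus\mathcal{O}_L(-a_2)$. The intersection lattice $L_{\mathcal{A}}$ is the poset of all intersections of lines of $\mathcal{A}$. A pair $(\mathcal{A}',\mathcal{B}')$ forms a (smaller) counterexample if $L_{\mathcal{A}'}\cong L_{\mathcal{B}'}$, $D_0(\mathcal{A}')$ is free and $D_0(\mathcal{B}')$ is not free. The dual point set $\mathcal{A}^\perp$ lies in the dual plane and consists of the points $(c_0:c_1:c_2)$ for the lines $\{c_0Y_0+c_1Y_1+c_2Y_2=0\}\in\mathcal{A}$. For a finite point set $Z$ and a point $P$, $L_P(Z)=\{\mathrm{Span}(P,Q):Q\in Z\setminus\{P\}\}$ is the set of lines joining $P$ to the other points of $Z$. *)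

theory Defs
  imports
    "HOL-Analysis.Cartesian_Space"
    "HOL-Library.Poly_Mapping"
    "HOL-Library.Numeral_Type"
    "HOL-Algebra.Module"
    "HOL-Algebra.AbelCoset"
begin

section \<open>The polynomial ring in three variables\<close>

text \<open>
  The three variables are indexed by the type \<^typ>\<open>3\<close>; a monomial is its exponent vector.
\<close>

type_synonym spoly = "(3 \<Rightarrow>\<^sub>0 nat) \<Rightarrow>\<^sub>0 complex"

definition const :: "complex \<Rightarrow> spoly" where
  "const a = Poly_Mapping.single 0 a"

definition var :: "3 \<Rightarrow> spoly" where
  "var i = Poly_Mapping.single (Poly_Mapping.single i 1) 1"

definition poly_eval :: "spoly \<Rightarrow> complex^3 \<Rightarrow> complex" where
  "poly_eval p v =
     (\<Sum>m\<in>Poly_Mapping.keys p.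
        Poly_Mapping.lookup p m * (\<Prod>i\<in>UNIV. (v $ i) ^ Poly_Mapping.lookup m i))"

definition partial_deriv :: "3 \<Rightarrow> spoly \<Rightarrow> spoly" where
  "partial_deriv i p =
     (\<Sum>m\<in>Poly_Mapping.keys p.
        Poly_Mapping.single (m - Poly_Mapping.single i 1)
          (of_nat (Poly_Mapping.lookup m i) * Poly_Mapping.lookup p m))"

text \<open>The zero polynomial is homogeneous of every degree.\<close>

definition homogeneous :: "nat \<Rightarrow> spoly \<Rightarrow> bool" where
  "homogeneous d p \<longleftrightarrow>
     (\<forall>m\<in>Poly_Mapping.keys p. (\<Sum>i\<in>UNIV. Poly_Mapping.lookup m i) = d)"

definition linear_form :: "complex^3 \<Rightarrow> spoly" where
  "linear_form c = (\<Sum>i\<in>UNIV. const (c $ i) * var i)"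

definition poly_ring :: "spoly ring" where
  "poly_ring = \<lparr>carrier = UNIV, monoid.mult = (*), one = 1, zero = 0, add = (+)\<rparr>"


section \<open>The projective plane, lines and arrangements\<close>

text \<open>
  A point of the plane is a one-dimensional subspace of \<^typ>\<open>complex^3\<close>. The same type serves
  for the dual plane. Note that the subspace contains the zero vector.
\<close>

typedef proj_plane = "{p :: (complex^3) set. \<exists>v. v \<noteq> 0 \<and> p = vec.span {v}}"
  morphisms subspace_of Abs_proj_plane
proof -
  have "axis 1 1 \<noteq> (0 :: complex^3)"
    by (simp add: axis_eq_0_iff)
  then show ?thesis
    by blast
qed

definition proj_point :: "complex^3 \<Rightarrow> proj_plane" where
  "proj_point v = Abs_proj_plane (vec.span {v})"

definition line :: "complex^3 \<Rightarrow> proj_plane set" where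
  "line c = {P. \<forall>v\<in>subspace_of P. poly_eval (linear_form c) v = 0}"

definition line_arrangement :: "proj_plane set set \<Rightarrow> bool" where
  "line_arrangement A \<longleftrightarrow> finite A \<and> (\<forall>H\<in>A. \<exists>c. c \<noteq> 0 \<and> H = line c)"

text \<open>
  The empty family contributes the whole plane, as \<^prop>\<open>\<Inter>{} = UNIV\<close>.
\<close>

definition intersection_lattice :: "proj_plane set set \<Rightarrow> proj_plane set set" where
  "intersection_lattice A = {\<Inter>F | F. F \<subseteq> A}"

definition lattice_isomorphic :: "proj_plane set set \<Rightarrow> proj_plane set set \<Rightarrow> bool" where
  "lattice_isomorphic A B \<longleftrightarrow>
     (\<exists>\<phi>. bij_betw \<phi> (intersection_lattice A) (intersection_lattice B) \<and>
        (\<forall>X\<in>intersection_lattice A. \<forall>Y\<in>intersection_lattice A.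
           X \<subseteq> Y \<longleftrightarrow> \<phi> X \<subseteq> \<phi> Y))"

definition dual_points :: "proj_plane set set \<Rightarrow> proj_plane set" where
  "dual_points A = {proj_point c | c. c \<noteq> 0 \<and> line c \<in> A}"

definition proj_span :: "proj_plane \<Rightarrow> proj_plane \<Rightarrow> proj_plane set" where
  "proj_span P Q = {R. subspace_of R \<subseteq> vec.span (subspace_of P \<union> subspace_of Q)}"

definition joining_lines :: "proj_plane \<Rightarrow> proj_plane set \<Rightarrow> proj_plane set set" where
  "joining_lines P Z = {proj_span P Q | Q. Q \<in> Z - {P}}"

text \<open>
  Since \<^term>\<open>subspace_of P\<close> is the full line in \<^typ>\<open>complex^3\<close>, this is the homogeneous ideal
  of all polynomials vanishing on the affine cone over \<open>X\<close>.
\<close>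

definition vanishing_ideal :: "proj_plane set \<Rightarrow> spoly set" where
  "vanishing_ideal X = {p. \<forall>P\<in>X. \<forall>v\<in>subspace_of P. poly_eval p v = 0}"


section \<open>Modules, quotients and gradings\<close>

text \<open>
  The record type of modules extends that of rings; the fields for multiplication and unit are
  irrelevant and left undefined throughout.
\<close>

record ('a, 'b) graded_module = "('a, 'b) module" +
  component :: "nat \<Rightarrow> 'b set"

definition module_basis :: "('a, 'r) ring_scheme \<Rightarrow> ('a, 'b, 'm) module_scheme \<Rightarrow> 'b set \<Rightarrow> bool"
  where
  "module_basis R M B \<longleftrightarrow>
     B \<subseteq> carrier M \<and>
     (\<forall>x\<in>carrier M. \<exists>!c. c ` B \<subseteq> carrier R \<and> (\<forall>b. b \<notin> B \<longrightarrow> c b = \<zero>\<^bsub>R\<^esub>) \<and>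
        finite {b. c b \<noteq> \<zero>\<^bsub>R\<^esub>} \<and>
        x = (\<Oplus>\<^bsub>M\<^esub>b\<in>{b. c b \<noteq> \<zero>\<^bsub>R\<^esub>}. c b \<odot>\<^bsub>M\<^esub> b))"

definition free_module :: "('a, 'r) ring_scheme \<Rightarrow> ('a, 'b, 'm) module_scheme \<Rightarrow> bool" where
  "free_module R M \<longleftrightarrow> (\<exists>B. module_basis R M B)"

text \<open>
  The quotient by a graded submodule with carrier \<open>N\<close>. Adding \<open>N\<close> to the set of multiples in the
  scalar multiplication turns it into a full coset.
\<close>

definition quotient_module ::
  "('a, 'b, 'm) graded_module_scheme \<Rightarrow> 'b set \<Rightarrow> ('a, 'b set) graded_module" where
  "quotient_module M N =
     \<lparr>carrier = a_rcosets\<^bsub>M\<^esub> N, monoid.mult = undefined, one = undefined,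
      zero = N, add = set_add M,
      smult = (\<lambda>a X. \<Union>x\<in>X. N +>\<^bsub>M\<^esub> (a \<odot>\<^bsub>M\<^esub> x)),
      component = (\<lambda>d. (\<lambda>x. N +>\<^bsub>M\<^esub> x) ` component M d)\<rparr>"

definition direct_sum ::
  "('a, 'b) graded_module \<Rightarrow> ('a, 'c) graded_module \<Rightarrow> ('a, 'b \<times> 'c) graded_module" where
  "direct_sum M N =
     \<lparr>carrier = carrier M \<times> carrier N, monoid.mult = undefined, one = undefined,
      zero = (\<zero>\<^bsub>M\<^esub>, \<zero>\<^bsub>N\<^esub>),
      add = (\<lambda>(x, y) (x', y'). (x \<oplus>\<^bsub>M\<^esub> x', y \<oplus>\<^bsub>N\<^esub> y')),
      smult = (\<lambda>a (x, y). (a \<odot>\<^bsub>M\<^esub> x, a \<odot>\<^bsub>N\<^esub> y)),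
      component = (\<lambda>d. component M d \<times> component N d)\<rparr>"

text \<open>The shifted module \<open>M(-a)\<close>.\<close>

definition twist_down :: "('a, 'b) graded_module \<Rightarrow> nat \<Rightarrow> ('a, 'b) graded_module" where
  "twist_down M a = M\<lparr>component := (\<lambda>d. if a \<le> d then component M (d - a) else {\<zero>\<^bsub>M\<^esub>})\<rparr>"

definition poly_module :: "(spoly, spoly) graded_module" where
  "poly_module =
     \<lparr>carrier = UNIV, monoid.mult = undefined, one = undefined, zero = 0, add = (+), smult = (*),
      component = (\<lambda>d. {p. homogeneous d p})\<rparr>"


section \<open>Derivations of an arrangement\<close>

definition derivation :: "(spoly \<Rightarrow> spoly) \<Rightarrow> bool" where
  "derivation \<theta> \<longleftrightarrow>
     (\<forall>p q. \<theta> (p + q) = \<theta> p + \<theta> q) \<and>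
     (\<forall>a p. \<theta> (const a * p) = const a * \<theta> p) \<and>
     (\<forall>p q. \<theta> (p * q) = \<theta> p * q + p * \<theta> q)"

definition log_derivations :: "proj_plane set set \<Rightarrow> (spoly \<Rightarrow> spoly) set" where
  "log_derivations A =
     {\<theta>. derivation \<theta> \<and> (\<forall>H\<in>A. \<theta> ` vanishing_ideal H \<subseteq> vanishing_ideal H)}"

definition derivation_module ::
  "proj_plane set set \<Rightarrow> (spoly, spoly \<Rightarrow> spoly) graded_module" where
  "derivation_module A =
     \<lparr>carrier = log_derivations A, monoid.mult = undefined, one = undefined,
      zero = (\<lambda>p. 0), add = (\<lambda>\<theta> \<eta> p. \<theta> p + \<eta> p), smult = (\<lambda>f \<theta> p. f * \<theta> p),
      component =
        (\<lambda>d. {\<theta>\<in>log_derivations A. \<forall>l. homogeneous 1 l \<longrightarrow> homogeneous d (\<theta> l)})\<rparr>"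

definition euler_derivation :: "spoly \<Rightarrow> spoly" where
  "euler_derivation p = (\<Sum>i\<in>UNIV. var i * partial_deriv i p)"

definition D0 :: "proj_plane set set \<Rightarrow> (spoly, (spoly \<Rightarrow> spoly) set) graded_module" where
  "D0 A = quotient_module (derivation_module A) {(\<lambda>p. f * euler_derivation p) | f. True}"

definition counterexample :: "proj_plane set set \<Rightarrow> proj_plane set set \<Rightarrow> bool" where
  "counterexample A B \<longleftrightarrow>
     lattice_isomorphic A B \<and> free_module poly_ring (D0 A) \<and> \<not> free_module poly_ring (D0 B)"


section \<open>The sheaf associated with a graded module\<close>

text \<open>
  The sheaf of a graded module \<open>M\<close> is given on the basis of open sets \<open>D\<^sub>+(f)\<close>, where \<open>f\<close> is
  homogeneous of degree \<open>e \<ge> 1\<close>, by the degree zero part of the localisation of \<open>M\<close> at \<open>f\<close>. Its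
  elements are the fractions \<open>m / f^k\<close> with \<open>m\<close> in \<open>M\<close> of degree \<open>k * e\<close>, represented by \<open>(m, k)\<close>.
\<close>

definition fractions :: "(spoly, 'b) graded_module \<Rightarrow> nat \<Rightarrow> ('b \<times> nat) set" where
  "fractions M e = {(m, k). m \<in> component M (k * e)}"

definition fraction_rel ::
  "(spoly, 'b) graded_module \<Rightarrow> nat \<Rightarrow> spoly \<Rightarrow> (('b \<times> nat) \<times> ('b \<times> nat)) set" where
  "fraction_rel M e f =
     {((m, k), (n, l)). (m, k) \<in> fractions M e \<and> (n, l) \<in> fractions M e \<and>
        (\<exists>j. (f ^ (j + l)) \<odot>\<^bsub>M\<^esub> m = (f ^ (j + k)) \<odot>\<^bsub>M\<^esub> n)}"

definition fraction ::
  "(spoly, 'b) graded_module \<Rightarrow> nat \<Rightarrow> spoly \<Rightarrow> 'b \<Rightarrow> nat \<Rightarrow> ('b \<times> nat) set" where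
  "fraction M e f m k = fraction_rel M e f `` {(m, k)}"

definition sections ::
  "(spoly, 'b) graded_module \<Rightarrow> nat \<Rightarrow> spoly \<Rightarrow> ('b \<times> nat) set set" where
  "sections M e f = fractions M e // fraction_rel M e f"

definition section_add ::
  "(spoly, 'b) graded_module \<Rightarrow> nat \<Rightarrow> spoly \<Rightarrow>
     ('b \<times> nat) set \<Rightarrow> ('b \<times> nat) set \<Rightarrow> ('b \<times> nat) set" where
  "section_add M e f s t =
     (\<Union>(m, k)\<in>s. \<Union>(n, l)\<in>t.
        fraction M e f ((f ^ l) \<odot>\<^bsub>M\<^esub> m \<oplus>\<^bsub>M\<^esub> (f ^ k) \<odot>\<^bsub>M\<^esub> n) (k + l))"

text \<open>Multiplication by the regular function \<open>g / f^j\<close>, where \<open>g\<close> has degree \<open>j * e\<close>.\<close>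

definition section_smult ::
  "(spoly, 'b) graded_module \<Rightarrow> nat \<Rightarrow> spoly \<Rightarrow> spoly \<Rightarrow> nat \<Rightarrow>
     ('b \<times> nat) set \<Rightarrow> ('b \<times> nat) set" where
  "section_smult M e f g j s = (\<Union>(m, k)\<in>s. fraction M e f (g \<odot>\<^bsub>M\<^esub> m) (j + k))"

text \<open>
  Restriction from \<open>D\<^sub>+(f)\<close> to \<open>D\<^sub>+(f * g)\<close>, sending \<open>m / f^k\<close> to \<open>g^k m / (f * g)^k\<close>;
  here \<open>f\<close> and \<open>g\<close> have degrees \<open>e\<close> and \<open>e'\<close>.
\<close>

definition section_restrict ::
  "(spoly, 'b) graded_module \<Rightarrow> nat \<Rightarrow> spoly \<Rightarrow> nat \<Rightarrow> spoly \<Rightarrow>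
     ('b \<times> nat) set \<Rightarrow> ('b \<times> nat) set" where
  "section_restrict M e f e' g s =
     (\<Union>(m, k)\<in>s. fraction M (e + e') (f * g) ((g ^ k) \<odot>\<^bsub>M\<^esub> m) k)"

text \<open>
  An isomorphism of the associated sheaves of modules over the structure sheaf, given on the basis
  of the open sets \<open>D\<^sub>+(f)\<close>.
\<close>

definition sheaf_isomorphic ::
  "(spoly, 'b) graded_module \<Rightarrow> (spoly, 'c) graded_module \<Rightarrow> bool" where
  "sheaf_isomorphic M N \<longleftrightarrow>
     (\<exists>\<phi> :: nat \<Rightarrow> spoly \<Rightarrow> ('b \<times> nat) set \<Rightarrow> ('c \<times> nat) set.
        \<forall>e f. e \<ge> 1 \<and> homogeneous e f \<longrightarrow>
          bij_betw (\<phi> e f) (sections M e f) (sections N e f) \<and>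
          (\<forall>s\<in>sections M e f. \<forall>t\<in>sections M e f.
             \<phi> e f (section_add M e f s t) = section_add N e f (\<phi> e f s) (\<phi> e f t)) \<and>
          (\<forall>j g. \<forall>s\<in>sections M e f. homogeneous (j * e) g \<longrightarrow>
             \<phi> e f (section_smult M e f g j s) = section_smult N e f g j (\<phi> e f s)) \<and>
          (\<forall>e' g. \<forall>s\<in>sections M e f. homogeneous e' g \<longrightarrow>
             \<phi> (e + e') (f * g) (section_restrict M e f e' g s) =
               section_restrict N e f e' g (\<phi> e f s)))"


section \<open>Splitting type\<close>

text \<open>
  The restriction of the sheaf of \<open>M\<close> to the line \<open>L\<close> with equation \<open>l = 0\<close> is the sheaf of
  \<open>M / l M\<close>, the tensor product of \<open>M\<close> with the coordinate ring \<open>S / l S\<close> of \<open>L\<close>. Sheaves on \<open>L\<close>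
  are viewed as sheaves on the plane supported on \<open>L\<close>, that is, modules over \<open>S / l S\<close> as modules
  over \<open>S\<close>; this affects neither isomorphisms nor linearity.
\<close>

definition restrict_to_line ::
  "(spoly, 'b) graded_module \<Rightarrow> complex^3 \<Rightarrow> (spoly, 'b set) graded_module" where
  "restrict_to_line M c = quotient_module M ((\<lambda>m. linear_form c \<odot>\<^bsub>M\<^esub> m) ` carrier M)"

text \<open>The graded module whose sheaf is \<open>O\<^sub>L(-a)\<close>.\<close>

definition line_bundle :: "complex^3 \<Rightarrow> nat \<Rightarrow> (spoly, spoly set) graded_module" where
  "line_bundle c a = twist_down (restrict_to_line poly_module c) a"

text \<open>
  A general line is one whose coefficient vector lies in some fixed nonempty Zariski open subset of
  the dual plane; every such subset contains one of the form \<open>F \<noteq> 0\<close> with \<open>F\<close> homogeneous.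
\<close>

definition for_general_line :: "(complex^3 \<Rightarrow> bool) \<Rightarrow> bool" where
  "for_general_line P \<longleftrightarrow>
     (\<exists>d F. F \<noteq> 0 \<and> homogeneous d F \<and> (\<forall>c. c \<noteq> 0 \<and> poly_eval F c \<noteq> 0 \<longrightarrow> P c))"

definition splitting_type :: "proj_plane set set \<Rightarrow> nat \<Rightarrow> nat \<Rightarrow> bool" where
  "splitting_type A a\<^sub>1 a\<^sub>2 \<longleftrightarrow>
     a\<^sub>1 \<le> a\<^sub>2 \<and>
     for_general_line (\<lambda>c.
       sheaf_isomorphic (restrict_to_line (D0 A) c)
         (direct_sum (line_bundle c a\<^sub>1) (line_bundle c a\<^sub>2)))"

end

theory Submission
  imports Defs "HOL-Computational_Algebra.Polynomial"
begin

text \<open>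
  A derivation is a vector of three polynomials, and by Saito's criterion \<open>D\<^sub>0\<close> is free exactly when
  two logarithmic vectors have, together with the Euler vector, a determinant that is a nonzero
  multiple of the defining polynomial.

  Suppose a line \<open>H\<close> of \<open>\<A>\<close>, which is free with exponents \<open>a \<le> b\<close>, carries \<open>n > a\<close> points. Restricting
  logarithmic vectors to \<open>H\<close> and dividing by the equations of the \<open>n\<close> points shows that a basis element
  becomes, up to the Euler vector, divisible by the equation of \<open>H\<close>; hence \<open>\<A> - H\<close> is free, with
  exponents \<open>(a - 1, b)\<close> and \<open>n = b + 1\<close>, or \<open>(a, b - 1)\<close> and \<open>n = a + 1\<close>. By minimality the
  corresponding subarrangement of \<open>\<B>\<close> is free. Its exponents are the same, since restriction to \<open>H\<close> and
  evaluation on the equation of \<open>H\<close> bound the Hilbert function of an arrangement from both sides in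
  terms of \<open>n\<close> and the Hilbert function of the deletion, and the two bounds agree in large degrees.
  Then the addition theorem makes \<open>\<B>\<close> free, a contradiction.

  Finally \<open>a\<close> is the smaller entry of the splitting type because there is no nonzero map
  \<open>O(-a) \<rightarrow> O(-a')\<close> on a projective line for \<open>a < a'\<close>.
\<close>

section \<open>Commutative algebra of complex polynomials in three variables\<close>

section \<open>Polynomials and their values\<close>

text \<open>Minimality tells that the deletion of the second arrangement is free, but not with which
  exponents, whereas addition requires \<open>n - 1\<close> to be one of them. The usual bridge is
  the factorisation of the characteristic polynomial. Here a statement about arbitrary nonempty
  arrangements takes its place: in large degrees the Hilbert function is combinatorial and grows by
  \<open>2 * k + 5\<close> minus the number of lines from degree \<open>k\<close> to
  \<open>k + 1\<close>. Value and growth have to be proved together, because the two bounds involve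
  the deletion in degrees \<open>k - 1\<close> and \<open>k\<close> and meet only if its growth
  between them is known. Exponents with a given sum can then be read off from the Hilbert function.
  The coordinate ring of a line is realised inside the polynomial ring, as the image of a linear
  projection of the variables. It is thereby an integral domain, and congruences modulo the line
  become equations; this serves both the restriction arguments and the sheaves. Saito's criterion is
  matched with freeness for nonempty arrangements, which is why each deletion is checked to retain a
  line.\<close>

definition monomial_eval :: "(3 \<Rightarrow>\<^sub>0 nat) \<Rightarrow> complex^3 \<Rightarrow> complex" where
  "monomial_eval m v = (\<Prod>i\<in>UNIV. (v $ i) ^ Poly_Mapping.lookup m i)"

lemma monomial_eval_add: "monomial_eval (m + n) v = monomial_eval m v * monomial_eval n v"
  by (simp add: monomial_eval_def lookup_add power_add prod.distrib)

lemma monomial_eval_0 [simp]: "monomial_eval 0 v = 1"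
  by (simp add: monomial_eval_def)

lemma poly_eval_superset:
  assumes "finite S" "Poly_Mapping.keys p \<subseteq> S"
  shows "poly_eval p v = (\<Sum>m\<in>S. Poly_Mapping.lookup p m * monomial_eval m v)"
  unfolding poly_eval_def monomial_eval_def[symmetric]
  by (rule sum.mono_neutral_left) (use assms in \<open>auto simp: in_keys_iff\<close>)

lemma poly_eval_single [simp]: "poly_eval (Poly_Mapping.single m a) v = a * monomial_eval m v"
  by (subst poly_eval_superset[of "{m}"]) auto

lemma poly_eval_0 [simp]: "poly_eval 0 v = 0"
  by (simp add: poly_eval_def)

lemma poly_eval_add [simp]: "poly_eval (p + q) v = poly_eval p v + poly_eval q v"
proof -
  let ?S = "Poly_Mapping.keys p \<union> Poly_Mapping.keys q"
  have "poly_eval (p + q) v = (\<Sum>m\<in>?S. Poly_Mapping.lookup (p + q) m * monomial_eval m v)"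
    by (rule poly_eval_superset) (use keys_add[of p q] in auto)
  moreover have "poly_eval p v = (\<Sum>m\<in>?S. Poly_Mapping.lookup p m * monomial_eval m v)"
    "poly_eval q v = (\<Sum>m\<in>?S. Poly_Mapping.lookup q m * monomial_eval m v)"
    by (rule poly_eval_superset; auto)+
  ultimately show ?thesis
    by (simp add: lookup_add algebra_simps sum.distrib)
qed

lemma poly_eval_sum [simp]: "poly_eval (sum f A) v = (\<Sum>a\<in>A. poly_eval (f a) v)"
  by (induction A rule: infinite_finite_induct) auto

lemma spoly_sum_single: "(\<Sum>m\<in>Poly_Mapping.keys p. Poly_Mapping.single m (Poly_Mapping.lookup p m)) = p"
  by (rule poly_mapping_eqI)
    (auto simp: lookup_sum lookup_single when_def in_keys_iff sum.delta)

lemma spoly_additive_induct: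
  fixes p :: spoly
  assumes "\<And>m a. P (Poly_Mapping.single m a)" "\<And>p q. P p \<Longrightarrow> P q \<Longrightarrow> P (p + q)"
  shows "P p"
proof -
  have "P (\<Sum>m\<in>S. Poly_Mapping.single m (Poly_Mapping.lookup p m))" for S
  proof (induction S rule: infinite_finite_induct)
    case (infinite A)
    then show ?case using assms(1)[of 0 0] by simp
  next
    case empty
    then show ?case using assms(1)[of 0 0] by simp
  next
    case (insert x F)
    then show ?case by (auto intro: assms)
  qed
  then show ?thesis
    by (metis spoly_sum_single)
qed

lemma poly_eval_mult [simp]: "poly_eval (p * q) v = poly_eval p v * poly_eval q v"
proof (induction p rule: spoly_additive_induct)
  case (1 m a)
  show ?case
    by (induction q rule: spoly_additive_induct)
      (auto simp: mult_single monomial_eval_add algebra_simps)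
qed (simp add: algebra_simps)

lemma poly_eval_const [simp]: "poly_eval (const a) v = a"
  by (simp add: const_def)

lemma single_0_one: "Poly_Mapping.single 0 1 = (1::spoly)"
  by (simp add: single_one)

lemma poly_eval_1 [simp]: "poly_eval 1 v = 1"
  by (metis const_def single_0_one poly_eval_const)

lemma monomial_eval_single: "monomial_eval (Poly_Mapping.single i k) v = (v $ i) ^ k"
proof -
  have "monomial_eval (Poly_Mapping.single i k) v = (\<Prod>j\<in>UNIV. if j = i then (v $ i) ^ k else 1)"
    unfolding monomial_eval_def by (rule prod.cong) (auto simp: lookup_single when_def)
  then show ?thesis by simp
qed

lemma poly_eval_var [simp]: "poly_eval (var i) v = v $ i"
  by (simp add: var_def monomial_eval_single)

lemma poly_eval_uminus [simp]: "poly_eval (- p) v = - poly_eval p v"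
  by (metis add.inverse_unique add.right_inverse poly_eval_0 poly_eval_add)

lemma poly_eval_diff [simp]: "poly_eval (p - q) v = poly_eval p v - poly_eval q v"
  by (metis poly_eval_add poly_eval_uminus uminus_add_conv_diff add.commute)

lemma poly_eval_power [simp]: "poly_eval (p ^ n) v = poly_eval p v ^ n"
  by (induction n) auto

lemma poly_eval_prod [simp]: "poly_eval (prod f A) v = (\<Prod>a\<in>A. poly_eval (f a) v)"
  by (induction A rule: infinite_finite_induct) auto

text \<open>Kronecker's substitution \<open>v = (t, t^N, t^(N^2))\<close> separates the monomials of a polynomial with
  exponents below \<open>N\<close>, which reduces the claim to univariate polynomials.\<close>

lemma spoly_eq_0I:
  assumes "\<And>v. poly_eval p v = 0"
  shows "p = 0"
proof (rule ccontr)
  assume "p \<noteq> 0"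
  then obtain m0 where m0: "m0 \<in> Poly_Mapping.keys p"
    by (metis all_not_in_conv keys_eq_empty)
  obtain N :: nat where N: "\<And>m i. m \<in> Poly_Mapping.keys p \<Longrightarrow> Poly_Mapping.lookup m i < N"
  proof -
    have "finite ((\<lambda>(m, i). Poly_Mapping.lookup m i) ` (Poly_Mapping.keys p \<times> (UNIV::3 set)))"
      by simp
    then obtain N where "\<forall>n\<in>(\<lambda>(m, i). Poly_Mapping.lookup m i) ` (Poly_Mapping.keys p \<times> (UNIV::3 set)). n < N"
      using finite_nat_set_iff_bounded by blast
    then show ?thesis by (intro that[of N]) auto
  qed
  define e where "e m = Poly_Mapping.lookup m 1 + N * (Poly_Mapping.lookup m 2 + N * Poly_Mapping.lookup m 3)"
    for m :: "3 \<Rightarrow>\<^sub>0 nat"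
  have inj: "m = m'" if "m \<in> Poly_Mapping.keys p" "m' \<in> Poly_Mapping.keys p" "e m = e m'" for m m'
  proof -
    have Npos: "N > 0" using N[OF that(1), of 1] by simp
    have 1: "Poly_Mapping.lookup m 1 = Poly_Mapping.lookup m' 1"
      using arg_cong[OF that(3), of "\<lambda>x. x mod N"] N[OF that(1), of 1] N[OF that(2), of 1]
      by (simp add: e_def)
    then have 2: "Poly_Mapping.lookup m 2 + N * Poly_Mapping.lookup m 3 =
        Poly_Mapping.lookup m' 2 + N * Poly_Mapping.lookup m' 3"
      using that(3) Npos by (simp add: e_def)
    have 3: "Poly_Mapping.lookup m 2 = Poly_Mapping.lookup m' 2"
      using arg_cong[OF 2, of "\<lambda>x. x mod N"] N[OF that(1), of 2] N[OF that(2), of 2] by simp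
    have "Poly_Mapping.lookup m 3 = Poly_Mapping.lookup m' 3"
      using 2 3 Npos by simp
    then show ?thesis using 1 3
      by (intro poly_mapping_eqI) (metis exhaust_3)
  qed
  have e: "(\<Prod>i\<in>UNIV. (vector [t, t ^ N, t ^ (N * N)] :: complex^3) $ i ^ Poly_Mapping.lookup m i) = t ^ e m" for m t
    unfolding UNIV_3 e_def by (simp add: power_add distrib_left mult.assoc flip: power_mult)
  define q where "q = (\<Sum>m\<in>Poly_Mapping.keys p. monom (Poly_Mapping.lookup p m) (e m))"
  have "poly q t = poly_eval p (vector [t, t ^ N, t ^ (N * N)])" for t
    by (simp only: q_def poly_sum poly_monom poly_eval_def e)
  then have "poly q t = 0" for t
    by (simp only: assms)
  then have "q = 0"
    using poly_all_0_iff_0[of q] by blast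
  moreover have "coeff q (e m0) = (\<Sum>m\<in>Poly_Mapping.keys p. if m = m0 then Poly_Mapping.lookup p m0 else 0)"
    unfolding q_def coeff_sum coeff_monom by (rule sum.cong[OF refl]) (metis inj m0)
  ultimately have "Poly_Mapping.lookup p m0 = 0"
    using m0 by (simp add: sum.delta)
  then show False
    using m0 by (simp add: in_keys_iff)
qed

text \<open>Identities between polynomials are from here on mostly checked at points, where they
  become arithmetic in the complex numbers.\<close>

lemma spoly_eqI:
  assumes "\<And>v. poly_eval p v = poly_eval q v"
  shows "p = q"
  using spoly_eq_0I[of "p - q"] assms by simp

lemma const_add: "const (a + b) = const a + const b"
  and const_mult: "const (a * b) = const a * const b"
  and const_0 [simp]: "const 0 = 0"
  and const_1 [simp]: "const 1 = 1"
  and const_uminus: "const (- a) = - const a"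
  and const_diff: "const (a - b) = const a - const b"
  by (rule spoly_eqI; simp)+

lemma const_eq_iff [simp]: "const a = const b \<longleftrightarrow> a = b"
  by (metis poly_eval_const)

lemma const_eq_0_iff [simp]: "const a = 0 \<longleftrightarrow> a = 0"
  by (metis const_eq_iff const_0)

lemma const_mult_inverse:
  assumes "a \<noteq> 0"
  shows "const (inverse a) * (const a * p) = p" "const a * (const (inverse a) * p) = p"
  using assms by (simp_all flip: mult.assoc const_mult)

lemma const_dvd: "a \<noteq> 0 \<Longrightarrow> const a dvd p"
  by (metis const_mult_inverse(2) dvd_triv_left)

lemma dvd_const_mult_iff: "a \<noteq> 0 \<Longrightarrow> p dvd const a * q \<longleftrightarrow> p dvd q"
  by (metis const_mult_inverse(1) dvd_mult)

lemma single_eq: "Poly_Mapping.single m a = const a * (\<Prod>i\<in>UNIV. var i ^ Poly_Mapping.lookup m i)"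
  by (rule spoly_eqI) (simp add: monomial_eval_def)

lemma spoly_induct [case_names const var add mult]:
  assumes "\<And>a. P (const a)" "\<And>i. P (var i)"
    "\<And>p q. P p \<Longrightarrow> P q \<Longrightarrow> P (p + q)" "\<And>p q. P p \<Longrightarrow> P q \<Longrightarrow> P (p * q)"
  shows "P p"
proof (induction p rule: spoly_additive_induct)
  case (1 m a)
  have pw: "P (var i ^ k)" for i k
    by (induction k) (use assms(1)[of 1] in \<open>auto intro: assms\<close>)
  show ?case
    unfolding single_eq UNIV_3 by (auto intro!: assms pw)
qed (rule assms)

definition psubst :: "(3 \<Rightarrow> spoly) \<Rightarrow> spoly \<Rightarrow> spoly" where
  "psubst g p = (\<Sum>m\<in>Poly_Mapping.keys p.
     const (Poly_Mapping.lookup p m) * (\<Prod>i\<in>UNIV. g i ^ Poly_Mapping.lookup m i))"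

lemma poly_eval_psubst [simp]: "poly_eval (psubst g p) v = poly_eval p (\<chi> i. poly_eval (g i) v)"
  by (simp add: psubst_def poly_eval_def[of p])

lemma psubst_simps [simp]:
  "psubst g (p + q) = psubst g p + psubst g q"
  "psubst g (p - q) = psubst g p - psubst g q"
  "psubst g (p * q) = psubst g p * psubst g q"
  "psubst g (- p) = - psubst g p"
  "psubst g (p ^ n) = psubst g p ^ n"
  "psubst g 0 = 0" "psubst g 1 = 1" "psubst g (const a) = const a" "psubst g (var i) = g i"
  by (rule spoly_eqI; simp)+

lemma psubst_prod [simp]: "psubst g (prod f A) = (\<Prod>a\<in>A. psubst g (f a))"
  by (rule spoly_eqI) simp

section \<open>Homogeneous polynomials\<close>

definition total_degree :: "(3 \<Rightarrow>\<^sub>0 nat) \<Rightarrow> nat" where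
  "total_degree m = (\<Sum>i\<in>UNIV. Poly_Mapping.lookup m i)"

lemma total_degree_add: "total_degree (m + n) = total_degree m + total_degree n"
  by (simp add: total_degree_def lookup_add sum.distrib)

lemma homogeneous_iff: "homogeneous d p \<longleftrightarrow> (\<forall>m\<in>Poly_Mapping.keys p. total_degree m = d)"
  by (simp add: homogeneous_def total_degree_def)

lemma homogeneous_0 [simp]: "homogeneous d 0"
  by (simp add: homogeneous_def)

lemma homogeneous_const [simp]: "homogeneous 0 (const a)"
  by (simp add: homogeneous_def const_def)

lemma homogeneous_1 [simp]: "homogeneous 0 1"
  by (metis homogeneous_const const_1)

lemma homogeneous_var [simp]: "homogeneous (Suc 0) (var i)"
proof -
  have "(\<Sum>j\<in>UNIV. Poly_Mapping.lookup (Poly_Mapping.single i (Suc 0)) j) = (\<Sum>j\<in>UNIV. if j = i then Suc 0 else 0)"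
    by (rule sum.cong) (auto simp: lookup_single when_def)
  then show ?thesis by (simp add: homogeneous_def var_def)
qed

lemma homogeneous_add: "homogeneous d p \<Longrightarrow> homogeneous d q \<Longrightarrow> homogeneous d (p + q)"
  using keys_add[of p q] by (auto simp: homogeneous_def)

lemma homogeneous_uminus: "homogeneous d p \<Longrightarrow> homogeneous d (- p)"
  by (simp add: homogeneous_def in_keys_iff)

lemma homogeneous_diff: "homogeneous d p \<Longrightarrow> homogeneous d q \<Longrightarrow> homogeneous d (p - q)"
  by (metis homogeneous_add homogeneous_uminus uminus_add_conv_diff add.commute)

lemma homogeneous_sum: "(\<And>a. a \<in> A \<Longrightarrow> homogeneous d (f a)) \<Longrightarrow> homogeneous d (sum f A)"
  by (induction A rule: infinite_finite_induct) (auto intro: homogeneous_add)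

lemma homogeneous_mult: "homogeneous d p \<Longrightarrow> homogeneous e q \<Longrightarrow> homogeneous (d + e) (p * q)"
  using keys_mult[of p q] by (auto simp: homogeneous_iff total_degree_add)

lemma homogeneous_const_mult: "homogeneous d p \<Longrightarrow> homogeneous d (const a * p)"
  using homogeneous_mult[of 0 "const a" d p] by simp

lemma homogeneous_power: "homogeneous d p \<Longrightarrow> homogeneous (n * d) (p ^ n)"
  by (induction n) (auto intro: homogeneous_mult)

lemma homogeneous_prod:
  "(\<And>a. a \<in> A \<Longrightarrow> homogeneous (d a) (f a)) \<Longrightarrow> homogeneous (sum d A) (prod f A)"
  by (induction A rule: infinite_finite_induct) (auto intro: homogeneous_mult)

lemma homogeneous_prod_linear:
  assumes "\<And>a. a \<in> A \<Longrightarrow> homogeneous (Suc 0) (f a)"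
  shows "homogeneous (card A) (prod f A)"
  using homogeneous_prod[of A "\<lambda>_. Suc 0" f] assms by simp

lemma homogeneous_degree_unique:
  assumes "homogeneous d p" "homogeneous e p" "p \<noteq> 0"
  shows "d = e"
proof -
  obtain m where "m \<in> Poly_Mapping.keys p"
    using assms(3) by (metis all_not_in_conv keys_eq_empty)
  then show ?thesis using assms by (auto simp: homogeneous_def)
qed

lemma homogeneous_degree_0:
  assumes "homogeneous 0 p"
  shows "p = const (poly_eval p 0)"
proof -
  have k: "Poly_Mapping.keys p \<subseteq> {0}"
  proof
    fix m assume "m \<in> Poly_Mapping.keys p"
    then have "total_degree m = 0" using assms by (auto simp: homogeneous_iff)
    then have "m = 0" by (intro poly_mapping_eqI) (auto simp: total_degree_def)
    then show "m \<in> {0}" by simp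
  qed
  have "p = const (Poly_Mapping.lookup p 0)"
    unfolding const_def
    by (rule poly_mapping_eqI) (use k in \<open>auto simp: lookup_single when_def in_keys_iff\<close>)
  then show ?thesis
    by (metis poly_eval_const)
qed

lemma homogeneous_psubst:
  assumes "homogeneous d p" "\<And>i. homogeneous (Suc 0) (g i)"
  shows "homogeneous d (psubst g p)"
  unfolding psubst_def
proof (rule homogeneous_sum)
  fix m assume m: "m \<in> Poly_Mapping.keys p"
  have "homogeneous (total_degree m) (\<Prod>i\<in>UNIV. g i ^ Poly_Mapping.lookup m i)"
    unfolding total_degree_def
    by (rule homogeneous_prod) (use assms(2) homogeneous_power[of "Suc 0"] in fastforce)
  then show "homogeneous d (const (Poly_Mapping.lookup p m) * (\<Prod>i\<in>UNIV. g i ^ Poly_Mapping.lookup m i))"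
    using m assms(1) by (auto simp: homogeneous_iff[of d p] intro: homogeneous_const_mult)
qed

definition hcomp :: "nat \<Rightarrow> spoly \<Rightarrow> spoly" where
  "hcomp d p = (\<Sum>m\<in>{m\<in>Poly_Mapping.keys p. total_degree m = d}. Poly_Mapping.single m (Poly_Mapping.lookup p m))"

lemma lookup_hcomp: "Poly_Mapping.lookup (hcomp d p) m = (if total_degree m = d then Poly_Mapping.lookup p m else 0)"
proof -
  have "Poly_Mapping.lookup (hcomp d p) m =
      (\<Sum>n\<in>{n\<in>Poly_Mapping.keys p. total_degree n = d}. if n = m then Poly_Mapping.lookup p n else 0)"
    unfolding hcomp_def lookup_sum by (rule sum.cong) (auto simp: lookup_single when_def)
  then show ?thesis
    by (auto simp: in_keys_iff)
qed

lemma hcomp_add [simp]: "hcomp d (p + q) = hcomp d p + hcomp d q"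
  by (rule poly_mapping_eqI) (simp add: lookup_hcomp lookup_add)

lemma hcomp_0 [simp]: "hcomp d 0 = 0"
  by (rule poly_mapping_eqI) (simp add: lookup_hcomp)

lemma hcomp_sum [simp]: "hcomp d (sum f A) = (\<Sum>a\<in>A. hcomp d (f a))"
  by (induction A rule: infinite_finite_induct) auto

lemma homogeneous_hcomp [simp]: "homogeneous d (hcomp d p)"
  by (auto simp: homogeneous_iff in_keys_iff lookup_hcomp split: if_splits)

lemma hcomp_homogeneous: "homogeneous e p \<Longrightarrow> hcomp d p = (if d = e then p else 0)"
  by (rule poly_mapping_eqI) (auto simp: lookup_hcomp homogeneous_iff in_keys_iff)

lemma hcomp_id_iff: "hcomp d p = p \<longleftrightarrow> homogeneous d p"
  by (metis hcomp_homogeneous homogeneous_hcomp)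

lemma sum_hcomp:
  obtains N where "p = (\<Sum>d\<le>N. hcomp d p)" "\<And>d. d > N \<Longrightarrow> hcomp d p = 0"
proof -
  obtain N where "\<forall>n\<in>total_degree ` Poly_Mapping.keys p. n \<le> N"
    by (metis finite_imageI finite_keys finite_nat_set_iff_bounded_le)
  then have N: "\<And>m. m \<in> Poly_Mapping.keys p \<Longrightarrow> total_degree m \<le> N" by blast
  show thesis
  proof (rule that[of N])
    show "p = (\<Sum>d\<le>N. hcomp d p)"
      by (rule poly_mapping_eqI) (use N in \<open>auto simp: lookup_sum lookup_hcomp in_keys_iff\<close>)
    show "hcomp d p = 0" if "d > N" for d
      by (rule poly_mapping_eqI) (use N that in \<open>force simp: lookup_hcomp in_keys_iff\<close>)
  qed
qed

lemma spoly_eq_hcompI: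
  assumes "\<And>d. hcomp d p = hcomp d q"
  shows "p = q"
  by (rule poly_mapping_eqI) (metis assms lookup_hcomp)

text \<open>The degree \<open>d\<close> part of \<open>S(-e)\<close>.\<close>

definition shifted_homogeneous :: "nat \<Rightarrow> nat \<Rightarrow> spoly \<Rightarrow> bool" where
  "shifted_homogeneous e d p \<longleftrightarrow> (if e \<le> d then homogeneous (d - e) p else p = 0)"

definition shifted_hcomp :: "nat \<Rightarrow> nat \<Rightarrow> spoly \<Rightarrow> spoly" where
  "shifted_hcomp e d p = (if e \<le> d then hcomp (d - e) p else 0)"

lemma shifted_homogeneous_hcomp [simp]: "shifted_homogeneous e d (shifted_hcomp e d p)"
  by (simp add: shifted_homogeneous_def shifted_hcomp_def)

lemma shifted_hcomp_id_iff: "shifted_hcomp e d p = p \<longleftrightarrow> shifted_homogeneous e d p"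
  by (auto simp: shifted_homogeneous_def shifted_hcomp_def hcomp_id_iff)

text \<open>Multiplication by \<open>p\<close> moves every component of \<open>q\<close> up by
  \<open>e\<close>. The shifted component covers \<open>d < e\<close>, where nothing
  remains.\<close>

lemma hcomp_mult:
  assumes "homogeneous e p"
  shows "hcomp d (p * q) = p * shifted_hcomp e d q"
proof -
  obtain N where N: "q = (\<Sum>i\<le>N. hcomp i q)" "\<And>i. i > N \<Longrightarrow> hcomp i q = 0"
    using sum_hcomp by blast
  have "hcomp d (p * q) = (\<Sum>i\<le>N. hcomp d (p * hcomp i q))"
    by (subst N(1)) (simp add: sum_distrib_left)
  also have "\<dots> = (\<Sum>i\<le>N. if i = d - e then (if e \<le> d then p * hcomp i q else 0) else 0)"
    by (rule sum.cong) (auto simp: hcomp_homogeneous[OF homogeneous_mult[OF assms homogeneous_hcomp]])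
  also have "\<dots> = p * shifted_hcomp e d q"
    using N(2)[of "d - e"] by (auto simp: shifted_hcomp_def not_le)
  finally show ?thesis .
qed

lemma shifted_homogeneous_mult:
  "homogeneous e p \<Longrightarrow> shifted_homogeneous e d q \<Longrightarrow> homogeneous d (p * q)"
  by (metis hcomp_id_iff hcomp_mult shifted_hcomp_id_iff)

text \<open>The degree \<open>d\<close> component of \<open>p * q\<close> is \<open>p\<close> times
  a component of \<open>q\<close>; cancelling \<open>p\<close> identifies that component with
  \<open>q\<close>.\<close>

lemma homogeneous_mult_cancel:
  assumes "homogeneous d (p * q)" "homogeneous e p" "p \<noteq> 0"
  shows "shifted_homogeneous e d q"
  by (metis assms hcomp_id_iff hcomp_mult mult_left_cancel shifted_hcomp_id_iff)

lemma homogeneous_mult_cancel':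
  assumes "homogeneous d (p * q)" "homogeneous e p" "p * q \<noteq> 0"
  shows "e \<le> d" "homogeneous (d - e) q"
  using homogeneous_mult_cancel[OF assms(1,2)] assms(3)
  by (auto simp: shifted_homogeneous_def split: if_splits)

text \<open>Serves to recognise the excess factor in Saito's determinant as a nonzero
  constant.\<close>

lemma is_unit_spoly_iff: "p dvd 1 \<longleftrightarrow> (\<exists>a. a \<noteq> 0 \<and> p = const a)" for p :: spoly
proof
  assume "p dvd 1"
  then obtain q where pq: "p * q = 1" by (metis dvd_def)
  have nz: "p \<noteq> 0" "q \<noteq> 0" using pq by auto
  text \<open>The top degree components multiply to the top degree component of the product.\<close>
  have ex: "\<exists>d. hcomp d r \<noteq> 0 \<and> (\<forall>e>d. hcomp e r = 0)" if r: "r \<noteq> 0" for r :: spoly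
  proof -
    obtain N where N: "r = (\<Sum>i\<le>N. hcomp i r)" "\<And>i. i > N \<Longrightarrow> hcomp i r = 0"
      using sum_hcomp by blast
    have "\<exists>d. hcomp d r \<noteq> 0" using spoly_eq_hcompI[of r 0] r by auto
    then obtain d0 where "hcomp d0 r \<noteq> 0" by blast
    moreover have "\<forall>d. hcomp d r \<noteq> 0 \<longrightarrow> d < Suc N" using N(2) by (meson less_Suc_eq_le not_le)
    ultimately have "\<exists>d. hcomp d r \<noteq> 0 \<and> (\<forall>e. hcomp e r \<noteq> 0 \<longrightarrow> e \<le> d)"
      by (rule ex_has_greatest_nat[of "\<lambda>d. hcomp d r \<noteq> 0" d0 "\<lambda>d. d" "Suc N"])
    then show ?thesis using not_le by blast
  qed
  obtain d where d: "hcomp d p \<noteq> 0" "\<And>e. e > d \<Longrightarrow> hcomp e p = 0" using ex[OF nz(1)] by blast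
  obtain e where e: "hcomp e q \<noteq> 0" "\<And>i. i > e \<Longrightarrow> hcomp i q = 0" using ex[OF nz(2)] by blast
  obtain N where N: "p = (\<Sum>i\<le>N. hcomp i p)" "\<And>i. i > N \<Longrightarrow> hcomp i p = 0" using sum_hcomp by blast
  have "hcomp (d + e) (p * q) = (\<Sum>i\<le>N. hcomp (d + e) (hcomp i p * q))"
    by (subst N(1)) (simp add: sum_distrib_right)
  also have "\<dots> = (\<Sum>i\<le>N. hcomp i p * shifted_hcomp i (d + e) q)"
    by (simp add: hcomp_mult[OF homogeneous_hcomp])
  also have "\<dots> = (\<Sum>i\<le>N. if i = d then hcomp d p * hcomp e q else 0)"
  proof (rule sum.cong)
    fix i
    consider "i < d" | "i = d" | "i > d" by linarith
    then show "hcomp i p * shifted_hcomp i (d + e) q = (if i = d then hcomp d p * hcomp e q else 0)"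
      by cases (use d(2) e(2) in \<open>auto simp: shifted_hcomp_def\<close>)
  qed simp
  also have "\<dots> = hcomp d p * hcomp e q"
    using N(2)[of d] by (auto simp: not_le)
  finally have "hcomp (d + e) (1::spoly) \<noteq> 0" using d(1) e(1) pq by simp
  then have "d = 0" by (auto simp: hcomp_homogeneous[OF homogeneous_1] split: if_splits)
  have "hcomp i p = hcomp i (hcomp 0 p)" for i
    using d(2)[of i] \<open>d = 0\<close> by (cases "i = 0") (simp_all add: hcomp_homogeneous[OF homogeneous_hcomp])
  then have "p = hcomp 0 p" by (rule spoly_eq_hcompI)
  then have "homogeneous 0 p" by (metis hcomp_id_iff)
  then have p: "p = const (poly_eval p 0)" by (rule homogeneous_degree_0)
  moreover have "poly_eval p 0 \<noteq> 0"
  proof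
    assume "poly_eval p 0 = 0"
    then have "p = const 0" using p by (rule subst)
    then show False using nz by simp
  qed
  ultimately show "\<exists>a. a \<noteq> 0 \<and> p = const a" by blast
next
  assume "\<exists>a. a \<noteq> 0 \<and> p = const a"
  then show "p dvd 1" using const_dvd by blast
qed

section \<open>Linear algebra of triples and restriction of polynomials to a line\<close>

section \<open>Vector algebra in three dimensions\<close>

definition vdot :: "'a::comm_ring_1^3 \<Rightarrow> 'a^3 \<Rightarrow> 'a" where
  "vdot x y = (\<Sum>i\<in>UNIV. x $ i * y $ i)"

definition vcross :: "'a::comm_ring_1^3 \<Rightarrow> 'a^3 \<Rightarrow> 'a^3" where
  "vcross x y = vector [x $ 2 * y $ 3 - x $ 3 * y $ 2, x $ 3 * y $ 1 - x $ 1 * y $ 3, x $ 1 * y $ 2 - x $ 2 * y $ 1]"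

definition det3 :: "'a::comm_ring_1^3 \<Rightarrow> 'a^3 \<Rightarrow> 'a^3 \<Rightarrow> 'a" where
  "det3 x y z = vdot x (vcross y z)"

lemma vdot_3: "vdot x y = x $ 1 * y $ 1 + x $ 2 * y $ 2 + x $ 3 * y $ 3"
  by (simp add: vdot_def sum_3)

lemma vcross_components [simp]:
  "vcross x y $ 1 = x $ 2 * y $ 3 - x $ 3 * y $ 2"
  "vcross x y $ 2 = x $ 3 * y $ 1 - x $ 1 * y $ 3"
  "vcross x y $ 3 = x $ 1 * y $ 2 - x $ 2 * y $ 1"
  by (simp_all add: vcross_def)

lemmas vec3_defs = vdot_3 det3_def vec_eq_iff[where 'b = 3] forall_3

lemma vdot_simps:
  "vdot x (y + z) = vdot x y + vdot x z" "vdot (x + y) z = vdot x z + vdot y z"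
  "vdot x (y - z) = vdot x y - vdot x z"
  "vdot x (a *s y) = a * vdot x y" "vdot (a *s x) y = a * vdot x y" "vdot x 0 = 0" "vdot 0 x = 0"
  by (simp_all add: vdot_3 algebra_simps)

lemma vdot_commute: "vdot x y = vdot y x"
  by (simp add: vdot_3 algebra_simps)

lemma vcross_simps:
  "vcross x (y + z) = vcross x y + vcross x z" "vcross (x + y) z = vcross x z + vcross y z"
  "vcross x (y - z) = vcross x y - vcross x z" "vcross (x - y) z = vcross x z - vcross y z"
  "vcross x (a *s y) = a *s vcross x y" "vcross (a *s x) y = a *s vcross x y"
  "vcross x 0 = 0" "vcross 0 x = 0" "vcross x x = 0"
  by (simp_all add: vec3_defs algebra_simps)

lemma vcross_anticommute: "vcross x y = - vcross y x"
  by (simp add: vec3_defs)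

lemma det3_simps:
  "det3 u x (y + z) = det3 u x y + det3 u x z" "det3 u (x + y) z = det3 u x z + det3 u y z"
  "det3 u x (y - z) = det3 u x y - det3 u x z" "det3 u (x - y) z = det3 u x z - det3 u y z"
  "det3 u x (a *s y) = a * det3 u x y" "det3 u (a *s x) y = a * det3 u x y"
  "det3 u x 0 = 0" "det3 u 0 x = 0" "det3 u x x = 0" "det3 u u x = 0" "det3 u x u = 0"
  by (simp_all add: vec3_defs algebra_simps)

lemma det3_swap: "det3 u x y = - det3 u y x" "det3 u x y = - det3 x u y"
  by (simp_all add: vec3_defs algebra_simps)

lemma det3_rotate: "det3 x y z = vdot (vcross x y) z"
  by (simp add: vec3_defs algebra_simps)

lemma vcross_vcross: "vcross c (vcross x y) = vdot c y *s x - vdot c x *s y"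
  by (simp add: vec3_defs algebra_simps)

lemma vdot_vcross_self [simp]: "vdot x (vcross x y) = 0" "vdot y (vcross x y) = 0"
  by (simp_all add: vec3_defs algebra_simps)

text \<open>Cramer's rule: four vectors of length three satisfy the relation whose coefficients are
  the signed minors, over any commutative ring. It supplies both the coefficients in a Saito basis
  and the relation between three basis elements.\<close>

lemma det3_four_vectors:
  "det3 b c d *s a - det3 a c d *s b + det3 a b d *s c - det3 a b c *s d = 0"
  by (simp add: vec3_defs algebra_simps)

text \<open>The functional \<open>vdot c\<close> applied to the relation between \<open>z\<close>,
  \<open>u\<close>, \<open>x\<close> and \<open>y\<close> given by their minors.\<close>

lemma vdot_mult_det3:
  "vdot c z * det3 u x y = vdot c u * det3 z x y + vdot c x * det3 u z y + vdot c y * det3 u x z"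
  by (simp add: vec3_defs algebra_simps)

definition vmap :: "('a \<Rightarrow> 'b) \<Rightarrow> 'a^3 \<Rightarrow> 'b^3" where
  "vmap f x = (\<chi> i. f (x $ i))"

lemma vmap_nth [simp]: "vmap f x $ i = f (x $ i)"
  by (simp add: vmap_def)

abbreviation cvec :: "complex^3 \<Rightarrow> spoly^3" where
  "cvec \<equiv> vmap const"

definition euler_vec :: "spoly^3" where
  "euler_vec = (\<chi> i. var i)"

lemma euler_vec_nth [simp]: "euler_vec $ i = var i"
  by (simp add: euler_vec_def)

lemma euler_vec_nonzero: "euler_vec \<noteq> 0"
proof
  assume "euler_vec = 0"
  then have "poly_eval (euler_vec $ 1) 1 = 0" by (metis poly_eval_0 zero_index)
  then show False by simp
qed

lemma linear_form_eq: "linear_form c = vdot (cvec c) euler_vec"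
  by (simp add: linear_form_def vdot_def)

lemma cvec_simps:
  "cvec (a + b) = cvec a + cvec b" "cvec (t *s a) = const t *s cvec a" "cvec 0 = 0"
  "vdot (cvec a) (cvec b) = const (vdot a b)" "vcross (cvec a) (cvec b) = cvec (vcross a b)"
  by (simp_all add: vec3_defs const_add const_mult const_diff)

lemma vmap_psubst_cvec [simp]: "vmap (psubst g) (cvec a) = cvec a"
  by (simp add: vec_eq_iff)

lemma vmap_psubst:
  "vmap (psubst g) (x + y) = vmap (psubst g) x + vmap (psubst g) y"
  "vmap (psubst g) (x - y) = vmap (psubst g) x - vmap (psubst g) y"
  "vmap (psubst g) (a *s x) = psubst g a *s vmap (psubst g) x"
  "psubst g (vdot x y) = vdot (vmap (psubst g) x) (vmap (psubst g) y)"
  "vmap (psubst g) (vcross x y) = vcross (vmap (psubst g) x) (vmap (psubst g) y)"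
  "psubst g (det3 x y z) = det3 (vmap (psubst g) x) (vmap (psubst g) y) (vmap (psubst g) z)"
  by (simp_all add: vec3_defs)

lemma ex_vdot_1:
  fixes c :: "complex^3"
  assumes "c \<noteq> 0"
  obtains w where "vdot c w = 1"
proof -
  obtain i where "c $ i \<noteq> 0" using assms by (auto simp: vec_eq_iff)
  then have "vdot c (axis i (inverse (c $ i))) = 1"
    by (simp add: vdot_def axis_def if_distrib cong: if_cong)
  then show ?thesis using that by blast
qed

lemma vdot_all_0:
  fixes c :: "complex^3"
  assumes "\<And>v. vdot c v = 0"
  shows "c = 0"
  by (rule ccontr) (metis assms ex_vdot_1 zero_neq_one)

lemma vcross_eq_0_iff:
  fixes c k :: "complex^3"
  assumes "c \<noteq> 0"
  shows "vcross c k = 0 \<longleftrightarrow> (\<exists>t. k = t *s c)"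
proof
  assume 0: "vcross c k = 0"
  obtain w where w: "vdot c w = 1" using assms ex_vdot_1 by blast
  have "vdot w k *s c - k = vcross w (vcross c k)"
    unfolding vcross_vcross using w by (simp add: vdot_commute)
  then have "k = vdot w k *s c" using 0 by (simp add: vcross_simps)
  then show "\<exists>t. k = t *s c" ..
qed (auto simp: vcross_simps)

section \<open>Linear forms and restriction to a line\<close>

lemma poly_eval_linear_form [simp]: "poly_eval (linear_form c) v = vdot c v"
  by (simp add: linear_form_def vdot_def)

lemma homogeneous_linear_form [simp]: "homogeneous (Suc 0) (linear_form c)"
  unfolding linear_form_def by (intro homogeneous_sum homogeneous_const_mult homogeneous_var)

lemma linear_form_eq_0_iff [simp]: "linear_form c = 0 \<longleftrightarrow> c = 0"
proof
  assume "linear_form c = 0"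
  then have "vdot c v = 0" for v by (metis poly_eval_linear_form poly_eval_0)
  then show "c = 0" by (rule vdot_all_0)
qed (simp add: linear_form_def)

lemma linear_form_simps:
  "linear_form (a + b) = linear_form a + linear_form b"
  "linear_form (a - b) = linear_form a - linear_form b"
  "linear_form (t *s a) = const t * linear_form a"
  by (rule spoly_eqI; simp add: vdot_3 algebra_simps)+

text \<open>Substitution of the projection along \<open>w\<close> onto the plane \<open>c = 0\<close>, for \<open>vdot c w = 1\<close>.\<close>

definition along :: "complex^3 \<Rightarrow> complex^3 \<Rightarrow> spoly \<Rightarrow> spoly" where
  "along c w = psubst (\<lambda>i. var i - const (w $ i) * linear_form c)"

lemma poly_eval_along: "poly_eval (along c w p) v = poly_eval p (v - vdot c v *s w)"
  by (simp add: along_def vector_scalar_mult_def minus_vec_def algebra_simps)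

lemma homogeneous_along: "homogeneous d p \<Longrightarrow> homogeneous d (along c w p)"
  unfolding along_def
  by (erule homogeneous_psubst) (intro homogeneous_diff homogeneous_const_mult homogeneous_var homogeneous_linear_form)

text \<open>The substitution fixes constants and changes variables by multiples of
  \<open>linear_form c\<close>, and congruences are stable under sums and products.\<close>

lemma dvd_diff_along: "linear_form c dvd p - along c w p"
proof (induction p rule: spoly_induct)
  case (add p q)
  have "p + q - along c w (p + q) = (p - along c w p) + (q - along c w q)"
    by (simp add: along_def)
  then show ?case using add by (metis dvd_add)
next
  case (mult p q)
  have "p * q - along c w (p * q) = (p - along c w p) * q + along c w p * (q - along c w q)"
    by (simp add: along_def algebra_simps)
  then show ?case using mult by (metis dvd_add dvd_mult dvd_mult2)
qed (simp_all add: along_def)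

lemma along_linear_form: "along c w (linear_form k) = linear_form (k - vdot k w *s c)"
  by (rule spoly_eqI) (simp add: poly_eval_along vdot_3 algebra_simps)

text \<open>The kernel of the substitution is the ideal of the line, so its image is a copy of the
  coordinate ring of the line inside the polynomial ring.\<close>

lemma dvd_iff_along:
  assumes "vdot c w = 1"
  shows "linear_form c dvd p \<longleftrightarrow> along c w p = 0"
proof
  assume "linear_form c dvd p"
  then obtain q where "p = linear_form c * q" by blast
  then have "along c w p = along c w (linear_form c) * along c w q" by (simp add: along_def)
  then show "along c w p = 0" by (simp add: along_linear_form assms)
next
  assume "along c w p = 0"
  then show "linear_form c dvd p" using dvd_diff_along[of c p w] by simp
qed

lemma along_simps [simp]:
  "along c w (p + q) = along c w p + along c w q" "along c w (p - q) = along c w p - along c w q"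
  "along c w (p * q) = along c w p * along c w q" "along c w (const a) = const a"
  "along c w 0 = 0" "along c w 1 = 1" "along c w (- p) = - along c w p"
  by (simp_all add: along_def)

lemma along_along: "vdot c w = 1 \<Longrightarrow> along c w (along c w p) = along c w p"
  using dvd_iff_along[of c w "p - along c w p"] dvd_diff_along[of c p w] by simp

text \<open>The projection along \<open>w\<close> takes values in the plane \<open>c = 0\<close>, so
  a polynomial vanishing on that plane is killed by the substitution.\<close>

lemma linear_form_dvd_iff_vanishes:
  assumes "c \<noteq> 0"
  shows "linear_form c dvd p \<longleftrightarrow> (\<forall>v. vdot c v = 0 \<longrightarrow> poly_eval p v = 0)"
proof
  assume "linear_form c dvd p"
  then show "\<forall>v. vdot c v = 0 \<longrightarrow> poly_eval p v = 0" by auto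
next
  assume *: "\<forall>v. vdot c v = 0 \<longrightarrow> poly_eval p v = 0"
  obtain w where w: "vdot c w = 1" using assms ex_vdot_1 by blast
  have "along c w p = 0"
    by (rule spoly_eq_0I) (use * w in \<open>simp add: poly_eval_along vdot_simps\<close>)
  then show "linear_form c dvd p" using dvd_iff_along[OF w] by simp
qed

lemma linear_form_not_unit: "c \<noteq> 0 \<Longrightarrow> \<not> linear_form c dvd 1"
  using linear_form_dvd_iff_vanishes[of c 1] by (metis poly_eval_1 vdot_simps(6) zero_neq_one)

text \<open>Linear forms are prime: the substitution is a ring homomorphism into an integral domain
  with kernel generated by the form.\<close>

lemma linear_form_dvd_mult_iff:
  assumes "c \<noteq> 0"
  shows "linear_form c dvd p * q \<longleftrightarrow> linear_form c dvd p \<or> linear_form c dvd q"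
proof -
  obtain w where w: "vdot c w = 1" using assms ex_vdot_1 by blast
  show ?thesis unfolding dvd_iff_along[OF w] by (simp add: along_def)
qed

lemma linear_form_dvd_prod_iff:
  assumes "c \<noteq> 0" "finite A"
  shows "linear_form c dvd prod f A \<longleftrightarrow> (\<exists>a\<in>A. linear_form c dvd f a)"
  using assms(2)
  by (induction A rule: finite_induct) (use assms(1) linear_form_not_unit in \<open>auto simp: linear_form_dvd_mult_iff\<close>)

lemma linear_form_dvd_linear_form_iff:
  assumes "c \<noteq> 0"
  shows "linear_form c dvd linear_form k \<longleftrightarrow> vcross c k = 0"
proof
  assume "linear_form c dvd linear_form k"
  then have *: "vdot k v = 0" if "vdot c v = 0" for v
    using linear_form_dvd_iff_vanishes[OF assms, of "linear_form k"] that by simp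
  have "vdot k (vcross c u) = 0" for u by (rule *) simp
  then have "vdot (vcross k c) u = 0" for u
    using det3_rotate[of k c u] by (simp add: det3_def)
  then have "vcross k c = 0" by (rule vdot_all_0)
  then show "vcross c k = 0" using vcross_anticommute[of c k] by simp
next
  assume "vcross c k = 0"
  then obtain t where "k = t *s c" using vcross_eq_0_iff[OF assms] by blast
  then show "linear_form c dvd linear_form k" by (simp add: linear_form_simps)
qed

text \<open>Primality of the single factors suffices, so proportional factors are allowed. This
  matters for the restrictions of several lines through one point of a given line.\<close>

lemma prod_linear_forms_dvd_cancel:
  assumes "finite A" "\<And>a. a \<in> A \<Longrightarrow> f a \<noteq> 0" "\<And>a. a \<in> A \<Longrightarrow> \<not> linear_form (f a) dvd p"
    "(\<Prod>a\<in>A. linear_form (f a)) dvd p * q"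
  shows "(\<Prod>a\<in>A. linear_form (f a)) dvd q"
  using assms
proof (induction A arbitrary: q rule: finite_induct)
  case (insert a A)
  have "linear_form (f a) dvd p * q" using insert.prems(3) insert.hyps by (auto dest: dvd_mult_left)
  then have "linear_form (f a) dvd q" using insert.prems(1,2) linear_form_dvd_mult_iff by blast
  then obtain r where r: "q = linear_form (f a) * r" by blast
  have "linear_form (f a) * (\<Prod>a\<in>A. linear_form (f a)) dvd linear_form (f a) * (p * r)"
    using insert.prems(3) insert.hyps by (simp add: r mult.left_commute)
  then have "(\<Prod>a\<in>A. linear_form (f a)) dvd p * r" using insert.prems(1)[of a] by simp
  then have "(\<Prod>a\<in>A. linear_form (f a)) dvd r"
    using insert.IH insert.prems(1,2) by blast
  then show ?case by (simp add: r insert.hyps)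
qed simp

lemma prod_linear_forms_dvd:
  assumes "finite A" "\<And>a. a \<in> A \<Longrightarrow> f a \<noteq> 0" "\<And>a b. a \<in> A \<Longrightarrow> b \<in> A \<Longrightarrow> a \<noteq> b \<Longrightarrow> vcross (f a) (f b) \<noteq> 0"
    "\<And>a. a \<in> A \<Longrightarrow> linear_form (f a) dvd p"
  shows "(\<Prod>a\<in>A. linear_form (f a)) dvd p"
  using assms
proof (induction A rule: finite_induct)
  case (insert a A)
  obtain q where q: "p = linear_form (f a) * q" using insert.prems(3) by blast
  have "(\<Prod>a\<in>A. linear_form (f a)) dvd q"
  proof (rule prod_linear_forms_dvd_cancel[OF insert.hyps(1)])
    show "\<not> linear_form (f b) dvd linear_form (f a)" if "b \<in> A" for b
      using insert.prems(1,2) insert.hyps(2) that by (subst linear_form_dvd_linear_form_iff) auto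
    show "(\<Prod>a\<in>A. linear_form (f a)) dvd linear_form (f a) * q"
      using insert.IH insert.prems q by (metis insertCI)
  qed (use insert.prems(1) in auto)
  then show ?case by (simp add: q insert.hyps)
qed simp

section \<open>Derivations as polynomial vectors and Saito's criterion\<close>

section \<open>Derivations\<close>

lemma monomial_eval_remove:
  "monomial_eval m v = (v $ i) ^ Poly_Mapping.lookup m i * (\<Prod>j\<in>UNIV - {i}. (v $ j) ^ Poly_Mapping.lookup m j)"
  unfolding monomial_eval_def by (simp add: prod.remove[of UNIV i])

text \<open>Ties the formal derivative to the analytic one along a coordinate line; the product rule
  then comes from calculus and the uniqueness of derivatives.\<close>

lemma poly_eval_partial_deriv:
  "((\<lambda>t. poly_eval p (\<chi> j. if j = i then t else v $ j)) has_field_derivative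
     poly_eval (partial_deriv i p) v) (at (v $ i))"
proof -
  define R where "R m = (\<Prod>j\<in>UNIV - {i}. (v $ j) ^ Poly_Mapping.lookup m j)" for m
  have 1: "poly_eval p (\<chi> j. if j = i then t else v $ j) =
      (\<Sum>m\<in>Poly_Mapping.keys p. Poly_Mapping.lookup p m * (t ^ Poly_Mapping.lookup m i * R m))" for t
  proof -
    have "monomial_eval m (\<chi> j. if j = i then t else v $ j) = t ^ Poly_Mapping.lookup m i * R m" for m
      unfolding monomial_eval_remove[of m _ i] R_def by simp
    then show ?thesis by (simp add: poly_eval_superset[of "Poly_Mapping.keys p"])
  qed
  have "monomial_eval (m - Poly_Mapping.single i 1) v = (v $ i) ^ (Poly_Mapping.lookup m i - 1) * R m" for m
    unfolding monomial_eval_remove[of _ v i] R_def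
    by (auto simp: lookup_minus lookup_single when_def intro!: prod.cong)
  then have 2: "poly_eval (partial_deriv i p) v = (\<Sum>m\<in>Poly_Mapping.keys p. Poly_Mapping.lookup p m *
      (of_nat (Poly_Mapping.lookup m i) * (v $ i) ^ (Poly_Mapping.lookup m i - 1) * R m))"
    by (simp add: partial_deriv_def algebra_simps)
  show ?thesis
    unfolding 1 2 by (auto intro!: derivative_eq_intros sum.cong simp: algebra_simps)
qed

lemma partial_deriv_eqI:
  assumes "\<And>v. ((\<lambda>t. poly_eval p (\<chi> j. if j = i then t else v $ j)) has_field_derivative
     poly_eval q v) (at (v $ i))"
  shows "partial_deriv i p = q"
  by (rule spoly_eqI) (rule DERIV_unique[OF poly_eval_partial_deriv assms])

lemma vec_update_self: "(\<chi> j. if j = i then v $ i else v $ j) = v"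
  by (simp add: vec_eq_iff)

lemma partial_deriv_simps:
  "partial_deriv i (p + q) = partial_deriv i p + partial_deriv i q"
  "partial_deriv i (p * q) = partial_deriv i p * q + p * partial_deriv i q"
  "partial_deriv i (const a) = 0"
  by (rule partial_deriv_eqI; auto intro!: derivative_eq_intros poly_eval_partial_deriv simp: vec_update_self)+

lemma partial_deriv_var: "partial_deriv i (var j) = (if i = j then 1 else 0)"
  by (rule partial_deriv_eqI; auto intro!: derivative_eq_intros)

lemma partial_deriv_sum: "partial_deriv i (sum f A) = (\<Sum>a\<in>A. partial_deriv i (f a))"
  by (induction A rule: infinite_finite_induct) (auto simp: partial_deriv_simps partial_deriv_def[of _ 0])

lemma homogeneous_partial_deriv:
  assumes "homogeneous (Suc d) p"
  shows "homogeneous d (partial_deriv i p)"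
  unfolding partial_deriv_def
proof (rule homogeneous_sum)
  fix m assume m: "m \<in> Poly_Mapping.keys p"
  show "homogeneous d (Poly_Mapping.single (m - Poly_Mapping.single i 1) (of_nat (Poly_Mapping.lookup m i) * Poly_Mapping.lookup p m))"
  proof (cases "Poly_Mapping.lookup m i = 0")
    case False
    have "m = (m - Poly_Mapping.single i 1) + Poly_Mapping.single i 1"
      by (rule poly_mapping_eqI) (use False in \<open>auto simp: lookup_add lookup_minus lookup_single when_def\<close>)
    then have "total_degree m = total_degree (m - Poly_Mapping.single i 1) + total_degree (Poly_Mapping.single i 1)"
      by (metis total_degree_add)
    moreover have "total_degree (Poly_Mapping.single i 1) = 1"
      using homogeneous_var[of i] by (simp add: homogeneous_iff var_def)
    ultimately show ?thesis using assms m by (auto simp: homogeneous_iff)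
  qed simp
qed

definition der :: "spoly^3 \<Rightarrow> spoly \<Rightarrow> spoly" where
  "der x p = (\<Sum>i\<in>UNIV. x $ i * partial_deriv i p)"

lemma der_simps:
  "der x (p + q) = der x p + der x q" "der x (p * q) = der x p * q + p * der x q"
  "der x (const a) = 0"
  by (simp_all add: der_def partial_deriv_simps algebra_simps sum.distrib sum_distrib_left)

lemma der_var [simp]: "der x (var i) = x $ i"
  by (simp add: der_def partial_deriv_var if_distrib cong: if_cong)

lemma der_sum: "der x (sum f A) = (\<Sum>a\<in>A. der x (f a))"
  by (simp add: der_def partial_deriv_sum sum_distrib_left) (rule sum.swap)

lemma derivation_der: "derivation (der x)"
  by (simp add: derivation_def der_simps)

text \<open>A derivation kills constants, and the variables generate the rest, so its values on the
  three variables determine it.\<close>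

lemma derivation_eq_der:
  assumes "derivation \<theta>"
  shows "\<theta> = der (\<chi> i. \<theta> (var i))"
proof
  fix p
  have 1: "\<theta> (a + b) = \<theta> a + \<theta> b" "\<theta> (const t * a) = const t * \<theta> a" "\<theta> (a * b) = \<theta> a * b + a * \<theta> b" for a b t
    using assms unfolding derivation_def by blast+
  have "\<theta> 1 = 0" using 1(3)[of 1 1] by simp
  then have 2: "\<theta> (const t) = 0" for t using 1(2)[of t 1] by simp
  show "\<theta> p = der (\<chi> i. \<theta> (var i)) p"
    by (induction p rule: spoly_induct) (simp_all add: 1 2 der_simps)
qed

lemma der_inject: "der x = der y \<longleftrightarrow> x = y"
  by (metis der_var vec_eq_iff)

lemma der_add: "der (x + y) p = der x p + der y p"
  and der_scale: "der (f *s x) p = f * der x p"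
  and der_0: "der 0 p = 0"
  by (simp_all add: der_def algebra_simps sum.distrib sum_distrib_left)

lemma euler_derivation_eq: "euler_derivation = der euler_vec"
  by (simp add: fun_eq_iff euler_derivation_def der_def)

lemma der_linear_form: "der x (linear_form c) = vdot (cvec c) x"
  by (simp add: linear_form_def der_sum der_simps vdot_def)

definition vhomogeneous :: "nat \<Rightarrow> spoly^3 \<Rightarrow> bool" where
  "vhomogeneous d x \<longleftrightarrow> (\<forall>i. homogeneous d (x $ i))"

text \<open>Linear forms have constant partial derivatives, so the grading by values on linear forms
  is the grading by the degree of the entries.\<close>

lemma vhomogeneous_iff_der: "(\<forall>l. homogeneous 1 l \<longrightarrow> homogeneous d (der x l)) \<longleftrightarrow> vhomogeneous d x"
proof
  assume "\<forall>l. homogeneous 1 l \<longrightarrow> homogeneous d (der x l)"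
  then show "vhomogeneous d x"
    by (metis der_var homogeneous_var One_nat_def vhomogeneous_def)
next
  assume x: "vhomogeneous d x"
  show "\<forall>l. homogeneous 1 l \<longrightarrow> homogeneous d (der x l)"
    unfolding der_def
  proof (intro allI impI homogeneous_sum)
    fix l i assume "homogeneous 1 l"
    then have "homogeneous 0 (partial_deriv i l)" by (intro homogeneous_partial_deriv) simp
    then show "homogeneous d (x $ i * partial_deriv i l)"
      using x homogeneous_mult[of d "x $ i" 0] by (auto simp: vhomogeneous_def)
  qed
qed

section \<open>Logarithmic vectors and Saito's criterion\<close>

text \<open>The logarithmic derivations in coordinates: \<open>vdot (cvec c) x\<close> is the value
  of \<open>der x\<close> on \<open>linear_form c\<close>, and that form generates the ideal of the
  line.\<close>

definition log_vectors :: "(complex^3) set \<Rightarrow> (spoly^3) set" where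
  "log_vectors C = {x. \<forall>c\<in>C. linear_form c dvd vdot (cvec c) x}"

definition reduced :: "(complex^3) set \<Rightarrow> bool" where
  "reduced C \<longleftrightarrow> finite C \<and> 0 \<notin> C \<and> (\<forall>c\<in>C. \<forall>k\<in>C. c \<noteq> k \<longrightarrow> vcross c k \<noteq> 0)"

definition defining_poly :: "(complex^3) set \<Rightarrow> spoly" where
  "defining_poly C = (\<Prod>c\<in>C. linear_form c)"

text \<open>The determinant condition itself serves as the working notion of freeness. The Euler
  vector is always the third basis element, so \<open>x\<close> and \<open>y\<close> represent a
  basis of the quotient by it.\<close>

definition saito :: "(complex^3) set \<Rightarrow> spoly^3 \<Rightarrow> spoly^3 \<Rightarrow> bool" where
  "saito C x y \<longleftrightarrow> x \<in> log_vectors C \<and> y \<in> log_vectors C \<and> (\<exists>k. k \<noteq> 0 \<and> det3 euler_vec x y = const k * defining_poly C)"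

lemma log_vectorsD: "x \<in> log_vectors C \<Longrightarrow> c \<in> C \<Longrightarrow> linear_form c dvd vdot (cvec c) x"
  by (simp add: log_vectors_def)

lemma log_vectors_add: "x \<in> log_vectors C \<Longrightarrow> y \<in> log_vectors C \<Longrightarrow> x + y \<in> log_vectors C"
  and log_vectors_diff: "x \<in> log_vectors C \<Longrightarrow> y \<in> log_vectors C \<Longrightarrow> x - y \<in> log_vectors C"
  and log_vectors_scale: "x \<in> log_vectors C \<Longrightarrow> f *s x \<in> log_vectors C"
  and log_vectors_0: "0 \<in> log_vectors C"
  and log_vectors_euler_vec: "euler_vec \<in> log_vectors C"
  by (auto simp: log_vectors_def vdot_simps linear_form_eq intro: dvd_add dvd_diff)

lemma log_vectors_mono: "C \<subseteq> D \<Longrightarrow> log_vectors D \<subseteq> log_vectors C"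
  by (auto simp: log_vectors_def)

lemma reduced_subset: "reduced C \<Longrightarrow> D \<subseteq> C \<Longrightarrow> reduced D"
  unfolding reduced_def by (meson finite_subset subsetD)

lemma reduced_finite: "reduced C \<Longrightarrow> finite C"
  and reduced_nonzero: "reduced C \<Longrightarrow> c \<in> C \<Longrightarrow> c \<noteq> 0"
  and reduced_vcross: "reduced C \<Longrightarrow> c \<in> C \<Longrightarrow> k \<in> C \<Longrightarrow> c \<noteq> k \<Longrightarrow> vcross c k \<noteq> 0"
  by (auto simp: reduced_def)

lemma reduced_not_dvd:
  "reduced C \<Longrightarrow> c \<in> C \<Longrightarrow> k \<in> C \<Longrightarrow> c \<noteq> k \<Longrightarrow> \<not> linear_form c dvd linear_form k"
  using linear_form_dvd_linear_form_iff reduced_nonzero reduced_vcross by blast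

lemma defining_poly_nonzero: "reduced C \<Longrightarrow> defining_poly C \<noteq> 0"
  unfolding defining_poly_def using reduced_finite reduced_nonzero by fastforce

lemma homogeneous_defining_poly: "homogeneous (card C) (defining_poly C)"
  unfolding defining_poly_def by (rule homogeneous_prod_linear) simp

lemma defining_poly_remove:
  "reduced C \<Longrightarrow> c \<in> C \<Longrightarrow> defining_poly C = linear_form c * defining_poly (C - {c})"
  unfolding defining_poly_def using reduced_finite by (simp add: prod.remove)

lemma linear_form_dvd_defining_poly: "reduced C \<Longrightarrow> c \<in> C \<Longrightarrow> linear_form c dvd defining_poly C"
  by (metis defining_poly_remove dvd_triv_left)

lemma not_dvd_defining_poly_remove:
  assumes "reduced C" "c \<in> C"
  shows "\<not> linear_form c dvd defining_poly (C - {c})"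
  unfolding defining_poly_def
  using linear_form_dvd_prod_iff[of c "C - {c}" linear_form] reduced_nonzero[OF assms]
    reduced_finite[OF assms(1)] reduced_not_dvd[OF assms] by auto

lemma defining_poly_dvd:
  assumes "reduced C" "\<And>c. c \<in> C \<Longrightarrow> linear_form c dvd p"
  shows "defining_poly C dvd p"
  unfolding defining_poly_def
  by (rule prod_linear_forms_dvd) (use assms reduced_finite reduced_nonzero reduced_vcross in auto)

text \<open>Modulo the form, the three vectors are annihilated by the nonzero functional
  \<open>c\<close> and hence dependent; a vector \<open>w\<close> with value 1 turns this into
  Cramer's rule.\<close>

lemma linear_form_dvd_det3:
  assumes "c \<noteq> 0" "linear_form c dvd vdot (cvec c) x" "linear_form c dvd vdot (cvec c) y"
    "linear_form c dvd vdot (cvec c) z"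
  shows "linear_form c dvd det3 x y z"
proof -
  obtain w where w: "vdot c w = 1" using ex_vdot_1 assms(1) by blast
  have "det3 x y z = vdot (cvec c) (cvec w) * det3 x y z" using w by (simp add: cvec_simps)
  then show ?thesis
    unfolding vdot_mult_det3[of "cvec c" "cvec w" x y z] using assms(2-4) by (auto intro!: dvd_add)
qed

lemma defining_poly_dvd_det3:
  assumes "reduced C" "x \<in> log_vectors C" "y \<in> log_vectors C" "z \<in> log_vectors C"
  shows "defining_poly C dvd det3 x y z"
  by (rule defining_poly_dvd[OF assms(1)])
    (use assms reduced_nonzero in \<open>auto intro!: linear_form_dvd_det3 log_vectorsD\<close>)

text \<open>Cramer's rule writes \<open>det3 euler_vec x y\<close> times \<open>z\<close> as a
  combination with determinants as coefficients. All of these are divisible by the defining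
  polynomial, which can therefore be cancelled and leaves the constant \<open>k\<close>.\<close>

lemma saito_span:
  assumes "reduced C" "saito C x y" "z \<in> log_vectors C"
  shows "\<exists>h p q. z = h *s euler_vec + p *s x + q *s y"
proof -
  obtain k where k: "k \<noteq> 0" "det3 euler_vec x y = const k * defining_poly C"
    and xy: "x \<in> log_vectors C" "y \<in> log_vectors C" using assms(2) by (auto simp: saito_def)
  obtain h where h: "det3 z x y = defining_poly C * h"
    using defining_poly_dvd_det3[OF assms(1,3) xy] by blast
  obtain p where p: "det3 z euler_vec y = defining_poly C * p"
    using defining_poly_dvd_det3[OF assms(1,3) log_vectors_euler_vec xy(2)] by blast
  obtain q where q: "det3 z euler_vec x = defining_poly C * q"
    using defining_poly_dvd_det3[OF assms(1,3) log_vectors_euler_vec xy(1)] by blast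
  have "defining_poly C *s (const k *s z - h *s euler_vec + p *s x - q *s y) = 0"
    using det3_four_vectors[of euler_vec x y z] unfolding k h p q
    by (simp add: vec_eq_iff algebra_simps)
  then have e: "const k *s z - h *s euler_vec + p *s x - q *s y = 0"
    using defining_poly_nonzero[OF assms(1)] by (simp add: vec_eq_iff)
  define j where "j = inverse k"
  have jk: "const j * const k = 1" using k(1) by (simp add: j_def flip: const_mult)
  have "const j *s (const k *s z - h *s euler_vec + p *s x - q *s y) = 0" using e by simp
  then have "(const j * const k) *s z = (const j * h) *s euler_vec + (- const j * p) *s x + (const j * q) *s y"
    by (simp add: vec_eq_iff algebra_simps)
  then have "z = (const j * h) *s euler_vec + (- const j * p) *s x + (const j * q) *s y" by (simp add: jk)
  then show ?thesis by blast
qed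

lemma saito_det_nonzero: "reduced C \<Longrightarrow> saito C x y \<Longrightarrow> det3 euler_vec x y \<noteq> 0"
  using defining_poly_nonzero by (auto simp: saito_def)

lemma saito_indep:
  assumes "reduced C" "saito C x y" "h *s euler_vec + p *s x + q *s y = 0"
  shows "h = 0" "p = 0" "q = 0"
proof -
  note nz = saito_det_nonzero[OF assms(1,2)]
  have "det3 euler_vec (h *s euler_vec + p *s x + q *s y) y = p * det3 euler_vec x y" by (simp add: det3_simps)
  then show p: "p = 0" using nz assms(3) by (simp add: det3_simps)
  have "det3 euler_vec x (h *s euler_vec + p *s x + q *s y) = q * det3 euler_vec x y" by (simp add: det3_simps)
  then show q: "q = 0" using nz assms(3) by (simp add: det3_simps)
  have "h *s euler_vec = 0" using assms(3) p q by simp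
  then show "h = 0" using euler_vec_nonzero by (auto simp: vec_eq_iff)
qed

lemma ex_det3_axis:
  fixes c :: "complex^3"
  assumes "c \<noteq> 0"
  shows "\<exists>i j. det3 c (axis i 1) (axis j 1) \<noteq> 0"
proof -
  have "c $ 1 \<noteq> 0 \<or> c $ 2 \<noteq> 0 \<or> c $ 3 \<noteq> 0" using assms by (simp add: vec_eq_iff forall_3)
  moreover have "det3 c (axis 2 1) (axis 3 1) = c $ 1" "det3 c (axis 3 1) (axis 1 1) = c $ 2"
    "det3 c (axis 1 1) (axis 2 1) = c $ 3"
    by (simp_all add: det3_def vdot_3 axis_def)
  ultimately show ?thesis by metis
qed

text \<open>Each linear factor is prime and does not divide \<open>e\<close>, so it divides the
  cofactor and can be cancelled.\<close>

lemma coprime_prod_linear_forms_unit: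
  assumes "finite A" "\<And>a. a \<in> A \<Longrightarrow> a \<noteq> 0 \<and> \<not> linear_form a dvd e" "e dvd (\<Prod>a\<in>A. linear_form a)"
  shows "e dvd 1"
  using assms
proof (induction A rule: finite_induct)
  case (insert a A)
  obtain r where r: "linear_form a * (\<Prod>a\<in>A. linear_form a) = e * r"
    using insert.prems(2) insert.hyps by (auto simp: dvd_def)
  then have "linear_form a dvd e * r" by (metis dvd_triv_left)
  then have "linear_form a dvd r" using insert.prems(1)[of a] linear_form_dvd_mult_iff[of a e r] by auto
  then obtain s where s: "r = linear_form a * s" by blast
  have "linear_form a * (\<Prod>a\<in>A. linear_form a) = linear_form a * (e * s)"
    unfolding r s by (simp add: algebra_simps)
  then have "(\<Prod>a\<in>A. linear_form a) = e * s" using insert.prems(1)[of a] by simp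
  then have "e dvd (\<Prod>a\<in>A. linear_form a)" by simp
  then show ?case using insert.IH insert.prems(1) by blast
qed simp

text \<open>For each line, constant vectors tangent to it, multiplied by the equations of the other lines,
  have a determinant in which the line occurs only once.\<close>

lemma saitoI:
  assumes "reduced C" "C \<noteq> {}" "x \<in> log_vectors C" "y \<in> log_vectors C"
    and span: "\<And>z. z \<in> log_vectors C \<Longrightarrow> \<exists>h p q. z = h *s euler_vec + p *s x + q *s y"
  shows "saito C x y"
proof -
  have dvd: "det3 euler_vec x y dvd det3 euler_vec z z'" if z: "z \<in> log_vectors C" "z' \<in> log_vectors C" for z z'
  proof -
    obtain h p q where 1: "z = h *s euler_vec + p *s x + q *s y" using span z by blast
    obtain h' p' q' where 2: "z' = h' *s euler_vec + p' *s x + q' *s y" using span z by blast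
    have "det3 euler_vec z z' = (p * q' - q * p') * det3 euler_vec x y"
      unfolding 1 2 by (simp add: det3_simps det3_swap(1)[of euler_vec y x] algebra_simps)
    then show ?thesis by simp
  qed
  obtain e where e: "det3 euler_vec x y = defining_poly C * e"
    using defining_poly_dvd_det3[OF assms(1) log_vectors_euler_vec assms(3,4)] by blast
  \<comment> \<open>The test vectors are multiplied by \<open>R\<close>, so their determinant is a
    constant times \<open>R * R * linear_form c\<close>; cancelling the defining polynomial leaves
    one factor \<open>R\<close> for \<open>e\<close> to divide.\<close>
  have edvd: "e dvd defining_poly (C - {c})" if c: "c \<in> C" for c
  proof -
    have c0: "c \<noteq> 0" using assms(1) c reduced_nonzero by blast
    obtain i j where ij: "det3 c (axis i 1) (axis j 1) \<noteq> 0" using ex_det3_axis[OF c0] by blast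
    define R where "R = defining_poly (C - {c})"
    have R: "R \<noteq> 0" "defining_poly C = linear_form c * R"
      using assms(1) c by (auto simp: R_def defining_poly_remove intro!: defining_poly_nonzero intro: reduced_subset)
    define u where "u = (axis i 1 :: complex^3)"
    define v where "v = (axis j 1 :: complex^3)"
    have in_LD: "R *s cvec (vcross c u) \<in> log_vectors C" for u
      unfolding log_vectors_def
    proof safe
      fix k assume k: "k \<in> C"
      show "linear_form k dvd vdot (cvec k) (R *s cvec (vcross c u))"
      proof (cases "k = c")
        case True
        then show ?thesis by (simp add: vdot_simps cvec_simps)
      next
        case False
        then have "linear_form k dvd R" unfolding R_def
          using k assms(1) by (intro linear_form_dvd_defining_poly) (auto intro: reduced_subset)
        then show ?thesis by (simp add: vdot_simps)
      qed
    qed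
    have "vcross (vcross c u) (vcross c v) = det3 c u v *s c"
      by (simp add: vec3_defs algebra_simps)
    then have "det3 euler_vec (R *s cvec (vcross c u)) (R *s cvec (vcross c v)) = R * R * (const (det3 c u v) * linear_form c)"
      by (simp add: det3_simps) (simp add: det3_def cvec_simps vdot_simps linear_form_eq vdot_commute[of euler_vec] mult.assoc)
    then have "linear_form c * R * e dvd R * R * (const (det3 c u v) * linear_form c)"
      using dvd[OF in_LD in_LD] e R(2) by metis
    then have "(linear_form c * R) * e dvd (linear_form c * R) * (const (det3 c u v) * R)"
      by (simp add: mult_ac)
    then have "e dvd const (det3 c u v) * R"
      using R(1) c0 by (simp only: dvd_mult_cancel_left) auto
    then show ?thesis using ij dvd_const_mult_iff by (auto simp: R_def u_def v_def)
  qed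
  \<comment> \<open>Otherwise \<open>linear_form c\<close> would divide, through \<open>e\<close>,
    the product of the equations of the other lines.\<close>
  have ndvd: "\<not> linear_form c dvd e" if "c \<in> C" for c
    using edvd[OF that] not_dvd_defining_poly_remove[OF assms(1) that] dvd_trans by blast
  obtain c where c: "c \<in> C" using assms(2) by blast
  have "e dvd 1"
    by (rule coprime_prod_linear_forms_unit[OF _ _ edvd[OF c, unfolded defining_poly_def]])
      (use reduced_finite[OF assms(1)] reduced_nonzero[OF assms(1)] ndvd in auto)
  then obtain k where "k \<noteq> 0" "e = const k" using is_unit_spoly_iff by blast
  then show ?thesis using assms(3,4) e by (auto simp: saito_def mult.commute)
qed

section \<open>Homogeneous bases\<close>

lemma vhomogeneous_euler_vec: "vhomogeneous (Suc 0) euler_vec"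
  by (simp add: vhomogeneous_def)

lemma vhomogeneous_cvec: "vhomogeneous 0 (cvec a)"
  by (simp add: vhomogeneous_def)

lemma homogeneous_vdot:
  "vhomogeneous a x \<Longrightarrow> vhomogeneous b y \<Longrightarrow> homogeneous (a + b) (vdot x y)"
  unfolding vdot_def by (intro homogeneous_sum homogeneous_mult) (auto simp: vhomogeneous_def)

lemma vhomogeneous_vcross:
  "vhomogeneous a x \<Longrightarrow> vhomogeneous b y \<Longrightarrow> vhomogeneous (a + b) (vcross x y)"
  unfolding vhomogeneous_def forall_3 vcross_components
  by (intro conjI homogeneous_diff homogeneous_mult) auto

lemma homogeneous_det3:
  "vhomogeneous a x \<Longrightarrow> vhomogeneous b y \<Longrightarrow> vhomogeneous c z \<Longrightarrow> homogeneous (a + (b + c)) (det3 x y z)"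
  unfolding det3_def by (intro homogeneous_vdot vhomogeneous_vcross)

lemma vhomogeneous_add: "vhomogeneous d x \<Longrightarrow> vhomogeneous d y \<Longrightarrow> vhomogeneous d (x + y)"
  and vhomogeneous_diff: "vhomogeneous d x \<Longrightarrow> vhomogeneous d y \<Longrightarrow> vhomogeneous d (x - y)"
  and vhomogeneous_const: "vhomogeneous d x \<Longrightarrow> vhomogeneous d (const t *s x)"
  and vhomogeneous_0: "vhomogeneous d 0"
  by (auto simp: vhomogeneous_def intro: homogeneous_add homogeneous_diff homogeneous_const_mult)

lemma vhomogeneous_scale:
  "vhomogeneous a x \<Longrightarrow> shifted_homogeneous a d p \<Longrightarrow> vhomogeneous d (p *s x)"
  by (auto simp: vhomogeneous_def mult.commute[of p] intro: shifted_homogeneous_mult)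

definition vhcomp :: "nat \<Rightarrow> spoly^3 \<Rightarrow> spoly^3" where
  "vhcomp d = vmap (hcomp d)"

lemma vhomogeneous_vhcomp: "vhomogeneous d (vhcomp d x)"
  by (simp add: vhomogeneous_def vhcomp_def)

lemma vhcomp_id: "vhomogeneous d x \<Longrightarrow> vhcomp d x = x"
  by (simp add: vhomogeneous_def vhcomp_def vec_eq_iff hcomp_id_iff)

lemma vhcomp_add: "vhcomp d (x + y) = vhcomp d x + vhcomp d y"
  by (simp add: vhcomp_def vec_eq_iff)

lemma vhcomp_scale: "vhomogeneous a x \<Longrightarrow> vhcomp d (p *s x) = shifted_hcomp a d p *s x"
  by (simp add: vhomogeneous_def vhcomp_def vec_eq_iff) (metis hcomp_mult mult.commute)

lemma vhcomp_scale': "homogeneous a p \<Longrightarrow> vhcomp d (p *s x) = p *s vmap (shifted_hcomp a d) x"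
  by (simp add: vhcomp_def vec_eq_iff hcomp_mult)

lemma hcomp_vdot_cvec: "hcomp d (vdot (cvec c) x) = vdot (cvec c) (vhcomp d x)"
  by (simp add: vdot_def vhcomp_def hcomp_mult[OF homogeneous_const] shifted_hcomp_def)

lemma log_vectors_vhcomp: 
  assumes "x \<in> log_vectors C"
  shows "vhcomp d x \<in> log_vectors C"
  unfolding log_vectors_def
proof safe
  fix c assume "c \<in> C"
  then obtain q where "vdot (cvec c) x = linear_form c * q" using log_vectorsD[OF assms] by blast
  then have "vdot (cvec c) (vhcomp d x) = linear_form c * shifted_hcomp (Suc 0) d q"
    by (metis hcomp_mult hcomp_vdot_cvec homogeneous_linear_form)
  then show "linear_form c dvd vdot (cvec c) (vhcomp d x)" by simp
qed

lemma vec_sum_vhcomp: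
  obtains N where "x = (\<Sum>d\<le>N. vhcomp d x)"
proof -
  have "\<exists>N. \<forall>M\<ge>N. x $ i = (\<Sum>d\<le>M. hcomp d (x $ i))" for i
  proof -
    obtain N where N: "x $ i = (\<Sum>d\<le>N. hcomp d (x $ i))" "\<And>d. d > N \<Longrightarrow> hcomp d (x $ i) = 0"
      using sum_hcomp by blast
    have "(\<Sum>d\<le>M. hcomp d (x $ i)) = (\<Sum>d\<le>N. hcomp d (x $ i))" if "M \<ge> N" for M
      by (rule sum.mono_neutral_right) (use that N(2) in auto)
    then show ?thesis using N(1) by metis
  qed
  then obtain N where N: "\<And>i M. M \<ge> N i \<Longrightarrow> x $ i = (\<Sum>d\<le>M. hcomp d (x $ i))" by metis
  have "x $ i = (\<Sum>d\<le>Max (range N). vhcomp d x) $ i" for i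
    unfolding sum_component using N[of i "Max (range N)"] by (simp add: vhcomp_def)
  then have "x = (\<Sum>d\<le>Max (range N). vhcomp d x)" by (simp add: vec_eq_iff)
  then show thesis by (rule that)
qed

lemma det3_sum:
  "det3 u (sum f A) y = (\<Sum>a\<in>A. det3 u (f a) y)" "det3 u x (sum f A) = (\<Sum>a\<in>A. det3 u x (f a))"
  by (induction A rule: infinite_finite_induct) (auto simp: det3_simps)

text \<open>The determinant has degree \<open>card C\<close>, so some pair of components of
  \<open>x\<close> and \<open>y\<close> has a determinant contributing in that degree. It is
  divisible by the defining polynomial, which has the same degree, so the quotient is a
  constant.\<close>

lemma saito_homogeneous:
  assumes "reduced C" "saito C x y"
  obtains a b x' y' where "saito C x' y'" "vhomogeneous a x'" "vhomogeneous b y'"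
proof -
  obtain k where k: "k \<noteq> 0" "det3 euler_vec x y = const k * defining_poly C"
    and xy: "x \<in> log_vectors C" "y \<in> log_vectors C" using assms(2) by (auto simp: saito_def)
  obtain N where N: "x = (\<Sum>d\<le>N. vhcomp d x)" using vec_sum_vhcomp by blast
  obtain M where M: "y = (\<Sum>d\<le>M. vhcomp d y)" using vec_sum_vhcomp by blast
  define D where "D i j = det3 euler_vec (vhcomp i x) (vhcomp j y)" for i j
  have D: "det3 euler_vec x y = (\<Sum>i\<le>N. \<Sum>j\<le>M. D i j)"
    by (subst N, subst M) (simp add: det3_sum D_def, rule sum.swap)
  have "hcomp (card C) (det3 euler_vec x y) \<noteq> 0"
    using k hcomp_homogeneous[OF homogeneous_const_mult[OF homogeneous_defining_poly]] defining_poly_nonzero[OF assms(1)]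
    by simp
  then obtain i j where ij: "hcomp (card C) (D i j) \<noteq> 0"
    unfolding D hcomp_sum by (metis (no_types, lifting) sum.neutral)
  have hD: "homogeneous (Suc (i + j)) (D i j)"
    using homogeneous_det3[OF vhomogeneous_euler_vec vhomogeneous_vhcomp vhomogeneous_vhcomp] by (simp add: D_def)
  have deg: "card C = Suc (i + j)" using ij hcomp_homogeneous[OF hD] by (metis (full_types))
  have nz: "D i j \<noteq> 0" using ij by auto
  obtain e where e: "D i j = defining_poly C * e"
    using defining_poly_dvd_det3[OF assms(1) log_vectors_euler_vec log_vectors_vhcomp[OF xy(1)] log_vectors_vhcomp[OF xy(2)]]
    unfolding D_def dvd_def by blast
  have "homogeneous 0 e"
    using homogeneous_mult_cancel'(2)[of "card C" "defining_poly C" e "card C"]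
      homogeneous_defining_poly[of C] hD[folded deg] e nz by (metis diff_self_eq_0)
  then obtain t where t: "e = const t" using homogeneous_degree_0 by blast
  have "t \<noteq> 0" using nz e t by auto
  then have "saito C (vhcomp i x) (vhcomp j y)"
    unfolding saito_def using e t xy by (auto simp: D_def log_vectors_vhcomp mult.commute)
  then show thesis using that vhomogeneous_vhcomp by blast
qed

lemma saito_swap: "saito C x y \<Longrightarrow> saito C y x"
proof -
  assume "saito C x y"
  then obtain k where "k \<noteq> 0" "det3 euler_vec x y = const k * defining_poly C" "x \<in> log_vectors C" "y \<in> log_vectors C"
    by (auto simp: saito_def)
  then have "- k \<noteq> 0" "det3 euler_vec y x = const (- k) * defining_poly C"
    using det3_swap(1)[of euler_vec y x] by (auto simp: const_uminus)
  then show "saito C y x" using \<open>x \<in> log_vectors C\<close> \<open>y \<in> log_vectors C\<close> unfolding saito_def by blast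
qed

text \<open>The numbers \<open>a\<close> and \<open>b\<close> are the exponents of the arrangement
  without the exponent 1 of the Euler derivation. Their order is left open because deletion can
  change which one is larger.\<close>

definition free_with :: "(complex^3) set \<Rightarrow> nat \<Rightarrow> nat \<Rightarrow> bool" where
  "free_with C a b \<longleftrightarrow> (\<exists>x y. saito C x y \<and> vhomogeneous a x \<and> vhomogeneous b y)"

lemma free_with_swap: "free_with C a b \<Longrightarrow> free_with C b a"
  using saito_swap unfolding free_with_def by blast

text \<open>Compares the degrees of the determinant and of the defining polynomial; the successor is
  the degree of the Euler vector.\<close>

lemma saito_degrees:
  assumes "reduced C" "saito C x y" "vhomogeneous a x" "vhomogeneous b y"
  shows "Suc (a + b) = card C"
proof -
  obtain k where k: "k \<noteq> 0" "det3 euler_vec x y = const k * defining_poly C" using assms(2) by (auto simp: saito_def)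
  have "homogeneous (card C) (det3 euler_vec x y)"
    unfolding k by (intro homogeneous_const_mult homogeneous_defining_poly)
  moreover have "homogeneous (Suc (a + b)) (det3 euler_vec x y)"
    using homogeneous_det3[OF vhomogeneous_euler_vec assms(3,4)] by simp
  ultimately show ?thesis
    using homogeneous_degree_unique saito_det_nonzero[OF assms(1,2)] by blast
qed

lemma free_with_degrees: "reduced C \<Longrightarrow> free_with C a b \<Longrightarrow> Suc (a + b) = card C"
  unfolding free_with_def using saito_degrees by blast

lemma saito_span_homogeneous:
  assumes "reduced C" "saito C x y" "vhomogeneous a x" "vhomogeneous b y" "z \<in> log_vectors C" "vhomogeneous d z"
  obtains h p q where "z = h *s euler_vec + p *s x + q *s y"
    "shifted_homogeneous (Suc 0) d h" "shifted_homogeneous a d p" "shifted_homogeneous b d q"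
proof -
  obtain h p q where z: "z = h *s euler_vec + p *s x + q *s y" using saito_span assms by blast
  have "vhcomp d z = shifted_hcomp (Suc 0) d h *s euler_vec + shifted_hcomp a d p *s x + shifted_hcomp b d q *s y"
    unfolding z by (simp add: vhcomp_add vhcomp_scale[OF vhomogeneous_euler_vec] vhcomp_scale[OF assms(3)] vhcomp_scale[OF assms(4)])
  then show thesis using that vhcomp_id[OF assms(6)] by (metis shifted_homogeneous_hcomp)
qed

section \<open>Restriction, deletion and addition for a line of the arrangement\<close>

section \<open>Restriction to a line of the arrangement\<close>

lemma coplanar_span:
  fixes c k r :: "complex^3"
  assumes "vcross c k \<noteq> 0" "det3 c k r = 0"
  obtains a b where "r = a *s c + b *s k"
proof -
  obtain w where w: "vdot (vcross c k) w = 1" using ex_vdot_1 assms(1) by blast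
  have 1: "det3 c k w = 1" using w by (simp add: det3_rotate)
  have 2: "det3 r c k = 0" using assms(2) by (simp add: det3_def vdot_3 algebra_simps)
  have "r = det3 r k w *s c + (- det3 r c w) *s k"
    using det3_four_vectors[of c k w r] unfolding 1 2 by (simp add: vec_eq_iff algebra_simps)
  then show thesis by (rule that)
qed

text \<open>\<open>R\<close> contains one line through each of the points of the arrangement on the line \<open>c\<close>.\<close>

definition transversal :: "(complex^3) set \<Rightarrow> complex^3 \<Rightarrow> (complex^3) set \<Rightarrow> bool" where
  "transversal C c R \<longleftrightarrow> R \<subseteq> C - {c} \<and> (\<forall>k\<in>C - {c}. \<exists>r\<in>R. det3 c r k = 0) \<and>
     (\<forall>r\<in>R. \<forall>s\<in>R. r \<noteq> s \<longrightarrow> det3 c r s \<noteq> 0)"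

text \<open>The vector \<open>w\<close> is a point off the line \<open>c\<close> from which
  everything is projected to the line. The size of \<open>R\<close> is the number of points in which
  the other lines meet \<open>c\<close>.\<close>

locale restriction =
  fixes C :: "(complex^3) set" and c w :: "complex^3" and R :: "(complex^3) set"
  assumes reduced: "reduced C" and c_in: "c \<in> C" and c_w: "vdot c w = 1"
    and transversal: "transversal C c R"
begin

abbreviation C' where "C' \<equiv> C - {c}"
abbreviation \<alpha> where "\<alpha> \<equiv> linear_form c"
abbreviation \<sigma> where "\<sigma> \<equiv> along c w"

lemma c_nonzero: "c \<noteq> 0"
  using reduced c_in reduced_nonzero by blast

lemma w_nonzero: "w \<noteq> 0"
  using c_w by (auto simp: vdot_simps)

lemma finite_C': "finite C'" and finite_R: "finite R" and R_subset: "R \<subseteq> C'" and reduced': "reduced C'"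
  using reduced_finite[OF reduced] transversal reduced_subset[OF reduced]
  by (auto simp: transversal_def intro: finite_subset)

text \<open>The representative of \<open>k\<close> modulo \<open>c\<close> that vanishes at
  \<open>w\<close>: the equation, on the line \<open>c\<close>, of its intersection point with
  \<open>k\<close>.\<close>

definition hat :: "complex^3 \<Rightarrow> complex^3" where
  "hat k = k - vdot k w *s c"

lemma \<sigma>_linear_form: "\<sigma> (linear_form k) = linear_form (hat k)"
  by (simp add: along_linear_form hat_def)

lemma vmap_\<sigma>:
  "vmap \<sigma> (x + y) = vmap \<sigma> x + vmap \<sigma> y"
  "vmap \<sigma> (x - y) = vmap \<sigma> x - vmap \<sigma> y"
  "vmap \<sigma> (a *s x) = \<sigma> a *s vmap \<sigma> x"
  "\<sigma> (vdot x y) = vdot (vmap \<sigma> x) (vmap \<sigma> y)"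
  "vmap \<sigma> (vcross x y) = vcross (vmap \<sigma> x) (vmap \<sigma> y)"
  "\<sigma> (det3 x y z) = det3 (vmap \<sigma> x) (vmap \<sigma> y) (vmap \<sigma> z)"
  "vmap \<sigma> (cvec v) = cvec v"
  unfolding along_def by (rule vmap_psubst vmap_psubst_cvec)+

text \<open>Both factors vanish at \<open>w\<close>, so their product is a multiple of
  \<open>w\<close>; pairing with \<open>c\<close> gives the multiple. Thus two lines meet
  \<open>c\<close> in the same point exactly if their \<open>hat\<close> forms are
  proportional.\<close>

lemma vcross_hat: "vcross (hat k) (hat l) = det3 c k l *s w"
proof -
  define V where "V = vcross (hat k) (hat l)"
  have h: "vdot w (hat m) = 0" for m
    using c_w by (simp add: hat_def vdot_simps vdot_commute[of w])
  have "vcross w V = 0" unfolding V_def vcross_vcross by (simp add: h)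
  then have "vcross c (vcross w V) = 0" by (simp add: vcross_simps)
  then have "V = vdot c V *s w" unfolding vcross_vcross using c_w by simp
  moreover have "vdot c V = det3 c k l"
    unfolding V_def det3_def[symmetric] hat_def by (simp add: det3_simps)
  ultimately show ?thesis by (simp add: V_def)
qed

lemma hat_nonzero:
  assumes "k \<in> C'"
  shows "hat k \<noteq> 0"
proof
  assume "hat k = 0"
  then have "k = vdot k w *s c" by (simp add: hat_def)
  then have "vcross c k = 0" using vcross_eq_0_iff[OF c_nonzero] by blast
  then show False using reduced_vcross[OF reduced c_in] assms by auto
qed

lemma hat_dvd_iff: "k \<in> C' \<Longrightarrow> linear_form (hat k) dvd linear_form (hat l) \<longleftrightarrow> det3 c k l = 0"
  by (simp add: linear_form_dvd_linear_form_iff[OF hat_nonzero] vcross_hat w_nonzero)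

text \<open>On the line, vectors tangent to it form a module of rank two containing the Euler
  vector. This is the remaining coordinate, namely the factor of \<open>cvec c\<close> in the cross
  product with the Euler vector.\<close>

definition nu :: "spoly^3 \<Rightarrow> spoly" where
  "nu x = \<sigma> (det3 (cvec w) x euler_vec)"

text \<open>The value of the derivation on the equation of the line, restricted to the line. It is
  the obstruction to extending a logarithmic vector of \<open>C'\<close> to
  \<open>C\<close>.\<close>

definition rho :: "spoly^3 \<Rightarrow> spoly" where
  "rho x = \<sigma> (vdot (cvec c) x)"

definition point_poly :: spoly where
  "point_poly = (\<Prod>r\<in>R. linear_form (hat r))"

text \<open>Up to constants, the equation of each point on \<open>c\<close> occurs once less than
  the number of other lines through that point.\<close>

definition rest_poly :: spoly where
  "rest_poly = (\<Prod>k\<in>C' - R. linear_form (hat k))"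

lemma nu_simps: "nu (x + y) = nu x + nu y" "nu (x - y) = nu x - nu y" "nu (f *s x) = \<sigma> f * nu x"
  by (simp_all add: nu_def det3_simps)

lemma rho_simps: "rho (x + y) = rho x + rho y" "rho (x - y) = rho x - rho y" "rho (f *s x) = \<sigma> f * rho x"
  by (simp_all add: rho_def vdot_simps)

lemma rho_eq_0_iff: "x \<in> log_vectors C' \<Longrightarrow> rho x = 0 \<longleftrightarrow> x \<in> log_vectors C"
  using dvd_iff_along[OF c_w] c_in by (auto simp: rho_def log_vectors_def)

lemma \<sigma>_nu: "\<sigma> (nu x) = nu x" and \<sigma>_rho: "\<sigma> (rho x) = rho x"
  by (simp_all add: nu_def rho_def along_along[OF c_w])

lemma \<sigma>_prod: "\<sigma> (prod f A) = (\<Prod>a\<in>A. \<sigma> (f a))"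
  by (simp add: along_def)

lemma \<sigma>_hat: "\<sigma> (linear_form (hat k)) = linear_form (hat k)"
  by (metis \<sigma>_linear_form along_along c_w)

lemma \<sigma>_point_poly: "\<sigma> point_poly = point_poly" and \<sigma>_rest_poly: "\<sigma> rest_poly = rest_poly"
  by (simp_all add: point_poly_def rest_poly_def \<sigma>_prod \<sigma>_hat)

lemma homogeneous_nu: "vhomogeneous d x \<Longrightarrow> homogeneous (Suc d) (nu x)"
  unfolding nu_def using homogeneous_det3[OF vhomogeneous_cvec _ vhomogeneous_euler_vec, of d x w]
  by (auto intro: homogeneous_along)

lemma homogeneous_rho: "vhomogeneous d x \<Longrightarrow> homogeneous d (rho x)"
  unfolding rho_def using homogeneous_vdot[OF vhomogeneous_cvec, of d x c] by (auto intro: homogeneous_along)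

lemma homogeneous_point_poly: "homogeneous (card R) point_poly"
  unfolding point_poly_def by (rule homogeneous_prod_linear) simp

lemma homogeneous_rest_poly: "homogeneous (card C' - card R) rest_poly"
  unfolding rest_poly_def using homogeneous_prod_linear[of "C' - R" "\<lambda>k. linear_form (hat k)"]
  by (simp add: card_Diff_subset[OF finite_R R_subset])

lemma point_poly_nonzero: "point_poly \<noteq> 0"
  unfolding point_poly_def using finite_R hat_nonzero R_subset by auto

lemma rest_poly_nonzero: "rest_poly \<noteq> 0"
  unfolding rest_poly_def using finite_C' hat_nonzero by auto

lemma \<sigma>_tangent: "x \<in> log_vectors C \<Longrightarrow> vdot (cvec c) (vmap \<sigma> x) = 0"
  using log_vectorsD[OF _ c_in] dvd_iff_along[OF c_w] by (simp add: vmap_\<sigma>(4,7))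

text \<open>Both restricted vectors are annihilated by \<open>c\<close>, so their cross product is
  parallel to \<open>c\<close>; pairing with \<open>w\<close> gives the factor.\<close>

lemma vcross_\<sigma>:
  assumes "x \<in> log_vectors C"
  shows "vcross (vmap \<sigma> x) (vmap \<sigma> euler_vec) = nu x *s cvec c"
proof -
  define V where "V = vcross (vmap \<sigma> x) (vmap \<sigma> euler_vec)"
  have "vcross (cvec c) V = 0"
    unfolding V_def vcross_vcross using \<sigma>_tangent[OF assms] \<sigma>_tangent[OF log_vectors_euler_vec] by simp
  then have "vcross (cvec w) (vcross (cvec c) V) = 0" by (simp add: vcross_simps)
  then have "vdot (cvec w) V *s cvec c = vdot (cvec w) (cvec c) *s V" unfolding vcross_vcross by simp
  moreover have "vdot (cvec w) (cvec c) = 1" using c_w by (simp add: cvec_simps vdot_commute)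
  moreover have "vdot (cvec w) V = nu x"
    by (simp add: V_def nu_def vmap_\<sigma>) (simp add: det3_def)
  ultimately show ?thesis by (simp add: V_def)
qed

text \<open>At the point where \<open>r\<close> meets \<open>c\<close> the vector is tangent to both
  lines, hence proportional to the position vector. Algebraically, the triple product with
  \<open>r\<close> has both terms divisible by the equation of the point.\<close>

lemma linear_form_dvd_nu:
  assumes "x \<in> log_vectors C" "r \<in> C'"
  shows "linear_form (hat r) dvd nu x"
proof -
  have "linear_form r dvd vdot (cvec r) x" using assms log_vectorsD by blast
  then obtain q where "vdot (cvec r) x = linear_form r * q" by blast
  then have "\<sigma> (vdot (cvec r) x) = linear_form (hat r) * \<sigma> q" by (simp add: \<sigma>_linear_form)
  then have 1: "vdot (cvec r) (vmap \<sigma> x) = linear_form (hat r) * \<sigma> q" by (simp add: vmap_\<sigma>)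
  have 2: "vdot (cvec r) (vmap \<sigma> euler_vec) = linear_form (hat r)"
    by (metis \<sigma>_linear_form linear_form_eq vmap_\<sigma>(4,7))
  have "vcross (cvec r) (nu x *s cvec c) = linear_form (hat r) *s (vmap \<sigma> x - \<sigma> q *s vmap \<sigma> euler_vec)"
    unfolding vcross_\<sigma>[OF assms(1), symmetric] vcross_vcross 1 2 by (simp add: vec_eq_iff algebra_simps)
  then have 3: "nu x *s cvec (vcross r c) = linear_form (hat r) *s (vmap \<sigma> x - \<sigma> q *s vmap \<sigma> euler_vec)"
    by (simp add: vcross_simps cvec_simps)
  have "vcross r c \<noteq> 0" using reduced_vcross[OF reduced] assms(2) c_in by auto
  then obtain i where i: "vcross r c $ i \<noteq> 0" by (auto simp: vec_eq_iff)
  have "nu x * const (vcross r c $ i) = linear_form (hat r) * (vmap \<sigma> x - \<sigma> q *s vmap \<sigma> euler_vec) $ i"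
    using arg_cong[OF 3, of "\<lambda>v. v $ i"] by simp
  then have "linear_form (hat r) dvd const (vcross r c $ i) * nu x" by (metis dvd_triv_left mult.commute)
  then show ?thesis using dvd_const_mult_iff i by blast
qed

lemma point_poly_dvd_nu:
  assumes "x \<in> log_vectors C"
  shows "point_poly dvd nu x"
  unfolding point_poly_def
proof (rule prod_linear_forms_dvd[OF finite_R])
  fix r s assume "r \<in> R" "s \<in> R" "r \<noteq> s"
  then show "vcross (hat r) (hat s) \<noteq> 0"
    using transversal w_nonzero by (auto simp: vcross_hat transversal_def)
qed (use assms R_subset hat_nonzero linear_form_dvd_nu in auto)

text \<open>With vanishing \<open>nu\<close> the restriction of \<open>x\<close> is parallel to that
  of the Euler vector, and even a multiple of it because the entries of the latter have no common
  factor. The difference is then divisible by \<open>\<alpha>\<close>, which is prime to the other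
  equations.\<close>

lemma nu_eq_0:
  assumes "x \<in> log_vectors C" "nu x = 0"
  obtains h \<psi> where "x = h *s euler_vec + \<alpha> *s \<psi>" "\<psi> \<in> log_vectors C'"
proof -
  define X where "X = vmap \<sigma> x"
  define Z where "Z = vmap \<sigma> euler_vec"
  have cr: "X $ i * Z $ j = X $ j * Z $ i" for i j
  proof -
    have 0: "vcross X Z = 0" using vcross_\<sigma>[OF assms(1)] assms(2) by (simp add: X_def Z_def)
    have "X $ 2 * Z $ 3 = X $ 3 * Z $ 2" "X $ 3 * Z $ 1 = X $ 1 * Z $ 3" "X $ 1 * Z $ 2 = X $ 2 * Z $ 1"
      using arg_cong[OF 0, of "\<lambda>v. v $ 1"] arg_cong[OF 0, of "\<lambda>v. v $ 2"] arg_cong[OF 0, of "\<lambda>v. v $ 3"]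
      by simp_all
    then show ?thesis using exhaust_3[of i] exhaust_3[of j] by auto
  qed
  have Zi: "Z $ i = linear_form (hat (axis i 1))" for i
  proof -
    have "var i = linear_form (axis i 1)"
      by (rule spoly_eqI) (use exhaust_3[of i] in \<open>auto simp: vdot_3 axis_def\<close>)
    then show ?thesis by (simp add: Z_def \<sigma>_linear_form)
  qed
  \<comment> \<open>Two coordinates with coprime restrictions: the first one divides its entry of
    \<open>X\<close>, and this defines the multiplier \<open>h\<close>.\<close>
  obtain i j where "det3 c (axis i 1) (axis j 1) \<noteq> 0" using ex_det3_axis[OF c_nonzero] by blast
  then have ij: "vcross (hat (axis i 1)) (hat (axis j 1)) \<noteq> 0" using w_nonzero by (simp add: vcross_hat)
  then have i0: "hat (axis i 1) \<noteq> 0" by (auto simp: vcross_simps)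
  have "Z $ i dvd X $ i * Z $ j" using cr[of i j] by simp
  then have "Z $ i dvd X $ i"
    using ij i0 by (simp add: Zi linear_form_dvd_mult_iff linear_form_dvd_linear_form_iff)
  then obtain h where h: "X $ i = Z $ i * h" by blast
  have "X $ l = h * Z $ l" for l
  proof -
    have "Z $ i * X $ l = Z $ i * (h * Z $ l)" using cr[of l i] h by (simp add: algebra_simps)
    then show ?thesis using i0 by (simp add: Zi)
  qed
  then have X: "X = h *s Z" by (simp add: vec_eq_iff)
  have "vmap \<sigma> X = X" "vmap \<sigma> Z = Z"
    by (simp_all add: X_def Z_def vec_eq_iff along_along[OF c_w])
  then have X': "X = \<sigma> h *s Z" using X vmap_\<sigma>(3) by metis
  have "vmap \<sigma> (x - h *s euler_vec) = 0" using X' by (simp add: vmap_\<sigma> X_def Z_def)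
  then have "\<sigma> ((x - h *s euler_vec) $ l) = 0" for l by (metis vmap_nth zero_index)
  then have "\<exists>q. (x - h *s euler_vec) $ l = \<alpha> * q" for l using dvd_iff_along[OF c_w] by blast
  then obtain q where q: "\<And>l. (x - h *s euler_vec) $ l = \<alpha> * q l" by metis
  define \<psi> where "\<psi> = (\<chi> l. q l)"
  have eq: "x = h *s euler_vec + \<alpha> *s \<psi>" using q by (simp add: vec_eq_iff \<psi>_def algebra_simps)
  have "\<psi> \<in> log_vectors C'"
    unfolding log_vectors_def
  proof (intro CollectI ballI)
    fix k assume "k \<in> C'"
    then have k: "k \<in> C" "k \<noteq> c" by auto
    have "linear_form k dvd vdot (cvec k) (x - h *s euler_vec)" using k assms(1) by (intro log_vectorsD log_vectors_diff log_vectors_scale log_vectors_euler_vec)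
    moreover have "x - h *s euler_vec = \<alpha> *s \<psi>" using eq by simp
    ultimately have "linear_form k dvd \<alpha> * vdot (cvec k) \<psi>" by (simp add: vdot_simps)
    then show "linear_form k dvd vdot (cvec k) \<psi>"
      using linear_form_dvd_mult_iff[OF reduced_nonzero[OF reduced k(1)]] reduced_not_dvd[OF reduced k(1) c_in k(2)]
      by blast
  qed
  then show thesis using that eq by blast
qed

lemma nu_eq_0_homogeneous:
  assumes "x \<in> log_vectors C" "nu x = 0" "vhomogeneous d x"
  obtains h \<psi> where "x = h *s euler_vec + \<alpha> *s \<psi>" "\<psi> \<in> log_vectors C'" "\<psi> \<noteq> 0 \<Longrightarrow> 1 \<le> d" "vhomogeneous (d - 1) \<psi>"
proof -
  obtain h \<psi> where h: "x = h *s euler_vec + \<alpha> *s \<psi>" and \<psi>: "\<psi> \<in> log_vectors C'" using nu_eq_0[OF assms(1,2)] by blast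
  \<comment> \<open>In degree 0 the component has to be zero; truncated subtraction would otherwise
    select the constant part of \<open>\<psi>\<close>.\<close>
  define \<phi> where "\<phi> = (if 1 \<le> d then vhcomp (d - 1) \<psi> else 0)"
  have \<phi>: "\<phi> = vmap (shifted_hcomp (Suc 0) d) \<psi>"
    by (auto simp: \<phi>_def vhcomp_def vec_eq_iff shifted_hcomp_def)
  have "x = vhcomp d x" by (simp add: vhcomp_id assms(3))
  also have "\<dots> = shifted_hcomp (Suc 0) d h *s euler_vec + \<alpha> *s \<phi>"
    unfolding h \<phi> by (simp add: vhcomp_add vhcomp_scale[OF vhomogeneous_euler_vec] vhcomp_scale')
  finally have e: "x = shifted_hcomp (Suc 0) d h *s euler_vec + \<alpha> *s \<phi>" .
  show thesis
    by (rule that[OF e]) (auto simp: \<phi>_def vhomogeneous_vhcomp vhomogeneous_0 log_vectors_0 log_vectors_vhcomp[OF \<psi>] split: if_splits)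
qed

text \<open>Let \<open>k = t *s c + s *s r\<close> be another line through the point of
  \<open>r\<close>, and let \<open>F\<close> be the cofactor of \<open>linear_form r\<close> in the
  value of the derivation there. Divisibility of the value on \<open>k\<close> by its equation shows
  that \<open>k\<close> divides the value on \<open>c\<close> minus \<open>\<alpha> * F\<close>.
  Restriction to the line removes the last term, and every such \<open>k\<close> leaves a
  factor.\<close>

lemma rest_poly_dvd_rho:
  assumes "x \<in> log_vectors C'"
  shows "rest_poly dvd rho x"
proof -
  define T where "T r = {k \<in> C' - R. det3 c r k = 0}" for r
  have T: "(\<Prod>k\<in>T r. linear_form (hat k)) dvd rho x" if r: "r \<in> R" for r
  proof -
    have rC: "r \<in> C'" using r R_subset by blast
    have cr: "vcross c r \<noteq> 0" using reduced_vcross[OF reduced c_in] rC by auto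
    obtain F where F: "vdot (cvec r) x = linear_form r * F" using log_vectorsD[OF assms rC] by blast
    have "(\<Prod>k\<in>T r. linear_form k) dvd vdot (cvec c) x - \<alpha> * F"
    proof (rule prod_linear_forms_dvd)
      fix k assume k: "k \<in> T r"
      then have kC: "k \<in> C'" "k \<noteq> r" using r by (auto simp: T_def)
      obtain t s where ts: "k = t *s c + s *s r"
        using coplanar_span[OF cr, of k] k by (auto simp: T_def)
      have t: "t \<noteq> 0"
      proof
        assume "t = 0"
        then have "vcross r k = 0" using ts by (simp add: vcross_simps)
        then show False using reduced_vcross[OF reduced'] rC kC by auto
      qed
      have "linear_form k dvd vdot (cvec k) x" using log_vectorsD[OF assms kC(1)] .
      moreover have "vdot (cvec k) x = const t * (vdot (cvec c) x - \<alpha> * F) + linear_form k * F"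
        using F by (simp add: ts cvec_simps vdot_simps linear_form_simps algebra_simps)
      ultimately have "linear_form k dvd const t * (vdot (cvec c) x - \<alpha> * F)"
        by (metis dvd_add_left_iff dvd_triv_left)
      then show "linear_form k dvd vdot (cvec c) x - \<alpha> * F" using dvd_const_mult_iff t by blast
    next
      show "finite (T r)" using finite_C' by (simp add: T_def)
      show "k \<noteq> 0" if "k \<in> T r" for k using that reduced_nonzero[OF reduced'] by (auto simp: T_def)
      show "vcross k l \<noteq> 0" if "k \<in> T r" "l \<in> T r" "k \<noteq> l" for k l
        using that reduced_vcross[OF reduced'] by (auto simp: T_def)
    qed
    then obtain G where "vdot (cvec c) x - \<alpha> * F = (\<Prod>k\<in>T r. linear_form k) * G" by blast
    then have "\<sigma> (vdot (cvec c) x - \<alpha> * F) = (\<Prod>k\<in>T r. linear_form (hat k)) * \<sigma> G"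
      by (simp add: \<sigma>_prod \<sigma>_linear_form)
    moreover have "\<sigma> \<alpha> = 0" using dvd_iff_along[OF c_w, of \<alpha>] by simp
    ultimately show ?thesis by (simp add: rho_def)
  qed
  \<comment> \<open>Factors belonging to one point are proportional and were treated above; factors
    of different points are coprime, so the products over the points multiply.\<close>
  have "(\<Prod>k\<in>(\<Union>r\<in>A. T r). linear_form (hat k)) dvd rho x" if "finite A" "A \<subseteq> R" for A
    using that
  proof (induction A rule: finite_induct)
    case (insert r A)
    define U where "U = (\<Union>r\<in>A. T r)"
    have fin: "finite U" "finite (T r)" using finite_C' by (auto simp: U_def T_def intro: finite_subset)
    have sub: "U \<subseteq> C'" "T r \<subseteq> C'" by (auto simp: U_def T_def)
    \<comment> \<open>Concurrency with \<open>c\<close> is transitive, so otherwise the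
      representatives \<open>r\<close> and \<open>s\<close> of the two points would meet
      \<open>c\<close> in the same point.\<close>
    have ndet: "det3 c l k \<noteq> 0" if l: "l \<in> T r" and k: "k \<in> U" for l k
    proof
      assume lk: "det3 c l k = 0"
      obtain s where s: "s \<in> A" "k \<in> T s" using k by (auto simp: U_def)
      have rs: "r \<in> R" "s \<in> R" "r \<noteq> s" using insert s by auto
      have cC: "vcross c m \<noteq> 0" if "m \<in> C'" for m using reduced_vcross[OF reduced c_in] that by auto
      have "det3 c l r = 0" using l det3_swap(1)[of c "l" r] by (auto simp: T_def det3_def vdot_3 algebra_simps)
      then obtain a b where r: "r = a *s c + b *s l" using coplanar_span[OF cC] l sub(2) by blast
      obtain a' b' where l': "k = a' *s c + b' *s l" using coplanar_span[OF cC lk] l sub(2) by blast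
      have "det3 c k s = 0" using s by (auto simp: T_def det3_def vdot_3 algebra_simps)
      then obtain a'' b'' where s': "s = a'' *s c + b'' *s k" using coplanar_span[OF cC] k sub(1) by blast
      have "det3 c r s = 0" unfolding s' l' r by (simp add: det3_simps)
      then show False using transversal rs by (auto simp: transversal_def)
    qed
    have disj: "U \<inter> T r = {}" using ndet by (force simp: det3_simps)
    obtain G where G: "rho x = (\<Prod>k\<in>U. linear_form (hat k)) * G"
      using insert.IH insert.prems by (auto simp: U_def elim: dvdE)
    have "(\<Prod>k\<in>T r. linear_form (hat k)) dvd G"
    proof (rule prod_linear_forms_dvd_cancel[OF fin(2)])
      show "hat l \<noteq> 0" if "l \<in> T r" for l using that sub(2) hat_nonzero by blast
      show "\<not> linear_form (hat l) dvd (\<Prod>k\<in>U. linear_form (hat k))" if l: "l \<in> T r" for l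
      proof -
        have lC: "l \<in> C'" using l sub(2) by blast
        show ?thesis
          unfolding linear_form_dvd_prod_iff[OF hat_nonzero[OF lC] fin(1)] hat_dvd_iff[OF lC]
          using ndet l by blast
      qed
      show "(\<Prod>k\<in>T r. linear_form (hat k)) dvd (\<Prod>k\<in>U. linear_form (hat k)) * G"
        using T[of r] insert.prems G by simp
    qed
    then show ?case
      using disj by (simp add: G U_def[symmetric] prod.union_disjoint[OF fin(2,1)] Int_commute mult.commute mult_dvd_mono)
  qed simp
  from this[OF finite_R subset_refl] have "(\<Prod>k\<in>(\<Union>r\<in>R. T r). linear_form (hat k)) dvd rho x" .
  moreover have "(\<Union>r\<in>R. T r) = C' - R" using transversal by (auto simp: T_def transversal_def)
  ultimately show ?thesis by (simp add: rest_poly_def)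
qed

end

section \<open>Deletion and addition\<close>

context restriction
begin

lemma card_C: "card C = Suc (card C')"
  using card.remove[OF reduced_finite[OF reduced] c_in] .

lemma card_R_le: "card R \<le> card C'"
  by (rule card_mono[OF finite_C' R_subset])

lemma nu_factor:
  assumes "x \<in> log_vectors C" "vhomogeneous d x"
  obtains m where "nu x = point_poly * m" "\<sigma> m = m" "shifted_homogeneous (card R) (Suc d) m"
proof -
  obtain m where m: "nu x = point_poly * m" using point_poly_dvd_nu[OF assms(1)] by blast
  have "point_poly * \<sigma> m = point_poly * m"
    using \<sigma>_nu[of x] unfolding m along_simps \<sigma>_point_poly .
  then have "\<sigma> m = m" using point_poly_nonzero by simp
  moreover have "shifted_homogeneous (card R) (Suc d) m"
    using homogeneous_mult_cancel[of "Suc d" point_poly m] homogeneous_nu[OF assms(2)] m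
      homogeneous_point_poly point_poly_nonzero by metis
  ultimately show thesis using that m by blast
qed

lemma rho_factor:
  assumes "x \<in> log_vectors C'" "vhomogeneous d x"
  obtains m where "rho x = rest_poly * m" "\<sigma> m = m" "shifted_homogeneous (card C' - card R) d m"
proof -
  obtain m where m: "rho x = rest_poly * m" using rest_poly_dvd_rho[OF assms(1)] by blast
  have "rest_poly * \<sigma> m = rest_poly * m"
    using \<sigma>_rho[of x] unfolding m along_simps \<sigma>_rest_poly .
  then have "\<sigma> m = m" using rest_poly_nonzero by simp
  moreover have "shifted_homogeneous (card C' - card R) d m"
    using homogeneous_mult_cancel[of d rest_poly m] homogeneous_rho[OF assms(2)] m
      homogeneous_rest_poly rest_poly_nonzero by metis
  ultimately show thesis using that m by blast
qed

lemma shifted_homogeneous_nonzero: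
  "shifted_homogeneous e d p \<Longrightarrow> p \<noteq> 0 \<Longrightarrow> e \<le> d"
  by (auto simp: shifted_homogeneous_def split: if_splits)

text \<open>Subtracting a multiple of the Euler vector leaves the determinant unchanged, and
  division by \<open>\<alpha>\<close> removes exactly the factor of the deleted line.\<close>

lemma saito_divide:
  assumes "saito C x y" "x = h *s euler_vec + \<alpha> *s \<psi>" "\<psi> \<in> log_vectors C'"
  shows "saito C' \<psi> y"
proof -
  obtain k where k: "k \<noteq> 0" "det3 euler_vec x y = const k * defining_poly C" "y \<in> log_vectors C"
    using assms(1) by (auto simp: saito_def)
  have "\<alpha> * det3 euler_vec \<psi> y = \<alpha> * (const k * defining_poly C')"
    using k(2) unfolding assms(2) by (simp add: det3_simps defining_poly_remove[OF reduced c_in] mult_ac)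
  then have "det3 euler_vec \<psi> y = const k * defining_poly C'" using c_nonzero by simp
  then show ?thesis using k log_vectors_mono[of C' C] assms(3) unfolding saito_def by blast
qed

lemma not_saito_both:
  assumes "saito C' x y" "x \<in> log_vectors C" "y \<in> log_vectors C"
  shows False
proof -
  obtain k where k: "k \<noteq> 0" "det3 euler_vec x y = const k * defining_poly C'" using assms(1) by (auto simp: saito_def)
  have "\<alpha> dvd det3 euler_vec x y"
    using defining_poly_dvd_det3[OF reduced log_vectors_euler_vec assms(2,3)] linear_form_dvd_defining_poly[OF reduced c_in] dvd_trans by blast
  then show False
    using k dvd_const_mult_iff not_dvd_defining_poly_remove[OF reduced c_in] by metis
qed

lemma saito_nonzero: "reduced D \<Longrightarrow> saito D x y \<Longrightarrow> x \<noteq> 0"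
  by (metis saito_det_nonzero det3_simps(8))

text \<open>The quotients of \<open>nu x\<close> and \<open>nu y\<close> by
  \<open>point_poly\<close> have degrees \<open>a + 1 - n\<close> and \<open>b + 1 - n\<close> for
  \<open>n = card R\<close>. As \<open>n > a\<close>, the first is zero or a constant. If it is
  zero, \<open>x\<close> can be divided by \<open>\<alpha>\<close>; if it is a nonzero constant,
  \<open>y\<close> can be after subtracting a multiple of \<open>x\<close>.\<close>

lemma deletion:
  assumes "free_with C a b" "a \<le> b" "a < card R"
  shows "1 \<le> a \<and> free_with C' (a - 1) b \<and> card R = Suc b \<or>
    1 \<le> b \<and> free_with C' a (b - 1) \<and> card R = Suc a"
proof -
  obtain x y where xy: "saito C x y" "vhomogeneous a x" "vhomogeneous b y"
    using assms(1) by (auto simp: free_with_def)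
  then have LD: "x \<in> log_vectors C" "y \<in> log_vectors C" by (auto simp: saito_def)
  have card: "Suc (a + b) = card C" using saito_degrees[OF reduced xy] .
  obtain m where m: "nu x = point_poly * m" "\<sigma> m = m" "shifted_homogeneous (card R) (Suc a) m"
    using nu_factor[OF LD(1) xy(2)] by blast
  obtain m2 where m2: "nu y = point_poly * m2" "\<sigma> m2 = m2" "shifted_homogeneous (card R) (Suc b) m2"
    using nu_factor[OF LD(2) xy(3)] by blast
  show ?thesis
  proof (cases "m = 0")
    case True
    then have "nu x = 0" using m by simp
    then obtain h \<psi> where h: "x = h *s euler_vec + \<alpha> *s \<psi>" "\<psi> \<in> log_vectors C'" "\<psi> \<noteq> 0 \<Longrightarrow> 1 \<le> a" "vhomogeneous (a - 1) \<psi>"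
      using nu_eq_0_homogeneous[OF LD(1) _ xy(2)] by blast
    have s: "saito C' \<psi> y" using saito_divide[OF xy(1) h(1,2)] .
    have a1: "1 \<le> a" using h(3) saito_nonzero[OF reduced' s] by blast
    \<comment> \<open>If \<open>m2\<close> vanished, \<open>y\<close> would be a multiple of
      \<open>\<alpha>\<close> up to the Euler vector and \<open>\<alpha>\<close> would divide the
      determinant for \<open>C'\<close>. The degree of \<open>nu y\<close> then gives
      \<open>n \<le> b + 1\<close>.\<close>
    have "m2 \<noteq> 0"
    proof
      assume "m2 = 0"
      then have "nu y = 0" using m2 by simp
      then obtain h' \<psi>' where h': "y = h' *s euler_vec + \<alpha> *s \<psi>'" using nu_eq_0[OF LD(2)] by blast
      obtain k where k: "k \<noteq> 0" "det3 euler_vec \<psi> y = const k * defining_poly C'" using s by (auto simp: saito_def)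
      have "det3 euler_vec \<psi> y = \<alpha> * det3 euler_vec \<psi> \<psi>'" unfolding h' by (simp add: det3_simps)
      then have "\<alpha> dvd const k * defining_poly C'" using k by (metis dvd_triv_left)
      then show False using k(1) dvd_const_mult_iff not_dvd_defining_poly_remove[OF reduced c_in] by blast
    qed
    then have le: "card R \<le> Suc b" using shifted_homogeneous_nonzero m2(3) by blast
    \<comment> \<open>The reverse inequality comes from \<open>rho\<close>: it is nonzero on
      \<open>\<psi>\<close>, so its divisor \<open>rest_poly\<close>, of degree
      \<open>a + b - n\<close>, has degree at most \<open>a - 1\<close>.\<close>
    have "\<psi> \<notin> log_vectors C" using not_saito_both[OF s _ LD(2)] by blast
    then have "rho \<psi> \<noteq> 0" using rho_eq_0_iff[OF h(2)] by blast
    moreover obtain r where r: "rho \<psi> = rest_poly * r" "shifted_homogeneous (card C' - card R) (a - 1) r"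
      using rho_factor[OF h(2,4)] by blast
    ultimately have "card C' - card R \<le> a - 1" using shifted_homogeneous_nonzero by fastforce
    then have "Suc b \<le> card R" using card card_C a1 by linarith
    then have "card R = Suc b" using le by simp
    moreover have "free_with C' (a - 1) b" unfolding free_with_def using s h(4) xy(3) by blast
    ultimately show ?thesis using a1 by blast
  next
    case False
    then have n: "card R = Suc a" using shifted_homogeneous_nonzero[OF m(3)] assms(3) by simp
    then have "homogeneous 0 m" using m(3) by (simp add: shifted_homogeneous_def)
    then obtain t where t: "m = const t" using homogeneous_degree_0 by blast
    then have t0: "t \<noteq> 0" using False by auto
    \<comment> \<open>Chosen so that \<open>nu z\<close> vanishes. The coefficient of
      \<open>y\<close> is a nonzero constant, so \<open>x\<close> and \<open>z\<close> still satisfy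
      Saito's criterion.\<close>
    define z where "z = const t *s y - m2 *s x"
    have "homogeneous (b - a) m2" using m2(3) n assms(2) by (simp add: shifted_homogeneous_def)
    then have "shifted_homogeneous a b m2" using assms(2) by (simp add: shifted_homogeneous_def)
    then have hz: "vhomogeneous b z"
      unfolding z_def using xy by (intro vhomogeneous_diff vhomogeneous_const vhomogeneous_scale[OF xy(2)])
    have zL: "z \<in> log_vectors C" unfolding z_def using LD by (intro log_vectors_diff log_vectors_scale)
    have "nu z = 0" unfolding z_def by (simp add: nu_simps m m2 t)
    then obtain h \<psi> where h: "z = h *s euler_vec + \<alpha> *s \<psi>" "\<psi> \<in> log_vectors C'" "\<psi> \<noteq> 0 \<Longrightarrow> 1 \<le> b" "vhomogeneous (b - 1) \<psi>"
      using nu_eq_0_homogeneous[OF zL _ hz] by blast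
    have "saito C x z"
    proof -
      obtain k where k: "k \<noteq> 0" "det3 euler_vec x y = const k * defining_poly C" using xy(1) by (auto simp: saito_def)
      have "det3 euler_vec x z = const (t * k) * defining_poly C"
        unfolding z_def by (simp add: det3_simps k const_mult mult_ac)
      moreover have "t * k \<noteq> 0" using t0 k by simp
      ultimately show ?thesis using LD zL unfolding saito_def by blast
    qed
    then have s: "saito C' \<psi> x" by (intro saito_divide[OF saito_swap h(1,2)])
    then have "1 \<le> b" using h(3) saito_nonzero[OF reduced' s] by blast
    moreover have "free_with C' a (b - 1)" unfolding free_with_def using saito_swap[OF s] h(4) xy(2) by blast
    ultimately show ?thesis using n by blast
  qed
qed

lemma saito_multiply:
  assumes "saito C' x y" "y \<in> log_vectors C"
  shows "saito C (\<alpha> *s x) y"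
proof -
  obtain k where k: "k \<noteq> 0" "det3 euler_vec x y = const k * defining_poly C'" "x \<in> log_vectors C'"
    using assms(1) by (auto simp: saito_def)
  have "det3 euler_vec (\<alpha> *s x) y = const k * defining_poly C"
    by (simp add: det3_simps k defining_poly_remove[OF reduced c_in] mult_ac)
  moreover have "\<alpha> *s x \<in> log_vectors C"
    unfolding log_vectors_def
  proof (intro CollectI ballI)
    fix k assume "k \<in> C"
    then show "linear_form k dvd vdot (cvec k) (\<alpha> *s x)"
      using log_vectorsD[OF \<open>x \<in> log_vectors C'\<close>, of k] by (cases "k = c") (auto simp: vdot_simps)
  qed
  ultimately show ?thesis using k(1) assms(2) unfolding saito_def by blast
qed

text \<open>The degree of \<open>rest_poly\<close> is \<open>card C' - card R = a\<close>, so
  \<open>rho x\<close> is a constant times it. Either the constant is zero and \<open>x\<close> is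
  already logarithmic for \<open>C\<close>, or \<open>x\<close> can be used to correct
  \<open>y\<close>; the other basis vector is multiplied by \<open>\<alpha>\<close>.\<close>

lemma addition:
  assumes "free_with C' a b" "card R = Suc b"
  shows "\<exists>x y. saito C x y"
proof -
  obtain x y where xy: "saito C' x y" "vhomogeneous a x" "vhomogeneous b y"
    using assms(1) by (auto simp: free_with_def)
  then have LD: "x \<in> log_vectors C'" "y \<in> log_vectors C'" by (auto simp: saito_def)
  have card: "Suc (a + b) = card C'" using saito_degrees[OF reduced' xy] .
  obtain m where m: "rho x = rest_poly * m" "\<sigma> m = m" "shifted_homogeneous (card C' - card R) a m"
    using rho_factor[OF LD(1) xy(2)] by blast
  obtain m2 where m2: "rho y = rest_poly * m2" "\<sigma> m2 = m2"
    using rho_factor[OF LD(2) xy(3)] by blast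
  have "card C' - card R = a" using card assms(2) by linarith
  then have "homogeneous 0 m" using m(3) by (simp add: shifted_homogeneous_def)
  then obtain t where t: "m = const t" using homogeneous_degree_0 by blast
  show ?thesis
  proof (cases "t = 0")
    case True
    then have "x \<in> log_vectors C" using rho_eq_0_iff[OF LD(1)] m t by simp
    then show ?thesis using saito_multiply[OF saito_swap[OF xy(1)]] by blast
  next
    case False
    define z where "z = const t *s y - m2 *s x"
    have zL': "z \<in> log_vectors C'" unfolding z_def using LD by (intro log_vectors_diff log_vectors_scale)
    have "rho z = 0" unfolding z_def by (simp add: rho_simps m m2 t)
    then have zL: "z \<in> log_vectors C" using rho_eq_0_iff[OF zL'] by blast
    have "saito C' x z"
    proof -
      obtain k where k: "k \<noteq> 0" "det3 euler_vec x y = const k * defining_poly C'" using xy(1) by (auto simp: saito_def)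
      have "det3 euler_vec x z = const (t * k) * defining_poly C'"
        unfolding z_def by (simp add: det3_simps k const_mult mult_ac)
      moreover have "t * k \<noteq> 0" using False k by simp
      ultimately show ?thesis using LD zL' unfolding saito_def by blast
    qed
    then show ?thesis using saito_multiply zL by blast
  qed
qed

end

section \<open>Graded dimensions and the combinatorial nature of the exponents\<close>

section \<open>Hilbert functions\<close>

context vector_space_pair
begin

text \<open>The ambient spaces of polynomials are infinite dimensional; the finite set
  \<open>T\<close> guarantees that \<open>V\<close> is not. A basis of the kernel is extended to one
  of \<open>V\<close>, and the added vectors map to a basis of the image.\<close>

lemma rank_nullity_on:
  assumes lin: "Vector_Spaces.linear s1 s2 f" and sub: "vs1.subspace V" and fin: "finite T" "V \<subseteq> vs1.span T"
  shows "vs1.dim V = vs1.dim {x \<in> V. f x = 0} + vs2.dim (f ` V)"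
proof -
  interpret f: Vector_Spaces.linear s1 s2 f by (rule lin)
  let ?N = "{x \<in> V. f x = 0}"
  obtain K where K: "K \<subseteq> ?N" "vs1.independent K" "?N \<subseteq> vs1.span K" "card K = vs1.dim ?N"
    using vs1.basis_exists by blast
  have "K \<subseteq> V" using K(1) by blast
  then obtain B where B: "K \<subseteq> B" "B \<subseteq> V" "vs1.independent B" "V \<subseteq> vs1.span B"
    using K(2) by (rule vs1.maximal_independent_subset_extend)
  have finB: "finite B"
    using vs1.independent_span_bound[OF fin(1) B(3)] B(2) fin(2) by blast
  have cardB: "card B = vs1.dim V" using vs1.basis_card_eq_dim B by blast
  have indD: "vs1.independent (B - K)" by (rule vs1.independent_mono[OF B(3)]) blast
  have inj: "inj_on f (vs1.span (B - K))"
  proof (subst f.inj_on_iff_eq_0)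
    show "vs1.subspace (vs1.span (B - K))" by simp
    show "\<forall>x\<in>vs1.span (B - K). f x = 0 \<longrightarrow> x = 0"
    proof (intro ballI impI)
      fix x assume x: "x \<in> vs1.span (B - K)" "f x = 0"
      have "vs1.span (B - K) \<subseteq> V" using B(2) sub by (intro vs1.span_minimal) auto
      then have xK: "x \<in> vs1.span K" using x K(3) by blast
      have 1: "vs1.representation B x = vs1.representation (B - K) x"
        by (rule vs1.representation_extend[OF B(3) x(1)]) blast
      have 2: "vs1.representation B x = vs1.representation K x"
        by (rule vs1.representation_extend[OF B(3) xK B(1)])
      have "vs1.representation B x b = 0" for b
        using vs1.representation_ne_zero[of "B - K" x b] vs1.representation_ne_zero[of K x b] 1 2 by fastforce
      moreover have "x \<in> vs1.span B" using xK vs1.span_mono[OF B(1)] by blast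
      ultimately show "x = 0"
        using vs1.sum_nonzero_representation_eq[OF B(3), of x] by simp
    qed
  qed
  have ind: "vs2.independent (f ` (B - K))"
    by (rule f.independent_injective_image[OF indD inj])
  have injB: "inj_on f (B - K)" using inj by (rule inj_on_subset) (rule vs1.span_superset)
  have "f ` V \<subseteq> vs2.span (f ` (B - K))"
  proof -
    have "f ` V \<subseteq> f ` vs1.span B" using B(4) by blast
    also have "\<dots> = vs2.span (f ` B)" by (simp add: f.span_image)
    also have "\<dots> \<subseteq> vs2.span (f ` (B - K))"
    proof (rule vs2.span_minimal)
      show "f ` B \<subseteq> vs2.span (f ` (B - K))"
      proof
        fix y assume "y \<in> f ` B"
        then obtain b where b: "b \<in> B" "y = f b" by blast
        show "y \<in> vs2.span (f ` (B - K))"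
        proof (cases "b \<in> K")
          case True
          then show ?thesis using K(1) b vs2.span_zero by auto
        next
          case False
          then show ?thesis using b by (auto intro: vs2.span_base)
        qed
      qed
    qed simp
    finally show ?thesis .
  qed
  moreover have "f ` (B - K) \<subseteq> f ` V" using B(2) by blast
  ultimately have "vs2.dim (f ` V) = card (f ` (B - K))"
    using vs2.basis_card_eq_dim[OF _ _ ind] by simp
  also have "\<dots> = card (B - K)" using injB by (rule card_image)
  finally have "vs2.dim (f ` V) = card (B - K)" .
  moreover have "card B = card K + card (B - K)"
    using finB B(1) by (metis card_Diff_subset card_mono finite_subset le_add_diff_inverse)
  ultimately show ?thesis using cardB K(4) by simp
qed

lemma dim_injective_image:
  assumes lin: "Vector_Spaces.linear s1 s2 f" and sub: "vs1.subspace V" and fin: "finite T" "V \<subseteq> vs1.span T"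
    and inj: "\<And>x. x \<in> V \<Longrightarrow> f x = 0 \<Longrightarrow> x = 0"
  shows "vs2.dim (f ` V) = vs1.dim V"
proof -
  have "f 0 = 0" using lin by (metis linear_0)
  then have "{x \<in> V. f x = 0} = {0}" using inj vs1.subspace_0[OF sub] by auto
  moreover have "vs1.dim {0} = 0"
    using vs1.dim_unique[of "{}" "{0}" 0] by (auto simp: vs1.independent_empty)
  ultimately show ?thesis using rank_nullity_on[OF lin sub fin] by simp
qed

end

definition pscale :: "complex \<Rightarrow> spoly \<Rightarrow> spoly" where
  "pscale a p = const a * p"

definition vscale :: "complex \<Rightarrow> spoly^3 \<Rightarrow> spoly^3" where
  "vscale a x = const a *s x"

interpretation P: vector_space pscale
  by unfold_locales (simp_all add: pscale_def const_add const_mult algebra_simps)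

interpretation V: vector_space vscale
  by unfold_locales (simp_all add: vscale_def const_add const_mult vec_eq_iff algebra_simps)

interpretation PP: vector_space_pair pscale pscale ..

interpretation PV: vector_space_pair pscale vscale ..

interpretation VP: vector_space_pair vscale pscale ..

interpretation VV: vector_space_pair vscale vscale ..

lemma linear_PP:
  assumes "\<And>x y. f (x + y) = f x + f y" "\<And>a x. f (const a * x) = const a * f x"
  shows "Vector_Spaces.linear pscale pscale f"
  using assms P.vector_space_axioms V.vector_space_axioms
  by (simp add: Vector_Spaces.linear_iff pscale_def vscale_def)

lemma linear_PV:
  assumes "\<And>x y. f (x + y) = f x + f y" "\<And>a x. f (const a * x) = const a *s f x"
  shows "Vector_Spaces.linear pscale vscale f"
  using assms P.vector_space_axioms V.vector_space_axioms
  by (simp add: Vector_Spaces.linear_iff pscale_def vscale_def)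

lemma linear_VP:
  assumes "\<And>x y. f (x + y) = f x + f y" "\<And>a x. f (const a *s x) = const a * f x"
  shows "Vector_Spaces.linear vscale pscale f"
  using assms P.vector_space_axioms V.vector_space_axioms
  by (simp add: Vector_Spaces.linear_iff pscale_def vscale_def)

lemma linear_VV:
  assumes "\<And>x y. f (x + y) = f x + f y" "\<And>a x. f (const a *s x) = const a *s f x"
  shows "Vector_Spaces.linear vscale vscale f"
  using assms P.vector_space_axioms V.vector_space_axioms
  by (simp add: Vector_Spaces.linear_iff pscale_def vscale_def)

definition homogeneous_polys :: "nat \<Rightarrow> spoly set" where
  "homogeneous_polys k = {p. homogeneous k p}"

lemma subspace_homogeneous_polys: "P.subspace (homogeneous_polys k)"
  by (auto simp: P.subspace_def homogeneous_polys_def pscale_def intro: homogeneous_add homogeneous_const_mult)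

definition monomials :: "nat \<Rightarrow> (3 \<Rightarrow>\<^sub>0 nat) set" where
  "monomials k = {m. total_degree m = k}"

definition exponents :: "nat \<Rightarrow> nat \<Rightarrow> nat \<Rightarrow> (3 \<Rightarrow>\<^sub>0 nat)" where
  "exponents a b c = Poly_Mapping.single 1 a + Poly_Mapping.single 2 b + Poly_Mapping.single 3 c"

lemma lookup_exponents:
  "Poly_Mapping.lookup (exponents a b c) 1 = a" "Poly_Mapping.lookup (exponents a b c) 2 = b"
  "Poly_Mapping.lookup (exponents a b c) 3 = c"
  by (simp_all add: exponents_def lookup_add lookup_single)

lemma bij_monomials: "bij_betw (\<lambda>(a, b). exponents a b (k - a - b)) (SIGMA a:{..k}. {..k - a}) (monomials k)"
proof (rule bij_betw_byWitness[where f' = "\<lambda>m. (Poly_Mapping.lookup m 1, Poly_Mapping.lookup m 2)"])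
  show "\<forall>m\<in>monomials k. (case (Poly_Mapping.lookup m 1, Poly_Mapping.lookup m 2) of (a, b) \<Rightarrow> exponents a b (k - a - b)) = m"
  proof
    fix m assume "m \<in> monomials k"
    then have "Poly_Mapping.lookup m 3 = k - Poly_Mapping.lookup m 1 - Poly_Mapping.lookup m 2"
      by (simp add: monomials_def total_degree_def sum_3)
    then have "Poly_Mapping.lookup (exponents (Poly_Mapping.lookup m 1) (Poly_Mapping.lookup m 2)
        (k - Poly_Mapping.lookup m 1 - Poly_Mapping.lookup m 2)) i = Poly_Mapping.lookup m i" for i
      using exhaust_3[of i] by (auto simp: lookup_exponents)
    then show "(case (Poly_Mapping.lookup m 1, Poly_Mapping.lookup m 2) of (a, b) \<Rightarrow> exponents a b (k - a - b)) = m"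
      by (simp add: poly_mapping_eqI)
  qed
qed (auto simp: lookup_exponents monomials_def total_degree_def sum_3)

lemma finite_monomials: "finite (monomials k)"
  using bij_betw_finite[OF bij_monomials[of k]] by simp

lemma card_monomials: "2 * card (monomials k) = (k + 1) * (k + 2)"
proof -
  have "card (monomials k) = (\<Sum>a\<le>k. Suc (k - a))"
    using bij_betw_same_card[OF bij_monomials[of k]] by simp
  also have "\<dots> = (\<Sum>a\<le>k. Suc a)"
    by (rule sum.reindex_bij_witness[of _ "\<lambda>a. k - a" "\<lambda>a. k - a"]) auto
  finally have "card (monomials k) = (\<Sum>a\<le>k. Suc a)" .
  moreover have "2 * (\<Sum>a\<le>k. Suc a) = (k + 1) * (k + 2)" by (induction k) auto
  ultimately show ?thesis by simp
qed

lemma homogeneous_polys_span: "homogeneous_polys k \<subseteq> P.span ((\<lambda>m. Poly_Mapping.single m 1) ` monomials k)"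
proof
  fix p assume p: "p \<in> homogeneous_polys k"
  have "Poly_Mapping.single m (Poly_Mapping.lookup p m) = pscale (Poly_Mapping.lookup p m) (Poly_Mapping.single m 1)" for m
    by (simp add: pscale_def const_def mult_single)
  then have "p = (\<Sum>m\<in>Poly_Mapping.keys p. pscale (Poly_Mapping.lookup p m) (Poly_Mapping.single m 1))"
    using spoly_sum_single[of p] by simp
  also have "\<dots> \<in> P.span ((\<lambda>m. Poly_Mapping.single m 1) ` monomials k)"
    using p by (intro P.span_sum P.span_scale P.span_base) (auto simp: homogeneous_polys_def homogeneous_iff monomials_def)
  finally show "p \<in> P.span ((\<lambda>m. Poly_Mapping.single m 1) ` monomials k)" .
qed

text \<open>The binomial coefficient \<open>k + 2\<close> over 2, doubled to avoid division of
  natural numbers.\<close>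

lemma dim_homogeneous_polys: "2 * P.dim (homogeneous_polys k) = (k + 1) * (k + 2)"
proof -
  let ?B = "(\<lambda>m. Poly_Mapping.single m (1::complex)) ` monomials k"
  have inj: "inj_on (\<lambda>m. Poly_Mapping.single m (1::complex)) (monomials k)"
    by (rule inj_onI) (metis lookup_single_eq lookup_single_not_eq zero_neq_one)
  have "P.independent ?B"
  proof (rule P.independent_if_scalars_zero)
    show "finite ?B" using finite_monomials by simp
    fix f :: "spoly \<Rightarrow> complex" and x
    assume s: "(\<Sum>x\<in>?B. pscale (f x) x) = 0" and x: "x \<in> ?B"
    obtain n where n: "n \<in> monomials k" "x = Poly_Mapping.single n 1" using x by blast
    have "(\<Sum>x\<in>?B. pscale (f x) x) = (\<Sum>m\<in>monomials k. Poly_Mapping.single m (f (Poly_Mapping.single m 1)))"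
      by (simp add: sum.reindex[OF inj] pscale_def const_def mult_single)
    then have "(\<Sum>m\<in>monomials k. Poly_Mapping.single m (f (Poly_Mapping.single m 1))) = 0" using s by simp
    then have "Poly_Mapping.lookup (\<Sum>m\<in>monomials k. Poly_Mapping.single m (f (Poly_Mapping.single m 1))) n = 0" by simp
    then have "(\<Sum>m\<in>monomials k. Poly_Mapping.lookup (Poly_Mapping.single m (f (Poly_Mapping.single m 1))) n) = 0"
      by (simp only: lookup_sum)
    moreover have "(\<Sum>m\<in>monomials k. Poly_Mapping.lookup (Poly_Mapping.single m (f (Poly_Mapping.single m 1))) n) =
        (\<Sum>m\<in>monomials k. if m = n then f x else 0)"
      by (rule sum.cong) (auto simp: lookup_single when_def n)
    ultimately show "f x = 0" using n(1) finite_monomials by simp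
  qed
  moreover have "?B \<subseteq> homogeneous_polys k" by (auto simp: homogeneous_polys_def homogeneous_iff monomials_def)
  ultimately have "card ?B = P.dim (homogeneous_polys k)"
    using P.basis_card_eq_dim homogeneous_polys_span by blast
  then show ?thesis using card_monomials[of k] card_image[OF inj] by simp
qed

definition homogeneous_vectors :: "nat \<Rightarrow> (spoly^3) set" where
  "homogeneous_vectors k = {x. vhomogeneous k x}"

lemma homogeneous_vectors_span: "\<exists>T. finite T \<and> homogeneous_vectors k \<subseteq> V.span T"
proof -
  let ?B = "(\<lambda>m. Poly_Mapping.single m (1::complex)) ` monomials k"
  let ?T = "\<Union>i. (\<lambda>p. axis i p) ` ?B"
  have ax: "axis i p \<in> V.span ?T" if "p \<in> homogeneous_polys k" for i p
  proof -
    have lin: "Vector_Spaces.linear pscale vscale (axis i)"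
      by (rule linear_PV) (auto simp: vec_eq_iff axis_def)
    interpret l: Vector_Spaces.linear pscale vscale "axis i" by (rule lin)
    have "axis i p \<in> axis i ` P.span ?B" using that homogeneous_polys_span by blast
    then have "axis i p \<in> V.span (axis i ` ?B)" by (simp only: l.span_image)
    moreover have "V.span (axis i ` ?B) \<subseteq> V.span ?T" by (rule V.span_mono) blast
    ultimately show ?thesis by blast
  qed
  have "homogeneous_vectors k \<subseteq> V.span ?T"
  proof
    fix x assume "x \<in> homogeneous_vectors k"
    then have "x $ i \<in> homogeneous_polys k" for i by (auto simp: homogeneous_vectors_def homogeneous_polys_def vhomogeneous_def)
    then have "(\<Sum>i\<in>UNIV. axis i (x $ i)) \<in> V.span ?T" by (intro V.span_sum ax)
    moreover have "(\<Sum>i\<in>UNIV. axis i (x $ i)) = x"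
      by (simp add: vec_eq_iff sum_3 forall_3 axis_def)
    ultimately show "x \<in> V.span ?T" by simp
  qed
  moreover have "finite ?T" using finite_monomials by auto
  ultimately show ?thesis by blast
qed

text \<open>The degree \<open>k\<close> part of \<open>D(C)\<close>, normalised modulo the Euler derivation by \<open>\<theta>(c\<^sub>0) = 0\<close>.\<close>

definition normal_vectors :: "complex^3 \<Rightarrow> (complex^3) set \<Rightarrow> nat \<Rightarrow> (spoly^3) set" where
  "normal_vectors c0 C k = {x \<in> log_vectors C. vhomogeneous k x \<and> vdot (cvec c0) x = 0}"

definition hilbert_function :: "complex^3 \<Rightarrow> (complex^3) set \<Rightarrow> nat \<Rightarrow> nat" where
  "hilbert_function c0 C k = V.dim (normal_vectors c0 C k)"

lemma subspace_normal_vectors: "V.subspace (normal_vectors c0 C k)"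
  by (auto simp: V.subspace_def normal_vectors_def vscale_def vdot_simps
      intro: log_vectors_0 log_vectors_add log_vectors_scale vhomogeneous_0 vhomogeneous_add vhomogeneous_const)

lemma normal_vectors_span: "\<exists>T. finite T \<and> normal_vectors c0 C k \<subseteq> V.span T"
  using homogeneous_vectors_span[of k] by (auto simp: homogeneous_vectors_def normal_vectors_def)

text \<open>Substituting combinations of two polynomials for the variables turns forms of degree
  \<open>e\<close> into binary forms in these two, and there are only \<open>e + 1\<close> monomials
  for those.\<close>

lemma binary_forms_span:
  fixes P Q :: spoly
  defines "B \<equiv> \<lambda>e. (\<lambda>s. P ^ s * Q ^ (e - s)) ` {..e}"
  assumes g: "\<And>i. \<exists>a b. g i = const a * P + const b * Q" and p: "homogeneous e p"
  shows "psubst g p \<in> P.span (B e)"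
proof -
  have base: "x * y \<in> P.span (B (d + e))" if x: "x \<in> B d" and y: "y \<in> B e" for x y d e
  proof -
    obtain s where s: "s \<le> d" "x = P ^ s * Q ^ (d - s)" using x by (auto simp: B_def)
    obtain t where t: "t \<le> e" "y = P ^ t * Q ^ (e - t)" using y by (auto simp: B_def)
    have eq: "d + e - (s + t) = (d - s) + (e - t)" using s t by simp
    have "x * y = P ^ (s + t) * Q ^ (d + e - (s + t))" unfolding s(2) t(2) eq power_add by (simp only: mult_ac)
    then show ?thesis using s t by (intro P.span_base) (auto simp: B_def)
  qed
  have mult: "x * y \<in> P.span (B (d + e))" if x: "x \<in> P.span (B d)" and y: "y \<in> P.span (B e)" for x y d e
    using x
  proof (induction x rule: P.span_induct_alt)
    case base
    then show ?case by (simp add: P.span_zero)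
  next
    case (step c x z)
    have "x * y \<in> P.span (B (d + e))"
      using y
    proof (induction y rule: P.span_induct_alt)
      case base
      then show ?case by (simp add: P.span_zero)
    next
      case (step c' y z')
      have "x * (pscale c' y + z') = pscale c' (x * y) + x * z'" by (simp add: pscale_def algebra_simps)
      then show ?case using step base[OF \<open>x \<in> B d\<close>] by (simp add: P.span_add P.span_scale)
    qed
    moreover have "(pscale c x + z) * y = pscale c (x * y) + z * y" by (simp add: pscale_def algebra_simps)
    ultimately show ?case using step by (simp add: P.span_add P.span_scale)
  qed
  have one: "1 \<in> P.span (B 0)" by (rule P.span_base) (simp add: B_def)
  have gB: "g i \<in> P.span (B 1)" for i
  proof -
    obtain a b where "g i = pscale a P + pscale b Q" using g by (metis pscale_def)
    moreover have "P \<in> B 1" "Q \<in> B 1" unfolding B_def by (force intro: image_eqI[of _ _ 1] image_eqI[of _ _ 0])+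
    ultimately show ?thesis by (simp add: P.span_add P.span_scale P.span_base)
  qed
  have pw: "g i ^ n \<in> P.span (B n)" for i n
  proof (induction n)
    case (Suc n)
    then show ?case using mult[OF gB[of i] Suc] by simp
  qed (simp add: one)
  have "(\<Prod>i\<in>UNIV. g i ^ Poly_Mapping.lookup m i) \<in> P.span (B (total_degree m))" for m
  proof -
    have "(\<Prod>i\<in>A. g i ^ Poly_Mapping.lookup m i) \<in> P.span (B (\<Sum>i\<in>A. Poly_Mapping.lookup m i))" if "finite A" for A
      using that by (induction A rule: finite_induct) (auto simp: one intro: mult pw)
    then show ?thesis by (simp add: total_degree_def)
  qed
  then have B: "pscale (Poly_Mapping.lookup p m) (\<Prod>i\<in>UNIV. g i ^ Poly_Mapping.lookup m i) \<in> P.span (B e)"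
    if "m \<in> Poly_Mapping.keys p" for m
    using that p by (intro P.span_scale) (auto simp: homogeneous_iff)
  have "psubst g p = (\<Sum>m\<in>Poly_Mapping.keys p. pscale (Poly_Mapping.lookup p m) (\<Prod>i\<in>UNIV. g i ^ Poly_Mapping.lookup m i))"
    by (simp add: psubst_def pscale_def)
  then show ?thesis using P.span_sum[OF B] by simp
qed

context restriction
begin

text \<open>The degree \<open>e\<close> part of the coordinate ring of a projective line has
  dimension at most \<open>e + 1\<close>: two restricted coordinates generate the third.\<close>

lemma \<sigma>_fixed_span:
  obtains T where "finite T" "card T \<le> Suc e" "\<And>p. homogeneous e p \<Longrightarrow> \<sigma> p = p \<Longrightarrow> p \<in> P.span T"
proof -
  obtain i j where "det3 c (axis i 1) (axis j 1) \<noteq> 0" using ex_det3_axis[OF c_nonzero] by blast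
  then have ij: "det3 c (hat (axis i 1)) (hat (axis j 1)) \<noteq> 0"
    by (simp add: hat_def det3_simps)
  define u where "u = hat (axis i 1)"
  define v where "v = hat (axis j 1)"
  have uv: "vcross u v \<noteq> 0" using ij by (auto simp: u_def v_def det3_def vdot_simps)
  have hw: "vdot (hat k) w = 0" for k
    by (subst vdot_commute) (use c_w in \<open>simp add: hat_def vdot_simps vdot_commute[of w]\<close>)
  define g where "g i = var i - const (w $ i) * linear_form c" for i
  have g: "\<exists>a b. g l = const a * linear_form u + const b * linear_form v" for l
  proof -
    have v1: "var l = linear_form (axis l 1)"
      by (rule spoly_eqI) (use exhaust_3[of l] in \<open>auto simp: vdot_3 axis_def\<close>)
    have "g l = \<sigma> (var l)" by (simp add: g_def along_def)
    then have gl: "g l = linear_form (hat (axis l 1))" by (simp add: v1 \<sigma>_linear_form)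
    \<comment> \<open>All these forms vanish at \<open>w\<close> and hence lie in a plane.\<close>
    have "det3 u v (hat (axis l 1)) = 0"
    proof -
      have "vcross u v = det3 c (axis i 1) (axis j 1) *s w" unfolding u_def v_def by (rule vcross_hat)
      then show ?thesis by (simp add: det3_rotate vdot_simps vdot_commute[of w] hw)
    qed
    then obtain a b where "hat (axis l 1) = a *s u + b *s v" using coplanar_span[OF uv] by blast
    then show ?thesis using gl by (auto simp: linear_form_simps)
  qed
  let ?T = "(\<lambda>s. linear_form u ^ s * linear_form v ^ (e - s)) ` {..e}"
  show thesis
  proof (rule that)
    show "finite ?T" by simp
    show "card ?T \<le> Suc e" using card_image_le[of "{..e}"] by simp
    fix p assume p: "homogeneous e p" "\<sigma> p = p"
    have "psubst g p \<in> P.span ?T" using binary_forms_span[of g "linear_form u" "linear_form v" e p] g p by blast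
    then show "p \<in> P.span ?T" using p(2) by (simp add: along_def g_def[abs_def])
  qed
qed

lemma dim_multiples_\<sigma>_fixed:
  assumes "\<And>x. x \<in> W \<Longrightarrow> \<exists>m. x = q * m \<and> \<sigma> m = m \<and> homogeneous e m"
  shows "P.dim W \<le> Suc e"
proof -
  obtain T where T: "finite T" "card T \<le> Suc e" "\<And>p. homogeneous e p \<Longrightarrow> \<sigma> p = p \<Longrightarrow> p \<in> P.span T"
    using \<sigma>_fixed_span by blast
  have lin: "Vector_Spaces.linear pscale pscale ((*) q)" by (rule linear_PP) (simp_all add: algebra_simps)
  interpret l: Vector_Spaces.linear pscale pscale "(*) q" by (rule lin)
  have "W \<subseteq> (*) q ` P.span T" using assms T(3) by blast
  also have "\<dots> = P.span ((*) q ` T)" by (simp only: l.span_image)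
  finally have "P.dim W \<le> card ((*) q ` T)" using T(1) by (intro P.dim_le_card) auto
  then show ?thesis using card_image_le[OF T(1), of "(*) q"] T(2) by linarith
qed

text \<open>Rank and nullity of \<open>nu\<close>: the kernel consists of multiples
  \<open>\<alpha> *s y\<close> with \<open>y\<close> normalised for \<open>C'\<close> in degree
  \<open>k - 1\<close>, and the image consists of \<open>point_poly\<close> times forms of degree
  \<open>k + 1 - card R\<close> on the line.\<close>

lemma hilbert_function_delete_ge:
  assumes c0: "c0 \<in> C'" and k: "card R \<le> k" "1 \<le> k"
  shows "hilbert_function c0 C k \<le> hilbert_function c0 C' (k - 1) + (k + 2 - card R)"
proof -
  obtain T where T: "finite T" "normal_vectors c0 C k \<subseteq> V.span T" using normal_vectors_span by blast
  have lin: "Vector_Spaces.linear vscale pscale nu"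
    by (rule linear_VP) (simp_all add: nu_simps)
  have ker: "{x \<in> normal_vectors c0 C k. nu x = 0} \<subseteq> (*s) \<alpha> ` normal_vectors c0 C' (k - 1)"
  proof
    fix x assume "x \<in> {x \<in> normal_vectors c0 C k. nu x = 0}"
    then have x: "x \<in> log_vectors C" "vhomogeneous k x" "vdot (cvec c0) x = 0" "nu x = 0" by (auto simp: normal_vectors_def)
    obtain h \<psi> where h: "x = h *s euler_vec + \<alpha> *s \<psi>" "\<psi> \<in> log_vectors C'" using nu_eq_0[OF x(1,4)] by blast
    have "h * linear_form c0 + \<alpha> * vdot (cvec c0) \<psi> = 0"
      using x(3) unfolding h(1) by (simp add: vdot_simps linear_form_eq)
    then have "h * linear_form c0 = \<alpha> * (- vdot (cvec c0) \<psi>)" by (simp add: eq_neg_iff_add_eq_0)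
    then have "\<alpha> dvd h * linear_form c0" by simp
    \<comment> \<open>The normalisation at \<open>c0\<close> forces the Euler coefficient to be
      divisible by \<open>\<alpha>\<close> as well, so that the whole vector is.\<close>
    then have "\<alpha> dvd h"
      using linear_form_dvd_mult_iff[OF c_nonzero] reduced_not_dvd[OF reduced c_in] c0 by blast
    then obtain h' where h': "h = \<alpha> * h'" by blast
    define y where "y = h' *s euler_vec + \<psi>"
    have xy: "x = \<alpha> *s y" unfolding h(1) y_def h' by (simp add: vec_eq_iff algebra_simps)
    have "y \<in> log_vectors C'" unfolding y_def using h(2) by (intro log_vectors_add log_vectors_scale log_vectors_euler_vec)
    moreover have "vdot (cvec c0) y = 0" using x(3) c_nonzero by (simp add: xy vdot_simps)
    moreover have "vhomogeneous (k - 1) y"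
      unfolding vhomogeneous_def
    proof
      fix i
      have "homogeneous k (\<alpha> * y $ i)" using x(2) by (simp add: xy vhomogeneous_def)
      then have "shifted_homogeneous (Suc 0) k (y $ i)"
        using homogeneous_mult_cancel[of k \<alpha> "y $ i" "Suc 0"] c_nonzero by simp
      then show "homogeneous (k - 1) (y $ i)" using k(2) by (simp add: shifted_homogeneous_def)
    qed
    ultimately show "x \<in> (*s) \<alpha> ` normal_vectors c0 C' (k - 1)" using xy by (auto simp: normal_vectors_def)
  qed
  have lin2: "Vector_Spaces.linear vscale vscale ((*s) \<alpha>)"
    by (rule linear_VV) (simp_all add: vec_eq_iff algebra_simps)
  obtain T' where T': "finite T'" "normal_vectors c0 C' (k - 1) \<subseteq> V.span T'" using normal_vectors_span by blast
  have "V.dim ((*s) \<alpha> ` normal_vectors c0 C' (k - 1)) = hilbert_function c0 C' (k - 1)"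
    unfolding hilbert_function_def
    by (rule VV.dim_injective_image[OF lin2 subspace_normal_vectors T']) (use c_nonzero in \<open>auto simp: vec_eq_iff\<close>)
  moreover have "V.dim {x \<in> normal_vectors c0 C k. nu x = 0} \<le> V.dim ((*s) \<alpha> ` normal_vectors c0 C' (k - 1))"
  proof -
    obtain B where B: "B \<subseteq> (*s) \<alpha> ` normal_vectors c0 C' (k - 1)" "V.independent B"
      "(*s) \<alpha> ` normal_vectors c0 C' (k - 1) \<subseteq> V.span B" "card B = V.dim ((*s) \<alpha> ` normal_vectors c0 C' (k - 1))"
      using V.basis_exists by blast
    interpret l: Vector_Spaces.linear vscale vscale "(*s) \<alpha>" by (rule lin2)
    have "B \<subseteq> V.span ((*s) \<alpha> ` T')" using B(1) T'(2) by (auto simp: l.span_image)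
    then have "finite B" using V.independent_span_bound[of "(*s) \<alpha> ` T'" B] B(2) T'(1) by simp
    then show ?thesis using V.dim_le_card[of _ B] ker B by fastforce
  qed
  moreover have "P.dim (nu ` normal_vectors c0 C k) \<le> Suc (Suc k - card R)"
  proof (rule dim_multiples_\<sigma>_fixed[where q = point_poly])
    fix p assume "p \<in> nu ` normal_vectors c0 C k"
    then obtain x where x: "x \<in> log_vectors C" "vhomogeneous k x" "p = nu x" by (auto simp: normal_vectors_def)
    obtain m where "nu x = point_poly * m" "\<sigma> m = m" "shifted_homogeneous (card R) (Suc k) m"
      using nu_factor[OF x(1,2)] by blast
    then show "\<exists>m. p = point_poly * m \<and> \<sigma> m = m \<and> homogeneous (Suc k - card R) m"
      using x(3) k(1) by (auto simp: shifted_homogeneous_def)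
  qed
  ultimately show ?thesis
    using VP.rank_nullity_on[OF lin subspace_normal_vectors T] k by (simp add: hilbert_function_def)
qed

text \<open>Rank and nullity of \<open>rho\<close>: the kernel is the space for \<open>C\<close>,
  and the image consists of multiples of \<open>rest_poly\<close>, whose degree is
  \<open>card C' - card R\<close>.\<close>

lemma hilbert_function_delete_le:
  assumes k: "card C' - card R \<le> k"
  shows "hilbert_function c0 C' k \<le> hilbert_function c0 C k + Suc (k - (card C' - card R))"
proof -
  obtain T where T: "finite T" "normal_vectors c0 C' k \<subseteq> V.span T" using normal_vectors_span by blast
  have lin: "Vector_Spaces.linear vscale pscale rho"
    by (rule linear_VP) (simp_all add: rho_simps)
  have ker: "{x \<in> normal_vectors c0 C' k. rho x = 0} = normal_vectors c0 C k"
    using rho_eq_0_iff log_vectors_mono[of C' C] by (auto simp: normal_vectors_def)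
  have "P.dim (rho ` normal_vectors c0 C' k) \<le> Suc (k - (card C' - card R))"
  proof (rule dim_multiples_\<sigma>_fixed[where q = rest_poly])
    fix p assume "p \<in> rho ` normal_vectors c0 C' k"
    then obtain x where x: "x \<in> log_vectors C'" "vhomogeneous k x" "p = rho x" by (auto simp: normal_vectors_def)
    obtain m where "rho x = rest_poly * m" "\<sigma> m = m" "shifted_homogeneous (card C' - card R) k m"
      using rho_factor[OF x(1,2)] by blast
    then show "\<exists>m. p = rest_poly * m \<and> \<sigma> m = m \<and> homogeneous (k - (card C' - card R)) m"
      using x(3) k by (auto simp: shifted_homogeneous_def)
  qed
  then show ?thesis
    using VP.rank_nullity_on[OF lin subspace_normal_vectors T] by (simp add: hilbert_function_def ker)
qed

end

lemma normalise:
  assumes "x \<in> log_vectors C" "c0 \<in> C" "c0 \<noteq> 0" "vhomogeneous a x"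
  obtains g where "vdot (cvec c0) (x - g *s euler_vec) = 0" "vhomogeneous a (x - g *s euler_vec)"
proof -
  obtain g where g: "vdot (cvec c0) x = linear_form c0 * g" using log_vectorsD[OF assms(1,2)] by blast
  have "homogeneous a (linear_form c0 * g)"
    using homogeneous_vdot[OF vhomogeneous_cvec assms(4), of c0] by (simp add: g)
  then have "shifted_homogeneous (Suc 0) a g"
    using assms(3) homogeneous_mult_cancel[of a "linear_form c0" g "Suc 0"] by simp
  then have "vhomogeneous a (x - g *s euler_vec)"
    by (intro vhomogeneous_diff assms(4) vhomogeneous_scale[OF vhomogeneous_euler_vec])
  moreover have "vdot (cvec c0) (x - g *s euler_vec) = 0"
    by (simp add: vdot_simps g linear_form_eq[symmetric] mult.commute)
  ultimately show thesis by (intro that)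
qed

text \<open>Once the basis is normalised at \<open>c0\<close>, the Euler coefficient of a normalised
  vector vanishes, and what remains is a direct sum of two shifted polynomial rings. The determinant
  with \<open>x\<close> separates the summands.\<close>

lemma hilbert_function_free:
  assumes red: "reduced C" and c0: "c0 \<in> C" and free: "free_with C a b" and k: "a \<le> k" "b \<le> k"
  shows "hilbert_function c0 C k = P.dim (homogeneous_polys (k - a)) + P.dim (homogeneous_polys (k - b))"
proof -
  have c00: "c0 \<noteq> 0" using reduced_nonzero[OF red c0] .
  obtain x0 y0 where xy0: "saito C x0 y0" "vhomogeneous a x0" "vhomogeneous b y0"
    using free by (auto simp: free_with_def)
  then have L0: "x0 \<in> log_vectors C" "y0 \<in> log_vectors C" by (auto simp: saito_def)
  obtain g where g: "vdot (cvec c0) (x0 - g *s euler_vec) = 0" "vhomogeneous a (x0 - g *s euler_vec)"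
    using normalise[OF L0(1) c0 c00 xy0(2)] by blast
  obtain g' where g': "vdot (cvec c0) (y0 - g' *s euler_vec) = 0" "vhomogeneous b (y0 - g' *s euler_vec)"
    using normalise[OF L0(2) c0 c00 xy0(3)] by blast
  define x where "x = x0 - g *s euler_vec"
  define y where "y = y0 - g' *s euler_vec"
  have LD: "x \<in> log_vectors C" "y \<in> log_vectors C" unfolding x_def y_def using L0 by (auto intro: log_vectors_diff log_vectors_scale log_vectors_euler_vec)
  have "det3 euler_vec x y = det3 euler_vec x0 y0" by (simp add: x_def y_def det3_simps)
  then have s: "saito C x y" using xy0(1) LD by (simp add: saito_def)
  define D where "D = det3 euler_vec x y"
  have D: "D \<noteq> 0" unfolding D_def by (rule saito_det_nonzero[OF red s])
  have hx: "vhomogeneous a x" "vdot (cvec c0) x = 0" and hy: "vhomogeneous b y" "vdot (cvec c0) y = 0"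
    using g g' by (auto simp: x_def y_def)
  have rep: "\<exists>p q. z = p *s x + q *s y \<and> homogeneous (k - a) p \<and> homogeneous (k - b) q" if z: "z \<in> normal_vectors c0 C k" for z
  proof -
    obtain h p q where h: "z = h *s euler_vec + p *s x + q *s y" "shifted_homogeneous a k p" "shifted_homogeneous b k q"
      using saito_span_homogeneous[OF red s hx(1) hy(1), of z k] z unfolding normal_vectors_def by blast
    have "h * linear_form c0 = 0"
      using z unfolding normal_vectors_def h(1) by (simp add: vdot_simps hx hy linear_form_eq)
    then have "h = 0" using c00 by simp
    then show ?thesis using h k by (auto simp: shifted_homogeneous_def)
  qed
  have inHD: "p *s x + q *s y \<in> normal_vectors c0 C k" if "homogeneous (k - a) p" "homogeneous (k - b) q" for p q
    unfolding normal_vectors_def using that k LD hx hy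
    by (auto simp: vdot_simps shifted_homogeneous_def intro!: log_vectors_add log_vectors_scale vhomogeneous_add
        vhomogeneous_scale[OF hx(1)] vhomogeneous_scale[OF hy(1)])
  obtain T where T: "finite T" "normal_vectors c0 C k \<subseteq> V.span T" using normal_vectors_span by blast
  have lin: "Vector_Spaces.linear vscale pscale (\<lambda>z. det3 euler_vec x z)"
    by (rule linear_VP) (simp_all add: det3_simps)
  have fin: "finite ((\<lambda>m. Poly_Mapping.single m (1::complex)) ` monomials d)" for d
    using finite_monomials by simp
  have ker: "{z \<in> normal_vectors c0 C k. det3 euler_vec x z = 0} = (\<lambda>p. p *s x) ` homogeneous_polys (k - a)"
  proof (intro equalityI subsetI)
    fix z assume z: "z \<in> {z \<in> normal_vectors c0 C k. det3 euler_vec x z = 0}"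
    then obtain p q where pq: "z = p *s x + q *s y" "homogeneous (k - a) p" using rep by blast
    have "q * D = 0" using z by (simp add: pq D_def det3_simps)
    then show "z \<in> (\<lambda>p. p *s x) ` homogeneous_polys (k - a)" using pq D by (auto simp: homogeneous_polys_def)
  next
    fix z assume "z \<in> (\<lambda>p. p *s x) ` homogeneous_polys (k - a)"
    then obtain p where p: "z = p *s x" "homogeneous (k - a) p" by (auto simp: homogeneous_polys_def)
    then show "z \<in> {z \<in> normal_vectors c0 C k. det3 euler_vec x z = 0}" using inHD[OF p(2), of 0] by (simp add: det3_simps)
  qed
  have im: "(\<lambda>z. det3 euler_vec x z) ` normal_vectors c0 C k = (\<lambda>q. q * D) ` homogeneous_polys (k - b)"
  proof (intro equalityI subsetI)
    fix r assume "r \<in> (\<lambda>z. det3 euler_vec x z) ` normal_vectors c0 C k"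
    then obtain p q where "r = det3 euler_vec x (p *s x + q *s y)" "homogeneous (k - b) q" using rep by force
    then show "r \<in> (\<lambda>q. q * D) ` homogeneous_polys (k - b)" by (auto simp: det3_simps D_def homogeneous_polys_def)
  next
    fix r assume "r \<in> (\<lambda>q. q * D) ` homogeneous_polys (k - b)"
    then obtain q where q: "r = q * D" "homogeneous (k - b) q" by (auto simp: homogeneous_polys_def)
    then have "r = det3 euler_vec x (0 *s x + q *s y)" by (simp add: det3_simps D_def)
    then show "r \<in> (\<lambda>z. det3 euler_vec x z) ` normal_vectors c0 C k" using inHD[OF homogeneous_0 q(2)] by blast
  qed
  have "V.dim ((\<lambda>p. p *s x) ` homogeneous_polys (k - a)) = P.dim (homogeneous_polys (k - a))"
  proof (rule PV.dim_injective_image[OF _ subspace_homogeneous_polys fin homogeneous_polys_span])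
    show "Vector_Spaces.linear pscale vscale (\<lambda>p. p *s x)"
      by (rule linear_PV) (simp_all add: vec_eq_iff algebra_simps)
    show "p = 0" if "p *s x = 0" for p
    proof -
      have "det3 euler_vec (p *s x) y = p * D" by (simp add: det3_simps D_def)
      then show "p = 0" using that D by (simp add: det3_simps)
    qed
  qed
  moreover have "P.dim ((\<lambda>q. q * D) ` homogeneous_polys (k - b)) = P.dim (homogeneous_polys (k - b))"
  proof (rule PP.dim_injective_image[OF _ subspace_homogeneous_polys fin homogeneous_polys_span])
    show "Vector_Spaces.linear pscale pscale (\<lambda>q. q * D)"
      by (rule linear_PP) (simp_all add: algebra_simps)
  qed (use D in auto)
  ultimately show ?thesis
    using VP.rank_nullity_on[OF lin subspace_normal_vectors T] by (simp add: hilbert_function_def ker im)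
qed

section \<open>The exponents of a free arrangement are combinatorial\<close>

lemma ex_transversal:
  assumes "finite C"
  shows "\<exists>R. transversal C c R"
proof -
  have "\<exists>R\<subseteq>A. (\<forall>k\<in>A. \<exists>r\<in>R. det3 c r k = 0) \<and> (\<forall>r\<in>R. \<forall>s\<in>R. r \<noteq> s \<longrightarrow> det3 c r s \<noteq> 0)"
    if "finite A" for A :: "(complex^3) set"
    using that
  proof (induction A rule: finite_induct)
    case (insert k A)
    then obtain R where R: "R \<subseteq> A" "\<And>k. k \<in> A \<Longrightarrow> \<exists>r\<in>R. det3 c r k = 0"
      "\<And>r s. r \<in> R \<Longrightarrow> s \<in> R \<Longrightarrow> r \<noteq> s \<Longrightarrow> det3 c r s \<noteq> 0" by blast
    show ?case
    proof (cases "\<exists>r\<in>R. det3 c r k = 0")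
      case True
      then show ?thesis using R by (intro exI[of _ R]) blast
    next
      case False
      then have 1: "det3 c r k \<noteq> 0" "det3 c k r \<noteq> 0" if "r \<in> R" for r
        using that det3_swap(1)[of c k r] by auto
      show ?thesis
      proof (intro exI[of _ "insert k R"] conjI ballI impI)
        fix l assume "l \<in> insert k A"
        then show "\<exists>r\<in>insert k R. det3 c r l = 0" using R(2) by (cases "l = k") (auto simp: det3_simps)
      next
        fix r s assume "r \<in> insert k R" "s \<in> insert k R" "r \<noteq> s"
        then show "det3 c r s \<noteq> 0" using R(3) 1 by blast
      qed (use R(1) in blast)
    qed
  qed simp
  then show ?thesis unfolding transversal_def using assms by (metis finite_Diff)
qed

text \<open>Three lines are concurrent exactly if their determinant vanishes. The lattice enters the
  algebra only through this relation.\<close>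

definition combinatorial_iso ::
  "(complex^3 \<Rightarrow> complex^3) \<Rightarrow> (complex^3) set \<Rightarrow> (complex^3) set \<Rightarrow> bool" where
  "combinatorial_iso \<beta> C D \<longleftrightarrow> bij_betw \<beta> C D \<and>
     (\<forall>c\<in>C. \<forall>k\<in>C. \<forall>l\<in>C. det3 c k l = 0 \<longleftrightarrow> det3 (\<beta> c) (\<beta> k) (\<beta> l) = 0)"

lemma combinatorial_iso_remove:
  assumes "combinatorial_iso \<beta> C D" "c \<in> C"
  shows "combinatorial_iso \<beta> (C - {c}) (D - {\<beta> c})"
  using assms bij_betw_DiffI[of \<beta> C D "{c}" "{\<beta> c}"] by (auto simp: combinatorial_iso_def bij_betw_def)

lemma transversal_image:
  assumes iso: "combinatorial_iso \<beta> C D" and c: "c \<in> C" and R: "transversal C c R"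
  shows "transversal D (\<beta> c) (\<beta> ` R)" "card (\<beta> ` R) = card R"
proof -
  have bij: "bij_betw \<beta> C D" and det: "\<And>c k l. c \<in> C \<Longrightarrow> k \<in> C \<Longrightarrow> l \<in> C \<Longrightarrow> det3 c k l = 0 \<longleftrightarrow> det3 (\<beta> c) (\<beta> k) (\<beta> l) = 0"
    using iso by (auto simp: combinatorial_iso_def)
  have RC: "R \<subseteq> C - {c}" using R by (simp add: transversal_def)
  have inj: "inj_on \<beta> C" and img: "\<beta> ` C = D" using bij by (auto simp: bij_betw_def)
  show "card (\<beta> ` R) = card R" using inj RC by (intro card_image) (auto intro: inj_on_subset)
  show "transversal D (\<beta> c) (\<beta> ` R)"
    unfolding transversal_def
  proof (intro conjI ballI impI)
    show "\<beta> ` R \<subseteq> D - {\<beta> c}" using RC img inj c by (auto dest: inj_onD)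
    fix k assume "k \<in> D - {\<beta> c}"
    then obtain l where l: "l \<in> C - {c}" "k = \<beta> l" using img by blast
    then obtain r where "r \<in> R" "det3 c r l = 0" using R unfolding transversal_def by blast
    then show "\<exists>r\<in>\<beta> ` R. det3 (\<beta> c) r k = 0" using det[OF c, of r l] l RC by auto
  next
    fix r s assume "r \<in> \<beta> ` R" "s \<in> \<beta> ` R" "r \<noteq> s"
    then obtain r' s' where "r' \<in> R" "s' \<in> R" "r = \<beta> r'" "s = \<beta> s'" "r' \<noteq> s'" by blast
    then show "det3 (\<beta> c) r s \<noteq> 0" using det[OF c, of r' s'] RC R by (auto simp: transversal_def)
  qed
qed

text \<open>Two constant vectors spanning the plane \<open>c = 0\<close>.\<close>

lemma free_with_singleton:
  assumes "c \<noteq> 0"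
  shows "free_with {c} 0 0"
proof -
  obtain i j where ij: "det3 c (axis i 1) (axis j 1) \<noteq> 0" using ex_det3_axis[OF assms] by blast
  define u where "u = (axis i 1 :: complex^3)"
  define v where "v = (axis j 1 :: complex^3)"
  have "vcross (vcross c u) (vcross c v) = det3 c u v *s c"
    by (simp add: vec3_defs algebra_simps)
  then have "det3 euler_vec (cvec (vcross c u)) (cvec (vcross c v)) = const (det3 c u v) * linear_form c"
    by (simp add: det3_def cvec_simps vdot_simps linear_form_eq vdot_commute[of euler_vec])
  then have "saito {c} (cvec (vcross c u)) (cvec (vcross c v))"
    unfolding saito_def log_vectors_def defining_poly_def using ij by (auto simp: cvec_simps u_def v_def)
  then show ?thesis unfolding free_with_def using vhomogeneous_cvec by blast
qed

lemma reduced_singleton: "c \<noteq> 0 \<Longrightarrow> reduced {c}"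
  by (auto simp: reduced_def)

text \<open>Induction by deletion, for both arrangements at once. The growth of the Hilbert function
  of the deletion makes the upper and the lower bound coincide; they then give the value for
  \<open>C\<close>, and its growth is the difference of two such values.\<close>

lemma hilbert_function_combinatorial_slope:
  assumes "reduced C" "reduced D" "combinatorial_iso \<beta> C D" "c0 \<in> C"
  shows "\<exists>K. \<forall>k\<ge>K. hilbert_function c0 C k = hilbert_function (\<beta> c0) D k \<and>
    hilbert_function c0 C (Suc k) + card C = hilbert_function c0 C k + 2 * k + 5"
  using assms
proof (induction "card C" arbitrary: C D)
  case 0
  then show ?case using reduced_finite by fastforce
next
  case (Suc d C D)
  have fin: "finite C" using Suc reduced_finite by blast
  have img: "\<beta> ` C = D" using Suc by (auto simp: combinatorial_iso_def bij_betw_def)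
  show ?case
  proof (cases "C = {c0}")
    case True
    then have D: "D = {\<beta> c0}" using img by auto
    have nz: "c0 \<noteq> 0" "\<beta> c0 \<noteq> 0" using Suc True D reduced_nonzero by auto
    have h: "hilbert_function c0 C k = 2 * P.dim (homogeneous_polys k)" "hilbert_function (\<beta> c0) D k = 2 * P.dim (homogeneous_polys k)" for k
      unfolding True D
      using hilbert_function_free[OF reduced_singleton _ free_with_singleton, of _ _ k] nz by auto
    \<comment> \<open>For a single line the value is \<open>(k + 1) * (k + 2)\<close>, which grows
      by \<open>2 * k + 4\<close>, that is \<open>2 * k + 5\<close> minus one line.\<close>
    have "2 * P.dim (homogeneous_polys (Suc k)) + 1 = 2 * P.dim (homogeneous_polys k) + 2 * k + 5" for k
      unfolding dim_homogeneous_polys by simp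
    then show ?thesis unfolding h by (simp add: True)
  next
    case False
    \<comment> \<open>The line \<open>c0\<close> has to survive all deletions because the vectors
      are normalised at it.\<close>
    then obtain c where c: "c \<in> C" "c \<noteq> c0" using Suc.prems(4) by blast
    define C' where "C' = C - {c}"
    define D' where "D' = D - {\<beta> c}"
    have cD: "\<beta> c \<in> D" using c img by blast
    have red: "reduced C'" "reduced D'" using Suc.prems reduced_subset unfolding C'_def D'_def by blast+
    have cardC: "card C = Suc (card C')" unfolding C'_def by (rule card.remove[OF fin c(1)])
    then have d: "d = card C'" using Suc.hyps(2) by simp
    have iso': "combinatorial_iso \<beta> C' D'" unfolding C'_def D'_def by (rule combinatorial_iso_remove[OF Suc.prems(3) c(1)])
    have cardD: "card D' = card C'" using iso' bij_betw_same_card unfolding combinatorial_iso_def by metis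
    have c0: "c0 \<in> C'" using c Suc.prems(4) by (simp add: C'_def)
    have c0D: "\<beta> c0 \<in> D'" using c0 iso' by (auto simp: combinatorial_iso_def bij_betw_def)
    obtain K where K: "\<And>k. k \<ge> K \<Longrightarrow> hilbert_function c0 C' k = hilbert_function (\<beta> c0) D' k"
      "\<And>k. k \<ge> K \<Longrightarrow> hilbert_function c0 C' (Suc k) + card C' = hilbert_function c0 C' k + 2 * k + 5"
      using Suc.hyps(1)[OF d red iso' c0] by blast
    obtain R where R: "transversal C c R" using ex_transversal[OF fin] by blast
    obtain w where w: "vdot c w = 1" using ex_vdot_1 reduced_nonzero[OF Suc.prems(1) c(1)] by blast
    obtain w' where w': "vdot (\<beta> c) w' = 1" using ex_vdot_1 reduced_nonzero[OF Suc.prems(2) cD] by blast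
    interpret C: restriction C c w R
      by unfold_locales (use Suc.prems c w R in auto)
    interpret D: restriction D "\<beta> c" w' "\<beta> ` R"
      by unfold_locales (use Suc.prems cD w' transversal_image[OF Suc.prems(3) c(1) R] in auto)
    have cR: "card (\<beta> ` R) = card R" using transversal_image[OF Suc.prems(3) c(1) R] by simp
    have Rle: "card R \<le> card C'" using C.card_R_le by (simp add: C'_def)
    \<comment> \<open>The bounds use the deletion in degrees \<open>k - 1\<close> and
      \<open>k\<close>. Its growth \<open>2 * (k - 1) + 5 - card C'\<close> is exactly the sum of
      the two correction terms, \<open>k + 2 - n\<close> and \<open>k + 1 - (card C' - n)\<close>,
      so both bounds are equalities.\<close>
    have key: "hilbert_function c0 C k + k + 1 + card R = hilbert_function c0 C' k + card C' \<and>
        hilbert_function (\<beta> c0) D k + k + 1 + card R = hilbert_function (\<beta> c0) D' k + card C'"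
      if k: "k \<ge> Suc (K + card C')" for k
    proof -
      have kK: "k - 1 \<ge> K" "Suc (k - 1) = k" "k \<ge> K" using k by auto
      have le: "card C' - card R \<le> k" using k by simp
      have 1: "hilbert_function c0 C k \<le> hilbert_function c0 C' (k - 1) + (k + 2 - card R)"
        using C.hilbert_function_delete_ge[of c0 k] c0 k Rle by (simp add: C'_def)
      have 2: "hilbert_function c0 C' k \<le> hilbert_function c0 C k + Suc (k - (card C' - card R))"
        by (rule C.hilbert_function_delete_le[folded C'_def, OF le])
      have 3: "hilbert_function (\<beta> c0) D k \<le> hilbert_function (\<beta> c0) D' (k - 1) + (k + 2 - card R)"
        using D.hilbert_function_delete_ge[of "\<beta> c0" k] c0D k Rle cR by (simp add: D'_def)
      have 4: "hilbert_function (\<beta> c0) D' k \<le> hilbert_function (\<beta> c0) D k + Suc (k - (card C' - card R))"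
        by (rule D.hilbert_function_delete_le[folded D'_def, unfolded cR cardD, OF le])
      have 5: "hilbert_function c0 C' k + card C' = hilbert_function c0 C' (k - 1) + 2 * (k - 1) + 5"
        using K(2)[OF kK(1)] kK(2) by simp
      show ?thesis
        using 1 2 3 4 5 K(1)[OF kK(1)] K(1)[OF kK(3)] k Rle by linarith
    qed
    show ?thesis
    proof (intro exI[of _ "Suc (K + card C')"] allI impI)
      fix k assume k: "k \<ge> Suc (K + card C')"
      then have k': "Suc k \<ge> Suc (K + card C')" "k \<ge> K" by auto
      show "hilbert_function c0 C k = hilbert_function (\<beta> c0) D k \<and> hilbert_function c0 C (Suc k) + card C = hilbert_function c0 C k + 2 * k + 5"
        using key[OF k] key[OF k'(1)] K(1)[OF k'(2)] K(2)[OF k'(2)] cardC by linarith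
    qed
  qed
qed

text \<open>With the sum of the exponents fixed by the number of lines, the value of the Hilbert
  function in one large degree fixes the sum of their squares, hence the unordered pair.\<close>

lemma exponents_combinatorial:
  assumes "reduced C" "reduced D" "combinatorial_iso \<beta> C D" "C \<noteq> {}"
    "free_with C a b" "free_with D a' b'"
  shows "(a' = a \<and> b' = b) \<or> (a' = b \<and> b' = a)"
proof -
  obtain c0 where c0: "c0 \<in> C" using assms(4) by blast
  then have c0D: "\<beta> c0 \<in> D" using assms(3) by (auto simp: combinatorial_iso_def bij_betw_def)
  obtain K where K: "\<And>k. k \<ge> K \<Longrightarrow> hilbert_function c0 C k = hilbert_function (\<beta> c0) D k"
    using hilbert_function_combinatorial_slope[OF assms(1-3) c0] by blast
  have "card C = card D" using assms(3) bij_betw_same_card by (auto simp: combinatorial_iso_def)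
  then have sum: "a + b = a' + b'"
    using free_with_degrees[OF assms(1,5)] free_with_degrees[OF assms(2,6)] by simp
  define k where "k = K + a + b + a' + b'"
  have "P.dim (homogeneous_polys (k - a)) + P.dim (homogeneous_polys (k - b)) = P.dim (homogeneous_polys (k - a')) + P.dim (homogeneous_polys (k - b'))"
    using K[of k] hilbert_function_free[OF assms(1) c0 assms(5), of k] hilbert_function_free[OF assms(2) c0D assms(6), of k]
    by (simp add: k_def)
  then have "(k - a + 1) * (k - a + 2) + (k - b + 1) * (k - b + 2) = (k - a' + 1) * (k - a' + 2) + (k - b' + 1) * (k - b' + 2)"
    using dim_homogeneous_polys[of "k - a"] dim_homogeneous_polys[of "k - b"] dim_homogeneous_polys[of "k - a'"] dim_homogeneous_polys[of "k - b'"] by linarith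
  then have "int ((k - a + 1) * (k - a + 2) + (k - b + 1) * (k - b + 2)) = int ((k - a' + 1) * (k - a' + 2) + (k - b' + 1) * (k - b' + 2))"
    by (rule arg_cong)
  then have "(int (k - a) + 1) * (int (k - a) + 2) + (int (k - b) + 1) * (int (k - b) + 2) =
      (int (k - a') + 1) * (int (k - a') + 2) + (int (k - b') + 1) * (int (k - b') + 2)"
    by (simp only: of_nat_add of_nat_mult of_nat_1 of_nat_numeral)
  moreover have "int (k - a) = int k - int a" "int (k - b) = int k - int b"
    "int (k - a') = int k - int a'" "int (k - b') = int k - int b'"
    by (auto simp: k_def)
  ultimately have e0: "(int k - int a + 1) * (int k - int a + 2) + (int k - int b + 1) * (int k - int b + 2) =
      (int k - int a' + 1) * (int k - int a' + 2) + (int k - int b' + 1) * (int k - int b' + 2)"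
    by metis
  define A B A' B' k' where "A = int a" and "B = int b" and "A' = int a'" and "B' = int b'" and "k' = int k"
  note defs = this
  have e: "(k' - A + 1) * (k' - A + 2) + (k' - B + 1) * (k' - B + 2) = (k' - A' + 1) * (k' - A' + 2) + (k' - B' + 1) * (k' - B' + 2)"
    using e0 unfolding defs .
  have B: "B = A' + B' - A" using sum by (simp add: A_def B_def A'_def B'_def)
  \<comment> \<open>With \<open>B\<close> eliminated, the terms involving \<open>k'\<close> cancel
    and the remaining quadratic expression factors.\<close>
  have "2 * ((A - A') * (A - B')) = 0"
    using e unfolding B by (simp add: algebra_simps)
  then have "A = A' \<or> A = B'" by simp
  then show ?thesis using sum by (auto simp: A_def A'_def B'_def)
qed

text \<open>The hypothesis \<open>minimal\<close> is the absence of smaller counterexamples in terms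
  of Saito's criterion, for pairs of lines matched by \<open>\<beta>\<close>. A line with more than
  \<open>a\<close> points would make \<open>D\<close> free.\<close>

theorem minimal_counterexample_bound:
  assumes red: "reduced C" "reduced D" and iso: "combinatorial_iso \<beta> C D"
    and free: "free_with C a b" "a \<le> b" and nonfree: "\<not> (\<exists>x y. saito D x y)"
    and minimal: "\<And>c a' b'. c \<in> C \<Longrightarrow> C \<noteq> {c} \<Longrightarrow> free_with (C - {c}) a' b' \<Longrightarrow> \<exists>x y. saito (D - {\<beta> c}) x y"
    and c: "c \<in> C" and R: "transversal C c R"
  shows "card R \<le> a"
proof (rule ccontr)
  assume "\<not> card R \<le> a"
  then have lt: "a < card R" by simp
  have cD: "\<beta> c \<in> D" using c iso by (auto simp: combinatorial_iso_def bij_betw_def)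
  obtain w where w: "vdot c w = 1" using ex_vdot_1 reduced_nonzero[OF red(1) c] by blast
  obtain w' where w': "vdot (\<beta> c) w' = 1" using ex_vdot_1 reduced_nonzero[OF red(2) cD] by blast
  interpret C: restriction C c w R
    by unfold_locales (use red c w R in auto)
  interpret D: restriction D "\<beta> c" w' "\<beta> ` R"
    by unfold_locales (use red cD w' transversal_image[OF iso c R] in auto)
  have cR: "card (\<beta> ` R) = card R" using transversal_image[OF iso c R] by simp
  have ne: "C - {c} \<noteq> {}" using lt C.R_subset by fastforce
  \<comment> \<open>Both outcomes of \<open>deletion\<close> leave \<open>card R - 1\<close> as one
    exponent: it is \<open>b\<close> beside \<open>a - 1\<close>, or \<open>a\<close> beside
    \<open>b - 1\<close>. This is the exponent that \<open>addition\<close> asks for on the other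
    side.\<close>
  obtain e where e: "free_with (C - {c}) e (card R - 1)"
    using C.deletion[OF free lt] free_with_swap by (metis diff_Suc_1)
  then obtain x y where "saito (D - {\<beta> c}) x y" using minimal[OF c _ e] ne by blast
  then obtain a' b' where ab: "free_with (D - {\<beta> c}) a' b'"
    using saito_homogeneous[OF D.reduced'] by (metis free_with_def)
  have "(a' = e \<and> b' = card R - 1) \<or> (a' = card R - 1 \<and> b' = e)"
    by (rule exponents_combinatorial[OF C.reduced' D.reduced' combinatorial_iso_remove[OF iso c] ne e ab])
  then have "free_with (D - {\<beta> c}) e (card R - 1)" using ab free_with_swap by blast
  then have "\<exists>x y. saito D x y" using D.addition[of e "card R - 1"] cR lt by simp
  then show False using nonfree by blast
qed

section \<open>Passage from point sets and quotient modules to polynomial vectors\<close>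

section \<open>Points and lines\<close>

lemma subspace_of_proj_point: "v \<noteq> 0 \<Longrightarrow> subspace_of (proj_point v) = vec.span {v}"
  unfolding proj_point_def by (rule Abs_proj_plane_inverse) blast

lemma proj_plane_cases:
  obtains v where "v \<noteq> 0" "P = proj_point v"
proof -
  obtain v where v: "v \<noteq> 0" "subspace_of P = vec.span {v}" using subspace_of[of P] by blast
  then have "P = proj_point v" unfolding proj_point_def by (metis subspace_of_inverse)
  then show thesis using that v by blast
qed

lemma in_span_singleton: "u \<in> vec.span {v} \<longleftrightarrow> (\<exists>t. u = t *s v)" for v :: "complex^3"
  by (auto simp: vec.span_singleton)

lemma proj_point_in_line:
  assumes "v \<noteq> 0"
  shows "proj_point v \<in> line c \<longleftrightarrow> vdot c v = 0"
proof -
  have "proj_point v \<in> line c \<longleftrightarrow> (\<forall>t. vdot c (t *s v) = 0)"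
    by (auto simp: line_def subspace_of_proj_point[OF assms] in_span_singleton)
  also have "\<dots> \<longleftrightarrow> vdot c v = 0" by (auto simp: vdot_simps dest: spec[of _ 1])
  finally show ?thesis .
qed

lemma line_subset_iff:
  assumes "c \<noteq> 0"
  shows "line c \<subseteq> line k \<longleftrightarrow> vcross c k = 0"
proof
  assume *: "line c \<subseteq> line k"
  have "vdot k v = 0" if "vdot c v = 0" for v
    using * that proj_point_in_line[of v] by (cases "v = 0") (auto simp: vdot_simps)
  then show "vcross c k = 0"
    using linear_form_dvd_iff_vanishes[OF assms, of "linear_form k"] linear_form_dvd_linear_form_iff[OF assms] by simp
next
  assume "vcross c k = 0"
  then obtain t where "k = t *s c" using vcross_eq_0_iff[OF assms] by blast
  then show "line c \<subseteq> line k" by (auto simp: line_def vdot_simps)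
qed

lemma line_eq_iff: "c \<noteq> 0 \<Longrightarrow> k \<noteq> 0 \<Longrightarrow> line c = line k \<longleftrightarrow> vcross c k = 0"
  using line_subset_iff[of c k] line_subset_iff[of k c] vcross_anticommute[of c k] by auto

lemma line_nonempty: "line c \<noteq> {}"
proof -
  have "\<exists>v. v \<noteq> 0 \<and> vdot c v = 0"
  proof (cases "c = 0")
    case True
    then show ?thesis by (intro exI[of _ "axis 1 1"]) (simp add: vdot_simps axis_eq_0_iff)
  next
    case False
    then obtain i j where "det3 c (axis i 1) (axis j 1) \<noteq> 0" using ex_det3_axis by blast
    then have "vcross c (axis i 1) \<noteq> 0" by (auto simp: det3_rotate vdot_simps)
    then show ?thesis using vdot_vcross_self by blast
  qed
  then show ?thesis using proj_point_in_line by blast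
qed

lemma vanishing_ideal_line:
  assumes "c \<noteq> 0"
  shows "vanishing_ideal (line c) = {p. linear_form c dvd p}"
proof (intro equalityI subsetI)
  fix p assume p: "p \<in> vanishing_ideal (line c)"
  have "poly_eval p v = 0" if v: "vdot c v = 0" for v
  proof (cases "v = 0")
    \<comment> \<open>The zero vector belongs to the subspace of every point, and the line has a
      point.\<close>
    case True
    obtain P where P: "P \<in> line c" using line_nonempty by blast
    obtain u where u: "u \<noteq> 0" "P = proj_point u" using proj_plane_cases by blast
    have "0 \<in> subspace_of P" unfolding u(2) subspace_of_proj_point[OF u(1)] by (rule vec.span_zero)
    then show ?thesis using p P True by (auto simp: vanishing_ideal_def)
  next
    case False
    have "v \<in> subspace_of (proj_point v)"
      unfolding subspace_of_proj_point[OF False] by (rule vec.span_base) simp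
    moreover have "proj_point v \<in> line c" using proj_point_in_line[OF False] v by blast
    ultimately show ?thesis using p by (auto simp: vanishing_ideal_def)
  qed
  then show "p \<in> {p. linear_form c dvd p}" using linear_form_dvd_iff_vanishes[OF assms] by blast
next
  fix p assume "p \<in> {p. linear_form c dvd p}"
  then show "p \<in> vanishing_ideal (line c)"
    by (auto simp: vanishing_ideal_def line_def)
qed

text \<open>The ideal of a line is generated by its equation, so by the product rule a derivation
  preserves it once the value on the equation lies in it.\<close>

lemma log_derivations_line:
  assumes "0 \<notin> C"
  shows "log_derivations (line ` C) = der ` log_vectors C"
proof (intro equalityI subsetI)
  fix \<theta> assume t: "\<theta> \<in> log_derivations (line ` C)"
  then obtain x where x: "\<theta> = der x" using derivation_eq_der unfolding log_derivations_def by blast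
  have "linear_form c dvd vdot (cvec c) x" if c: "c \<in> C" for c
  proof -
    have "c \<noteq> 0" using assms c by blast
    then have "linear_form c \<in> vanishing_ideal (line c)" using vanishing_ideal_line by simp
    then have "der x (linear_form c) \<in> vanishing_ideal (line c)"
      using t c unfolding x log_derivations_def by blast
    then show ?thesis using vanishing_ideal_line[OF \<open>c \<noteq> 0\<close>] by (simp add: der_linear_form)
  qed
  then show "\<theta> \<in> der ` log_vectors C" using x by (auto simp: log_vectors_def)
next
  fix \<theta> assume "\<theta> \<in> der ` log_vectors C"
  then obtain x where x: "\<theta> = der x" "x \<in> log_vectors C" by blast
  have "der x ` vanishing_ideal (line c) \<subseteq> vanishing_ideal (line c)" if c: "c \<in> C" for c
  proof -
    have c0: "c \<noteq> 0" using assms c by blast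
    show ?thesis
      unfolding vanishing_ideal_line[OF c0]
    proof safe
      fix p assume "linear_form c dvd p"
      then obtain q where q: "p = linear_form c * q" by blast
      show "linear_form c dvd der x p"
        unfolding q der_simps der_linear_form using log_vectorsD[OF x(2) c] by (intro dvd_add) auto
    qed
  qed
  then show "\<theta> \<in> log_derivations (line ` C)" unfolding log_derivations_def x(1) using derivation_der by blast
qed

section \<open>Quotient modules\<close>

text \<open>A structure inherited by quotients. The construction is applied twice, first modulo the
  Euler derivation and then modulo the equation of a line.\<close>

locale smodule =
  fixes M :: "(spoly, 'b) graded_module" (structure)
  assumes abelian: "abelian_group M"
    and smult_closed: "x \<in> carrier M \<Longrightarrow> a \<odot> x \<in> carrier M"
    and smult_add: "x \<in> carrier M \<Longrightarrow> y \<in> carrier M \<Longrightarrow> a \<odot> (x \<oplus> y) = a \<odot> x \<oplus> a \<odot> y"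
    and smult_zero: "a \<odot> \<zero> = \<zero>"

locale squotient = smodule M for M :: "(spoly, 'b) graded_module" (structure) +
  fixes N :: "'b set"
  assumes N_subset: "N \<subseteq> carrier M" and N_zero: "\<zero> \<in> N"
    and N_add: "x \<in> N \<Longrightarrow> y \<in> N \<Longrightarrow> x \<oplus> y \<in> N"
    and N_inv: "x \<in> N \<Longrightarrow> \<exists>y\<in>N. y \<oplus> x = \<zero>"
    and N_smult: "x \<in> N \<Longrightarrow> a \<odot> x \<in> N"
begin

lemma abelian_subgroup_N: "abelian_subgroup N M"
proof -
  interpret abelian_group M by (rule abelian)
  have "subgroup N (add_monoid M)"
  proof (rule subgroup.intro)
    show "N \<subseteq> carrier (add_monoid M)" using N_subset by simp
    show "x \<otimes>\<^bsub>add_monoid M\<^esub> y \<in> N" if "x \<in> N" "y \<in> N" for x y using N_add that by simp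
    show "\<one>\<^bsub>add_monoid M\<^esub> \<in> N" using N_zero by simp
    show "inv\<^bsub>add_monoid M\<^esub> x \<in> N" if x: "x \<in> N" for x
    proof -
      obtain y where y: "y \<in> N" "y \<oplus> x = \<zero>" using N_inv x by blast
      then have "\<ominus> x = y" using minus_equality[of y x] x N_subset by blast
      then show ?thesis using y by (simp add: a_inv_def)
    qed
  qed
  then show ?thesis by (intro abelian_subgroupI3 additive_subgroupI abelian)
qed

sublocale N: abelian_subgroup N M by (rule abelian_subgroup_N)

abbreviation Q where "Q \<equiv> quotient_module M N"

definition cls :: "'b \<Rightarrow> 'b set" where
  "cls x = N +> x"

lemma quotient_carrier: "carrier Q = cls ` carrier M"
  by (auto simp: quotient_module_def A_RCOSETS_def' cls_def)

lemma quotient_zero: "\<zero>\<^bsub>Q\<^esub> = cls \<zero>"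
  using N.a_coset_join2[of \<zero>] N.additive_subgroup_axioms N_zero
  by (simp add: quotient_module_def cls_def N.zero_closed N.a_subgroup additive_subgroup.a_subgroup)

lemma cls_self: "x \<in> carrier M \<Longrightarrow> x \<in> cls x"
  unfolding cls_def by (rule N.a_rcos_self)

lemma cls_add: "x \<in> carrier M \<Longrightarrow> y \<in> carrier M \<Longrightarrow> cls x \<oplus>\<^bsub>Q\<^esub> cls y = cls (x \<oplus> y)"
  by (simp add: quotient_module_def cls_def N.a_rcos_sum)

lemma cls_cong: "y \<in> cls x \<Longrightarrow> x \<in> carrier M \<Longrightarrow> cls y = cls x"
  unfolding cls_def using N.a_repr_independence'[of y x] by simp

lemma cls_eq_iff:
  assumes "x \<in> carrier M" "y \<in> carrier M"
  shows "cls x = cls y \<longleftrightarrow> (\<exists>n\<in>N. x = n \<oplus> y)"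
proof
  assume "cls x = cls y"
  then have "x \<in> cls y" using cls_self assms by blast
  then show "\<exists>n\<in>N. x = n \<oplus> y" by (auto simp: cls_def a_r_coset_def')
next
  assume "\<exists>n\<in>N. x = n \<oplus> y"
  then have "x \<in> cls y" by (auto simp: cls_def a_r_coset_def')
  then show "cls x = cls y" using cls_cong assms by blast
qed

lemma cls_smult:
  assumes x: "x \<in> carrier M"
  shows "a \<odot>\<^bsub>Q\<^esub> cls x = cls (a \<odot> x)"
proof -
  have "cls (a \<odot> y) = cls (a \<odot> x)" if yx: "y \<in> cls x" for y
  proof -
    obtain n where n: "n \<in> N" "y = n \<oplus> x" using yx by (auto simp: cls_def a_r_coset_def')
    have y: "y \<in> carrier M" using n x N_subset N.a_closed by blast
    have "a \<odot> y = (a \<odot> n) \<oplus> (a \<odot> x)" using n x N_subset smult_add by blast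
    then show ?thesis using cls_eq_iff[of "a \<odot> y" "a \<odot> x"] N_smult n(1) smult_closed x y by blast
  qed
  then have "(\<Union>y\<in>cls x. cls (a \<odot> y)) = cls (a \<odot> x)" using cls_self[OF x] by blast
  then show ?thesis by (simp add: quotient_module_def cls_def)
qed

lemma quotient_component: "component Q d = cls ` component M d"
  by (simp add: quotient_module_def cls_def)

lemma smodule_quotient: "smodule Q"
proof (rule smodule.intro)
  show "abelian_group Q"
  proof (rule abelian_groupI)
    fix X assume "X \<in> carrier Q"
    then obtain x where x: "x \<in> carrier M" "X = cls x" unfolding quotient_carrier by blast
    then show "\<exists>Z\<in>carrier Q. Z \<oplus>\<^bsub>Q\<^esub> X = \<zero>\<^bsub>Q\<^esub>"
      unfolding quotient_carrier quotient_zero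
      by (intro bexI[of _ "cls (\<ominus> x)"]) (auto simp: cls_add N.l_neg)
  qed (auto simp: quotient_carrier quotient_zero cls_add N.a_assoc N.a_comm N.a_lcomm)
next
  fix X a assume "X \<in> carrier Q"
  then show "a \<odot>\<^bsub>Q\<^esub> X \<in> carrier Q" unfolding quotient_carrier using cls_smult smult_closed by auto
next
  fix X Z a assume "X \<in> carrier Q" "Z \<in> carrier Q"
  then obtain x z where "x \<in> carrier M" "z \<in> carrier M" "X = cls x" "Z = cls z" unfolding quotient_carrier by blast
  then show "a \<odot>\<^bsub>Q\<^esub> (X \<oplus>\<^bsub>Q\<^esub> Z) = a \<odot>\<^bsub>Q\<^esub> X \<oplus>\<^bsub>Q\<^esub> a \<odot>\<^bsub>Q\<^esub> Z"
    by (simp add: cls_add cls_smult smult_closed smult_add N.a_closed)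
next
  fix a
  show "a \<odot>\<^bsub>Q\<^esub> \<zero>\<^bsub>Q\<^esub> = \<zero>\<^bsub>Q\<^esub>" unfolding quotient_zero by (simp add: cls_smult smult_zero)
qed

end

section \<open>The module of derivations modulo the Euler derivation\<close>

locale arrangement =
  fixes C :: "(complex^3) set"
  assumes reduced: "reduced C"
begin

abbreviation DM where "DM \<equiv> derivation_module (line ` C)"

abbreviation E :: "(spoly \<Rightarrow> spoly) set" where "E \<equiv> {(\<lambda>p. f * euler_derivation p) | f. True}"

lemma C_nonzero: "0 \<notin> C"
  using reduced by (simp add: reduced_def)

lemma carrier_DM: "carrier DM = der ` log_vectors C"
  by (simp add: derivation_module_def log_derivations_line[OF C_nonzero])

lemma DM_simps: "der x \<oplus>\<^bsub>DM\<^esub> der y = der (x + y)" "f \<odot>\<^bsub>DM\<^esub> der x = der (f *s x)" "\<zero>\<^bsub>DM\<^esub> = der 0"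
  by (simp_all add: derivation_module_def fun_eq_iff der_add der_scale der_0)

lemma E_eq: "E = range (\<lambda>f. der (f *s euler_vec))"
  by (auto simp: euler_derivation_eq der_scale[abs_def] fun_eq_iff)

lemma DM_component: "component DM d = der ` {x \<in> log_vectors C. vhomogeneous d x}"
  unfolding derivation_module_def log_derivations_line[OF C_nonzero]
  using vhomogeneous_iff_der by auto

sublocale DM: squotient DM E
proof (intro squotient.intro smodule.intro squotient_axioms.intro)
  show "abelian_group DM"
  proof (rule abelian_groupI)
    fix \<theta> assume "\<theta> \<in> carrier DM"
    then obtain x where "\<theta> = der x" "x \<in> log_vectors C" unfolding carrier_DM by blast
    moreover have "- x \<in> log_vectors C" if "x \<in> log_vectors C" using log_vectors_diff[OF log_vectors_0 that] by simp
    ultimately show "\<exists>\<eta>\<in>carrier DM. \<eta> \<oplus>\<^bsub>DM\<^esub> \<theta> = \<zero>\<^bsub>DM\<^esub>"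
      unfolding carrier_DM by (intro bexI[of _ "der (- x)"]) (auto simp: DM_simps)
  qed (auto simp: carrier_DM DM_simps add_ac intro: log_vectors_add log_vectors_0)
  show "E \<subseteq> carrier DM" unfolding E_eq carrier_DM by (auto intro: log_vectors_scale log_vectors_euler_vec)
  show "\<zero>\<^bsub>DM\<^esub> \<in> E" unfolding E_eq DM_simps by (rule image_eqI[of _ _ 0]) auto
  show "\<theta> \<oplus>\<^bsub>DM\<^esub> \<eta> \<in> E" if "\<theta> \<in> E" "\<eta> \<in> E" for \<theta> \<eta>
    using that unfolding E_eq by (auto simp: DM_simps simp flip: vector_sadd_rdistrib)
  show "\<exists>\<eta>\<in>E. \<eta> \<oplus>\<^bsub>DM\<^esub> \<theta> = \<zero>\<^bsub>DM\<^esub>" if \<theta>: "\<theta> \<in> E" for \<theta>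
  proof -
    obtain f where "\<theta> = der (f *s euler_vec)" using \<theta> unfolding E_eq by blast
    then show ?thesis unfolding E_eq
      by (intro bexI[of _ "der (- f *s euler_vec)"]) (auto simp: DM_simps simp flip: vector_sadd_rdistrib)
  qed
  show "f \<odot>\<^bsub>DM\<^esub> \<theta> \<in> E" if "\<theta> \<in> E" for f \<theta>
    using that unfolding E_eq by (auto simp: DM_simps vector_smult_assoc)
qed (auto simp: carrier_DM DM_simps vector_add_ldistrib intro: log_vectors_scale)

abbreviation D where "D \<equiv> D0 (line ` C)"

lemma D_eq: "D = quotient_module DM E"
  by (simp add: D0_def)

definition cl :: "spoly^3 \<Rightarrow> (spoly \<Rightarrow> spoly) set" where
  "cl x = DM.cls (der x)"

lemma cl_carrier: "carrier D = cl ` log_vectors C"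
  unfolding D_eq DM.quotient_carrier carrier_DM cl_def by blast

lemma cl_add: "x \<in> log_vectors C \<Longrightarrow> y \<in> log_vectors C \<Longrightarrow> cl x \<oplus>\<^bsub>D\<^esub> cl y = cl (x + y)"
  unfolding D_eq cl_def by (subst DM.cls_add) (auto simp: carrier_DM DM_simps)

lemma cl_smult: "x \<in> log_vectors C \<Longrightarrow> f \<odot>\<^bsub>D\<^esub> cl x = cl (f *s x)"
  unfolding D_eq cl_def by (subst DM.cls_smult) (auto simp: carrier_DM DM_simps)

lemma cl_zero: "\<zero>\<^bsub>D\<^esub> = cl 0"
  unfolding D_eq cl_def DM.quotient_zero DM_simps ..

lemma cl_eq_iff:
  assumes "x \<in> log_vectors C" "y \<in> log_vectors C"
  shows "cl x = cl y \<longleftrightarrow> (\<exists>h. x = h *s euler_vec + y)"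
proof -
  have "cl x = cl y \<longleftrightarrow> (\<exists>n\<in>E. der x = n \<oplus>\<^bsub>DM\<^esub> der y)"
    unfolding cl_def using assms by (intro DM.cls_eq_iff) (auto simp: carrier_DM)
  also have "\<dots> \<longleftrightarrow> (\<exists>h. x = h *s euler_vec + y)" unfolding E_eq by (simp add: DM_simps der_inject)
  finally show ?thesis .
qed

lemma cl_component: "component D d = cl ` {x \<in> log_vectors C. vhomogeneous d x}"
  unfolding D_eq DM.quotient_component DM_component cl_def by blast

lemma smodule_D: "smodule D"
  unfolding D_eq by (rule DM.smodule_quotient)

lemma log_vectors_sum: "(\<And>b. b \<in> S \<Longrightarrow> g b \<in> log_vectors C) \<Longrightarrow> (\<Sum>b\<in>S. f b *s g b) \<in> log_vectors C"
  by (induction S rule: infinite_finite_induct) (auto intro: log_vectors_0 log_vectors_add log_vectors_scale)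

lemma cl_finsum:
  assumes "finite S" "\<And>b. b \<in> S \<Longrightarrow> g b \<in> log_vectors C" "\<And>b. b \<in> S \<Longrightarrow> cl (g b) = b"
  shows "(\<Oplus>\<^bsub>D\<^esub>b\<in>S. f b \<odot>\<^bsub>D\<^esub> b) = cl (\<Sum>b\<in>S. f b *s g b)"
  using assms
proof (induction S rule: finite_induct)
  case empty
  interpret abelian_group D using smodule_D by (simp add: smodule_def)
  show ?case by (simp add: cl_zero)
next
  case (insert b S)
  interpret abelian_group D using smodule_D by (simp add: smodule_def)
  have trm: "f x \<odot>\<^bsub>D\<^esub> x = cl (f x *s g x)" if "x \<in> insert b S" for x
    using cl_smult[of "g x" "f x"] insert.prems[OF that] by simp
  then have car: "f x \<odot>\<^bsub>D\<^esub> x \<in> carrier D" if "x \<in> insert b S" for x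
    using that insert.prems(1)[OF that] log_vectors_scale unfolding cl_carrier by (metis imageI)
  have "(\<Oplus>\<^bsub>D\<^esub>b\<in>insert b S. f b \<odot>\<^bsub>D\<^esub> b) = f b \<odot>\<^bsub>D\<^esub> b \<oplus>\<^bsub>D\<^esub> (\<Oplus>\<^bsub>D\<^esub>b\<in>S. f b \<odot>\<^bsub>D\<^esub> b)"
    using insert.hyps car by (intro finsum_insert) auto
  also have "(\<Oplus>\<^bsub>D\<^esub>b\<in>S. f b \<odot>\<^bsub>D\<^esub> b) = cl (\<Sum>b\<in>S. f b *s g b)" using insert.IH insert.prems by simp
  also have "f b \<odot>\<^bsub>D\<^esub> b = cl (f b *s g b)" using trm by simp
  also have "cl (f b *s g b) \<oplus>\<^bsub>D\<^esub> cl (\<Sum>b\<in>S. f b *s g b) = cl (f b *s g b + (\<Sum>b\<in>S. f b *s g b))"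
    using insert.prems(1) by (intro cl_add log_vectors_scale log_vectors_sum) auto
  finally show ?case using insert.hyps by simp
qed

definition coeffs :: "(spoly \<Rightarrow> spoly) set set \<Rightarrow> ((spoly \<Rightarrow> spoly) set \<Rightarrow> spoly) \<Rightarrow> bool" where
  "coeffs B f \<longleftrightarrow> (\<forall>b. b \<notin> B \<longrightarrow> f b = 0) \<and> finite {b. f b \<noteq> 0}"

text \<open>Uniqueness of the coefficients is only needed for the zero element, that is, for relations
  modulo the Euler derivation.\<close>

lemma module_basis_iff:
  assumes g: "\<And>b. b \<in> B \<Longrightarrow> g b \<in> log_vectors C" "\<And>b. b \<in> B \<Longrightarrow> cl (g b) = b"
  shows "module_basis poly_ring D B \<longleftrightarrow>
    (\<forall>x\<in>log_vectors C. \<exists>f h. coeffs B f \<and> x = h *s euler_vec + (\<Sum>b\<in>{b. f b \<noteq> 0}. f b *s g b)) \<and>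
    (\<forall>f h. coeffs B f \<and> h *s euler_vec + (\<Sum>b\<in>{b. f b \<noteq> 0}. f b *s g b) = 0 \<longrightarrow> f = (\<lambda>b. 0))"
proof -
  define S where "S f = (\<Sum>b\<in>{b. f b \<noteq> 0}. f b *s g b)" for f
  have sub: "b \<in> B" if "coeffs B f" "f b \<noteq> 0" for f b using that by (auto simp: coeffs_def)
  have S_LD: "S f \<in> log_vectors C" if "coeffs B f" for f
    unfolding S_def using sub[OF that] g(1) by (intro log_vectors_sum) blast
  have S_eq: "S f = (\<Sum>b\<in>T. f b *s g b)" if "finite T" "{b. f b \<noteq> 0} \<subseteq> T" for f T
    unfolding S_def by (rule sum.mono_neutral_left) (use that in auto)
  have S_diff: "S (\<lambda>b. f b - f' b) = S f - S f'" "coeffs B (\<lambda>b. f b - f' b)" if "coeffs B f" "coeffs B f'" for f f'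
  proof -
    let ?T = "{b. f b \<noteq> 0} \<union> {b. f' b \<noteq> 0}"
    have T: "finite ?T" "{b. f b - f' b \<noteq> 0} \<subseteq> ?T" using that by (auto simp: coeffs_def)
    show "S (\<lambda>b. f b - f' b) = S f - S f'"
      unfolding S_eq[OF T] using S_eq[of ?T f] S_eq[of ?T f'] T(1)
      by (simp add: sum_subtractf vector_sub_rdistrib)
    show "coeffs B (\<lambda>b. f b - f' b)" using that T finite_subset[OF T(2,1)] by (auto simp: coeffs_def)
  qed
  have fs: "(\<Oplus>\<^bsub>D\<^esub>b\<in>{b. f b \<noteq> \<zero>\<^bsub>poly_ring\<^esub>}. f b \<odot>\<^bsub>D\<^esub> b) = cl (S f)" if f: "coeffs B f" for f
    unfolding S_def using cl_finsum[of "{b. f b \<noteq> 0}" g f] f sub[OF f] g by (simp add: poly_ring_def coeffs_def)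
  have rep: "(\<exists>!f. f ` B \<subseteq> carrier poly_ring \<and> (\<forall>b. b \<notin> B \<longrightarrow> f b = \<zero>\<^bsub>poly_ring\<^esub>) \<and>
      finite {b. f b \<noteq> \<zero>\<^bsub>poly_ring\<^esub>} \<and> X = (\<Oplus>\<^bsub>D\<^esub>b\<in>{b. f b \<noteq> \<zero>\<^bsub>poly_ring\<^esub>}. f b \<odot>\<^bsub>D\<^esub> b))
      \<longleftrightarrow> (\<exists>!f. coeffs B f \<and> X = cl (S f))" for X
  proof -
    have "f ` B \<subseteq> carrier poly_ring \<and> (\<forall>b. b \<notin> B \<longrightarrow> f b = \<zero>\<^bsub>poly_ring\<^esub>) \<and>
      finite {b. f b \<noteq> \<zero>\<^bsub>poly_ring\<^esub>} \<and> X = (\<Oplus>\<^bsub>D\<^esub>b\<in>{b. f b \<noteq> \<zero>\<^bsub>poly_ring\<^esub>}. f b \<odot>\<^bsub>D\<^esub> b) \<longleftrightarrow>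
      coeffs B f \<and> X = cl (S f)" for f
      using fs[of f] by (auto simp: coeffs_def poly_ring_def)
    then show ?thesis by simp
  qed
  have "B \<subseteq> carrier D" using g unfolding cl_carrier by force
  then have mb: "module_basis poly_ring D B \<longleftrightarrow> (\<forall>x\<in>log_vectors C. \<exists>!f. coeffs B f \<and> cl x = cl (S f))"
    unfolding module_basis_def rep cl_carrier by simp
  have 0: "coeffs B (\<lambda>b. 0)" "S (\<lambda>b. 0) = 0" by (simp_all add: coeffs_def S_def)
  have "(\<forall>x\<in>log_vectors C. \<exists>!f. coeffs B f \<and> cl x = cl (S f)) \<longleftrightarrow>
    (\<forall>x\<in>log_vectors C. \<exists>f h. coeffs B f \<and> x = h *s euler_vec + S f) \<and> (\<forall>f h. coeffs B f \<and> h *s euler_vec + S f = 0 \<longrightarrow> f = (\<lambda>b. 0))"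
    (is "?L \<longleftrightarrow> ?R1 \<and> ?R2")
  proof
    assume L: ?L
    have ?R1
    proof
      fix x assume x: "x \<in> log_vectors C"
      then obtain f where "coeffs B f" "cl x = cl (S f)" using L by blast
      then show "\<exists>f h. coeffs B f \<and> x = h *s euler_vec + S f" using cl_eq_iff[OF x S_LD] by blast
    qed
    moreover have ?R2
    proof (intro allI impI)
      fix f h assume f: "coeffs B f \<and> h *s euler_vec + S f = 0"
      then have "cl 0 = cl (S f)" using cl_eq_iff[OF log_vectors_0 S_LD] by metis
      moreover have "\<exists>!f. coeffs B f \<and> cl 0 = cl (S f)" using L log_vectors_0 by blast
      ultimately show "f = (\<lambda>b. 0)" using f 0 by metis
    qed
    ultimately show "?R1 \<and> ?R2" ..
  next
    assume R: "?R1 \<and> ?R2"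
    show ?L
    proof
      fix x assume x: "x \<in> log_vectors C"
      then obtain f h where f: "coeffs B f" "x = h *s euler_vec + S f" using R by blast
      show "\<exists>!f. coeffs B f \<and> cl x = cl (S f)"
      proof (rule ex1I[of _ f])
        show "coeffs B f \<and> cl x = cl (S f)" using f cl_eq_iff[OF x S_LD] by blast
        fix f' assume f': "coeffs B f' \<and> cl x = cl (S f')"
        then obtain h' where h': "x = h' *s euler_vec + S f'" using cl_eq_iff[OF x S_LD] by blast
        have "(h' - h) *s euler_vec + S (\<lambda>b. f' b - f b) = (h' *s euler_vec + S f') - (h *s euler_vec + S f)"
          using S_diff(1)[of f' f] f f' by (simp add: vector_sub_rdistrib)
        also have "\<dots> = 0" using f(2) h' by simp
        finally have "(\<lambda>b. f' b - f b) = (\<lambda>b. 0)" using R S_diff(2)[of f' f] f f' by blast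
        then show "f' = f" by (simp add: fun_eq_iff)
      qed
    qed
  qed
  then show ?thesis unfolding mb S_def .
qed

lemma free_if_saito:
  assumes "saito C x y"
  shows "free_module poly_ring D"
proof -
  have LD: "x \<in> log_vectors C" "y \<in> log_vectors C" using assms by (auto simp: saito_def)
  \<comment> \<open>A basis is a set of classes, so the classes have to be distinct before each can
    receive its own coefficient.\<close>
  have ne: "cl x \<noteq> cl y"
  proof
    assume "cl x = cl y"
    then obtain h where "x = h *s euler_vec + y" using cl_eq_iff LD by blast
    then have "h *s euler_vec + (- 1) *s x + 1 *s y = 0" by (simp add: vec_eq_iff)
    then show False using saito_indep(3)[OF reduced assms] by fastforce
  qed
  define B where "B = {cl x, cl y}"
  define g where "g b = (if b = cl x then x else y)" for b
  have g: "g b \<in> log_vectors C" "cl (g b) = b" if "b \<in> B" for b using that LD by (auto simp: B_def g_def)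
  have sum: "(\<Sum>b\<in>{b. f b \<noteq> 0}. f b *s g b) = f (cl x) *s x + f (cl y) *s y" if "coeffs B f" for f
  proof -
    have "(\<Sum>b\<in>{b. f b \<noteq> 0}. f b *s g b) = (\<Sum>b\<in>B. f b *s g b)"
      by (rule sum.mono_neutral_left) (use that in \<open>auto simp: coeffs_def B_def\<close>)
    then show ?thesis using ne by (simp add: B_def g_def)
  qed
  have "module_basis poly_ring D B"
  proof (rule iffD2[OF module_basis_iff[of B g, OF g]], assumption, assumption, intro conjI ballI allI impI)
    fix z assume "z \<in> log_vectors C"
    then obtain h p q where z: "z = h *s euler_vec + p *s x + q *s y" using saito_span[OF reduced assms] by blast
    define f where "f b = (if b = cl x then p else if b = cl y then q else 0)" for b
    have "finite {b. f b \<noteq> 0}" by (rule finite_subset[of _ B]) (auto simp: f_def B_def)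
    then have f: "coeffs B f" by (auto simp: coeffs_def B_def f_def)
    have "z = h *s euler_vec + (\<Sum>b\<in>{b. f b \<noteq> 0}. f b *s g b)"
      unfolding sum[OF f] z using ne by (simp add: f_def add.assoc)
    then show "\<exists>f h. coeffs B f \<and> z = h *s euler_vec + (\<Sum>b\<in>{b. f b \<noteq> 0}. f b *s g b)" using f by blast
  next
    fix f h assume f: "coeffs B f \<and> h *s euler_vec + (\<Sum>b\<in>{b. f b \<noteq> 0}. f b *s g b) = 0"
    then have "h *s euler_vec + f (cl x) *s x + f (cl y) *s y = 0" using sum[of f] by (simp add: add.assoc)
    then have z0: "f (cl x) = 0" "f (cl y) = 0" using saito_indep(2,3)[OF reduced assms] by blast+
    have zb: "f b = 0" if "b \<noteq> cl x" "b \<noteq> cl y" for b using f that by (simp add: coeffs_def B_def)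
    show "f = (\<lambda>b. 0)"
    proof
      fix b
      show "f b = 0" using z0 zb[of b] by metis
    qed
  qed
  then show ?thesis unfolding free_module_def by blast
qed

lemma det3_weighted_sum:
  "det3 u (\<Sum>b\<in>S. f b *s g b) z = (\<Sum>b\<in>S. f b * det3 u (g b) z)"
  "det3 u z (\<Sum>b\<in>S. f b *s g b) = (\<Sum>b\<in>S. f b * det3 u z (g b))"
  by (simp_all add: det3_sum det3_simps)

text \<open>The four vector identity turns three basis elements into a relation modulo the Euler
  derivation, so a basis has exactly two elements.\<close>

lemma saito_if_free:
  assumes "free_module poly_ring D" "C \<noteq> {}"
  shows "\<exists>x y. saito C x y"
proof -
  obtain B where B: "module_basis poly_ring D B" using assms(1) by (auto simp: free_module_def)
  then have "\<forall>b\<in>B. \<exists>x. x \<in> log_vectors C \<and> cl x = b" unfolding module_basis_def cl_carrier by blast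
  then obtain g where g: "\<And>b. b \<in> B \<Longrightarrow> g b \<in> log_vectors C" "\<And>b. b \<in> B \<Longrightarrow> cl (g b) = b" by metis
  note mb = iffD1[OF module_basis_iff[of B g, OF g] B, simplified]
  \<comment> \<open>If all these determinants vanished, so would those of arbitrary logarithmic
    vectors with the Euler vector. Coordinate vectors multiplied by the defining polynomial refute
    this.\<close>
  have "\<exists>b1\<in>B. \<exists>b2\<in>B. det3 euler_vec (g b1) (g b2) \<noteq> 0"
  proof (rule ccontr)
    assume "\<not> (\<exists>b1\<in>B. \<exists>b2\<in>B. det3 euler_vec (g b1) (g b2) \<noteq> 0)"
    then have z: "det3 euler_vec (g b1) (g b2) = 0" if "b1 \<in> B" "b2 \<in> B" for b1 b2 using that by blast
    have "det3 euler_vec x y = 0" if xy: "x \<in> log_vectors C" "y \<in> log_vectors C" for x y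
    proof -
      obtain f h where f: "coeffs B f" "x = h *s euler_vec + (\<Sum>b\<in>{b. f b \<noteq> 0}. f b *s g b)" using mb xy(1) by blast
      obtain f' h' where f': "coeffs B f'" "y = h' *s euler_vec + (\<Sum>b\<in>{b. f' b \<noteq> 0}. f' b *s g b)" using mb xy(2) by blast
      have "(\<Sum>b'\<in>{b. f' b \<noteq> 0}. f' b' * (\<Sum>b\<in>{b. f b \<noteq> 0}. f b * det3 euler_vec (g b) (g b'))) = 0"
      proof (intro sum.neutral ballI)
        fix b' assume "b' \<in> {b. f' b \<noteq> 0}"
        then have b': "b' \<in> B" using f'(1) unfolding coeffs_def by blast
        have "f b * det3 euler_vec (g b) (g b') = 0" for b
          using z[OF _ b', of b] f(1) unfolding coeffs_def by (cases "b \<in> B") auto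
        then have "(\<Sum>b\<in>{b. f b \<noteq> 0}. f b * det3 euler_vec (g b) (g b')) = 0" by (intro sum.neutral ballI)
        then show "f' b' * (\<Sum>b\<in>{b. f b \<noteq> 0}. f b * det3 euler_vec (g b) (g b')) = 0" by (simp only: mult_zero_right)
      qed
      then show ?thesis unfolding f(2) f'(2) by (simp add: det3_simps det3_weighted_sum)
    qed
    moreover have "defining_poly C *s cvec a \<in> log_vectors C" for a
      using linear_form_dvd_defining_poly[OF reduced] by (auto simp: log_vectors_def vdot_simps)
    ultimately have "det3 euler_vec (defining_poly C *s cvec (axis 1 1)) (defining_poly C *s cvec (axis 2 1)) = 0" by blast
    then have "defining_poly C * (defining_poly C * det3 euler_vec (cvec (axis 1 1)) (cvec (axis 2 1))) = 0"
      by (simp add: det3_simps)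
    then have "det3 euler_vec (cvec (axis 1 1)) (cvec (axis 2 1)) = 0" using defining_poly_nonzero[OF reduced] by simp
    moreover have "det3 euler_vec (cvec (axis 1 1)) (cvec (axis 2 1)) = var 3"
      by (simp add: det3_def vdot_3 axis_def)
    ultimately have "poly_eval (var 3) 1 = 0" by simp
    then show False by simp
  qed
  then obtain b1 b2 where b: "b1 \<in> B" "b2 \<in> B" and nz: "det3 euler_vec (g b1) (g b2) \<noteq> 0" by blast
  have ne: "b1 \<noteq> b2" using nz by (auto simp: det3_simps)
  have B2: "B = {b1, b2}"
  proof (rule ccontr)
    assume "B \<noteq> {b1, b2}"
    then obtain b3 where b3: "b3 \<in> B" "b3 \<noteq> b1" "b3 \<noteq> b2" using b by blast
    define f where "f b = (if b = b1 then det3 euler_vec (g b2) (g b3) else if b = b2 then - det3 euler_vec (g b1) (g b3)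
      else if b = b3 then det3 euler_vec (g b1) (g b2) else 0)" for b
    have sub: "{b. f b \<noteq> 0} \<subseteq> {b1, b2, b3}" by (auto simp: f_def)
    have f: "coeffs B f" unfolding coeffs_def using finite_subset[OF sub] b b3 by (auto simp: f_def)
    have "(\<Sum>b\<in>{b. f b \<noteq> 0}. f b *s g b) = (\<Sum>b\<in>{b1, b2, b3}. f b *s g b)"
      by (rule sum.mono_neutral_left) (use sub in auto)
    also have "\<dots> = det3 euler_vec (g b2) (g b3) *s g b1 - det3 euler_vec (g b1) (g b3) *s g b2 + det3 euler_vec (g b1) (g b2) *s g b3"
      using ne b3 by (simp add: f_def vec_eq_iff)
    also have "\<dots> = det3 (g b1) (g b2) (g b3) *s euler_vec"
      using det3_four_vectors[of "g b1" "g b2" "g b3" euler_vec] by (simp add: vec_eq_iff algebra_simps)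
    finally have "(- det3 (g b1) (g b2) (g b3)) *s euler_vec + (\<Sum>b\<in>{b. f b \<noteq> 0}. f b *s g b) = 0"
      by (simp add: vec_eq_iff)
    then have "f = (\<lambda>b. 0)" using mb f by blast
    then have "f b3 = 0" by simp
    then show False using b3 nz by (simp add: f_def)
  qed
  have "saito C (g b1) (g b2)"
  proof (rule saitoI[OF reduced assms(2)])
    show "g b1 \<in> log_vectors C" "g b2 \<in> log_vectors C" using g b by auto
    fix z assume "z \<in> log_vectors C"
    then obtain f h where f: "coeffs B f" "z = h *s euler_vec + (\<Sum>b\<in>{b. f b \<noteq> 0}. f b *s g b)" using mb by blast
    have "(\<Sum>b\<in>{b. f b \<noteq> 0}. f b *s g b) = (\<Sum>b\<in>B. f b *s g b)"
      by (rule sum.mono_neutral_left) (use f(1) B2 in \<open>auto simp: coeffs_def\<close>)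
    then have "z = h *s euler_vec + f b1 *s g b1 + f b2 *s g b2" using ne f(2) by (simp add: B2 add.assoc)
    then show "\<exists>h p q. z = h *s euler_vec + p *s g b1 + q *s g b2" by blast
  qed
  then show ?thesis by blast
qed

lemma free_iff_saito: "C \<noteq> {} \<Longrightarrow> free_module poly_ring D \<longleftrightarrow> (\<exists>x y. saito C x y)"
  using free_if_saito saito_if_free by blast

end

section \<open>Sheaves on a line and the splitting type\<close>

section \<open>Split sheaves on a line\<close>

text \<open>\<open>G\<close> presents the graded module \<open>M\<close> as \<open>T(-a) \<oplus> T(-b)\<close> over the coordinate ring \<open>T = S / (c)\<close>
  of a line; congruences modulo \<open>c\<close> become equations after applying \<open>along c w\<close>.\<close>

locale split_module =
  fixes M :: "(spoly, 'b) graded_module" and c w :: "complex^3" and a b :: nat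
    and G :: "spoly \<Rightarrow> spoly \<Rightarrow> 'b"
  assumes c_w: "vdot c w = 1"
    and smult: "f \<odot>\<^bsub>M\<^esub> G p q = G (f * p) (f * q)"
    and eq_iff: "G p q = G p' q' \<longleftrightarrow> along c w p = along c w p' \<and> along c w q = along c w q'"
    and component: "component M d = {G p q | p q. shifted_homogeneous a d p \<and> shifted_homogeneous b d q}"
begin

abbreviation \<sigma> where "\<sigma> \<equiv> along c w"

lemma \<sigma>_power: "\<sigma> (f ^ n) = \<sigma> f ^ n"
  by (simp add: along_def)

lemma in_fractions: "(m, k) \<in> fractions M e \<longleftrightarrow>
    (\<exists>p q. m = G p q \<and> shifted_homogeneous a (k * e) p \<and> shifted_homogeneous b (k * e) q)"
  by (auto simp: fractions_def component)

lemma fractions_smult: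
  assumes "(G p q, k) \<in> fractions M e" "homogeneous (j * e) g"
  shows "(G (g * p) (g * q), j + k) \<in> fractions M e"
proof -
  obtain p' q' where pq: "G p q = G p' q'" "shifted_homogeneous a (k * e) p'" "shifted_homogeneous b (k * e) q'"
    using assms(1) in_fractions by blast
  have *: "shifted_homogeneous d ((j + k) * e) (g * r)" if "shifted_homogeneous d (k * e) r" for d r
  proof (cases "d \<le> k * e")
    case True
    then have "homogeneous (j * e + (k * e - d)) (g * r)"
      using that assms(2) by (intro homogeneous_mult) (auto simp: shifted_homogeneous_def)
    moreover have "j * e + (k * e - d) = (j + k) * e - d" "d \<le> (j + k) * e"
      using True by (auto simp: distrib_right)
    ultimately show ?thesis by (simp add: shifted_homogeneous_def)
  qed (use that in \<open>auto simp: shifted_homogeneous_def\<close>)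
  have "G (g * p) (g * q) = G (g * p') (g * q')" using pq(1) by (simp add: eq_iff)
  then show ?thesis unfolding in_fractions using *[OF pq(2)] *[OF pq(3)] by blast
qed

lemma fractions_restrict:
  assumes "(G p q, k) \<in> fractions M e" "homogeneous e' g"
  shows "(G (g ^ k * p) (g ^ k * q), k) \<in> fractions M (e + e')"
proof -
  obtain p' q' where pq: "G p q = G p' q'" "shifted_homogeneous a (k * e) p'" "shifted_homogeneous b (k * e) q'"
    using assms(1) in_fractions by blast
  have *: "shifted_homogeneous d (k * (e + e')) (g ^ k * r)" if "shifted_homogeneous d (k * e) r" for d r
  proof (cases "d \<le> k * e")
    case True
    then have "homogeneous (k * e' + (k * e - d)) (g ^ k * r)"
      using that assms(2) by (intro homogeneous_mult homogeneous_power) (auto simp: shifted_homogeneous_def)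
    moreover have "k * e' + (k * e - d) = k * (e + e') - d" "d \<le> k * (e + e')"
      using True by (auto simp: distrib_left)
    ultimately show ?thesis by (simp add: shifted_homogeneous_def)
  qed (use that in \<open>auto simp: shifted_homogeneous_def\<close>)
  have "G (g ^ k * p) (g ^ k * q) = G (g ^ k * p') (g ^ k * q')" using pq(1) by (simp add: eq_iff)
  then show ?thesis unfolding in_fractions using *[OF pq(2)] *[OF pq(3)] by blast
qed

text \<open>If \<open>f\<close> does not vanish on the line, the auxiliary power of \<open>f\<close>
  in the definition of fractions cancels, the coordinate ring being a domain.\<close>

lemma fraction_rel_iff:
  assumes "\<sigma> f \<noteq> 0"
  shows "((G p q, k), (G p' q', l)) \<in> fraction_rel M e f \<longleftrightarrow>
    (G p q, k) \<in> fractions M e \<and> (G p' q', l) \<in> fractions M e \<and>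
    \<sigma> f ^ l * \<sigma> p = \<sigma> f ^ k * \<sigma> p' \<and> \<sigma> f ^ l * \<sigma> q = \<sigma> f ^ k * \<sigma> q'"
  unfolding fraction_rel_def using assms
  by (auto simp: smult eq_iff \<sigma>_power power_add mult.assoc)

lemma fractions_cases:
  assumes "x \<in> fractions M e"
  obtains p q k where "x = (G p q, k)" "shifted_homogeneous a (k * e) p" "shifted_homogeneous b (k * e) q"
  using assms in_fractions[of "fst x" "snd x" e] by (metis prod.collapse)

lemma equiv_fraction_rel:
  assumes f: "\<sigma> f \<noteq> 0"
  shows "equiv (fractions M e) (fraction_rel M e f)"
proof (rule equivI)
  show "fraction_rel M e f \<subseteq> fractions M e \<times> fractions M e" by (auto simp: fraction_rel_def)
  show "refl_on (fractions M e) (fraction_rel M e f)"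
    by (rule refl_onI) (auto simp: fraction_rel_def)
  show "sym (fraction_rel M e f)"
  proof (rule symI)
    fix x y assume xy: "(x, y) \<in> fraction_rel M e f"
    obtain m k where x: "x = (m, k)" by (cases x)
    obtain n l where y: "y = (n, l)" by (cases y)
    obtain j where "f ^ (j + l) \<odot>\<^bsub>M\<^esub> m = f ^ (j + k) \<odot>\<^bsub>M\<^esub> n" "x \<in> fractions M e" "y \<in> fractions M e"
      using xy unfolding x y fraction_rel_def by blast
    then show "(y, x) \<in> fraction_rel M e f"
      unfolding x y fraction_rel_def mem_Collect_eq case_prod_conv by metis
  qed
  show "trans (fraction_rel M e f)"
  proof (rule transI)
    fix x y z assume xy: "(x, y) \<in> fraction_rel M e f" and yz: "(y, z) \<in> fraction_rel M e f"
    then have fr: "x \<in> fractions M e" "y \<in> fractions M e" "z \<in> fractions M e"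
      by (auto simp: fraction_rel_def)
    obtain p q k where x: "x = (G p q, k)" using fractions_cases[OF fr(1)] by blast
    obtain p' q' k' where y: "y = (G p' q', k')" using fractions_cases[OF fr(2)] by blast
    obtain p'' q'' k'' where z: "z = (G p'' q'', k'')" using fractions_cases[OF fr(3)] by blast
    have *: "F ^ k'' * r = F ^ k * r''" if "F ^ k' * r = F ^ k * r'" "F ^ k'' * r' = F ^ k' * r''" "F \<noteq> 0"
      for F r r' r'' :: spoly
    proof -
      have "F ^ k' * (F ^ k'' * r) = F ^ k'' * (F ^ k' * r)" by (simp only: mult_ac)
      also have "\<dots> = F ^ k * (F ^ k'' * r')" unfolding that(1) by (simp only: mult_ac)
      also have "\<dots> = F ^ k' * (F ^ k * r'')" unfolding that(2) by (simp only: mult_ac)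
      finally show ?thesis using that(3) by simp
    qed
    show "(x, z) \<in> fraction_rel M e f"
      using xy yz fr unfolding x y z fraction_rel_iff[OF f] using *[OF _ _ f] by blast
  qed
qed

lemma fraction_eq_iff:
  assumes "\<sigma> f \<noteq> 0" "(G p q, k) \<in> fractions M e" "(G p' q', l) \<in> fractions M e"
  shows "fraction M e f (G p q) k = fraction M e f (G p' q') l \<longleftrightarrow>
    \<sigma> f ^ l * \<sigma> p = \<sigma> f ^ k * \<sigma> p' \<and> \<sigma> f ^ l * \<sigma> q = \<sigma> f ^ k * \<sigma> q'"
  unfolding fraction_def
  using eq_equiv_class_iff[OF equiv_fraction_rel[OF assms(1)] assms(2,3)]
    fraction_rel_iff[OF assms(1)] assms(2,3) by simp

lemma fraction_in_sections: "(m, k) \<in> fractions M e \<Longrightarrow> fraction M e f m k \<in> sections M e f"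
  by (auto simp: sections_def fraction_def intro: quotientI)

lemma sections_cases:
  assumes "s \<in> sections M e f"
  obtains p q k where "s = fraction M e f (G p q) k" "(G p q, k) \<in> fractions M e"
    "shifted_homogeneous a (k * e) p" "shifted_homogeneous b (k * e) q"
proof -
  obtain x where x: "x \<in> fractions M e" "s = fraction_rel M e f `` {x}"
    using assms by (auto simp: sections_def elim: quotientE)
  then show thesis using fractions_cases[OF x(1)] that unfolding fraction_def by metis
qed

text \<open>Operations on sections are unions over all representatives; if each of these gives the
  same class, the union is that class.\<close>

lemma UN_fraction_const:
  assumes f: "\<sigma> f \<noteq> 0" and m: "(G p q, k) \<in> fractions M e"
    and h: "\<And>p' q' l. (G p' q', l) \<in> fractions M e \<Longrightarrow>
      \<sigma> f ^ l * \<sigma> p = \<sigma> f ^ k * \<sigma> p' \<Longrightarrow> \<sigma> f ^ l * \<sigma> q = \<sigma> f ^ k * \<sigma> q' \<Longrightarrow> h (G p' q', l) = X"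
  shows "(\<Union>x\<in>fraction M e f (G p q) k. h x) = X"
proof -
  have "h x = X" if x: "x \<in> fraction M e f (G p q) k" for x
  proof -
    have r: "((G p q, k), x) \<in> fraction_rel M e f" using x by (simp add: fraction_def)
    then have "x \<in> fractions M e" by (auto simp: fraction_rel_def)
    then obtain p' q' l where e: "x = (G p' q', l)" using fractions_cases by blast
    show ?thesis using r unfolding e fraction_rel_iff[OF f] by (intro h) blast+
  qed
  moreover have "(G p q, k) \<in> fraction M e f (G p q) k"
    using equiv_class_self[OF equiv_fraction_rel[OF f] m] by (simp add: fraction_def)
  ultimately show ?thesis by blast
qed

lemma section_smult_fraction:
  assumes f: "\<sigma> f \<noteq> 0" and m: "(G p q, k) \<in> fractions M e" and g: "homogeneous (j * e) g"
  shows "section_smult M e f g j (fraction M e f (G p q) k) = fraction M e f (G (g * p) (g * q)) (j + k)"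
proof -
  have "(\<Union>x\<in>fraction M e f (G p q) k. case x of (m, k) \<Rightarrow> fraction M e f (g \<odot>\<^bsub>M\<^esub> m) (j + k)) =
      fraction M e f (G (g * p) (g * q)) (j + k)"
  proof (rule UN_fraction_const[OF f m])
    fix p' q' l
    assume n: "(G p' q', l) \<in> fractions M e" and 1: "\<sigma> f ^ l * \<sigma> p = \<sigma> f ^ k * \<sigma> p'" and 2: "\<sigma> f ^ l * \<sigma> q = \<sigma> f ^ k * \<sigma> q'"
    have *: "\<sigma> f ^ (j + k) * \<sigma> (g * r') = \<sigma> f ^ (j + l) * \<sigma> (g * r)" if "\<sigma> f ^ l * \<sigma> r = \<sigma> f ^ k * \<sigma> r'" for r r'
    proof -
      have "\<sigma> f ^ (j + k) * \<sigma> (g * r') = \<sigma> f ^ j * \<sigma> g * (\<sigma> f ^ k * \<sigma> r')" by (simp add: power_add mult_ac)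
      also have "\<dots> = \<sigma> f ^ (j + l) * \<sigma> (g * r)" unfolding that[symmetric] by (simp add: power_add mult_ac)
      finally show ?thesis .
    qed
    show "(case (G p' q', l) of (m, k) \<Rightarrow> fraction M e f (g \<odot>\<^bsub>M\<^esub> m) (j + k)) = fraction M e f (G (g * p) (g * q)) (j + k)"
      unfolding prod.case smult
      using fraction_eq_iff[OF f fractions_smult[OF n g] fractions_smult[OF m g]] *[OF 1] *[OF 2] by blast
  qed
  then show ?thesis unfolding section_smult_def .
qed

lemma section_restrict_fraction:
  assumes fg: "\<sigma> (f * g) \<noteq> 0" and m: "(G p q, k) \<in> fractions M e" and g: "homogeneous e' g"
  shows "section_restrict M e f e' g (fraction M e f (G p q) k) =
    fraction M (e + e') (f * g) (G (g ^ k * p) (g ^ k * q)) k"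
proof -
  have f: "\<sigma> f \<noteq> 0" using fg by simp
  have "(\<Union>x\<in>fraction M e f (G p q) k. case x of (m, k) \<Rightarrow> fraction M (e + e') (f * g) ((g ^ k) \<odot>\<^bsub>M\<^esub> m) k) =
      fraction M (e + e') (f * g) (G (g ^ k * p) (g ^ k * q)) k"
  proof (rule UN_fraction_const[OF f m])
    fix p' q' l
    assume n: "(G p' q', l) \<in> fractions M e" and 1: "\<sigma> f ^ l * \<sigma> p = \<sigma> f ^ k * \<sigma> p'" and 2: "\<sigma> f ^ l * \<sigma> q = \<sigma> f ^ k * \<sigma> q'"
    have *: "\<sigma> (f * g) ^ k * \<sigma> (g ^ l * r') = \<sigma> (f * g) ^ l * \<sigma> (g ^ k * r)" if "\<sigma> f ^ l * \<sigma> r = \<sigma> f ^ k * \<sigma> r'" for r r'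
    proof -
      have "\<sigma> (f * g) ^ k * \<sigma> (g ^ l * r') = \<sigma> g ^ k * \<sigma> g ^ l * (\<sigma> f ^ k * \<sigma> r')"
        by (simp add: \<sigma>_power power_mult_distrib mult_ac)
      also have "\<dots> = \<sigma> (f * g) ^ l * \<sigma> (g ^ k * r)" unfolding that[symmetric]
        by (simp add: \<sigma>_power power_mult_distrib mult_ac)
      finally show ?thesis .
    qed
    show "(case (G p' q', l) of (m, k) \<Rightarrow> fraction M (e + e') (f * g) ((g ^ k) \<odot>\<^bsub>M\<^esub> m) k) =
        fraction M (e + e') (f * g) (G (g ^ k * p) (g ^ k * q)) k"
      unfolding prod.case smult
      using fraction_eq_iff[OF fg fractions_restrict[OF n g] fractions_restrict[OF m g]] *[OF 1] *[OF 2] by blast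
  qed
  then show ?thesis unfolding section_restrict_def .
qed

end

text \<open>A one-sided consequence of isomorphism that can be obtained in both directions. It is
  restricted to functions \<open>f\<close> that do not vanish on the line, where equality of
  fractions is governed by cross multiplication.\<close>

definition injective_sheaf_map ::
  "complex^3 \<Rightarrow> complex^3 \<Rightarrow> (spoly, 'b) graded_module \<Rightarrow> (spoly, 'c) graded_module \<Rightarrow>
    (nat \<Rightarrow> spoly \<Rightarrow> ('b \<times> nat) set \<Rightarrow> ('c \<times> nat) set) \<Rightarrow> bool" where
  "injective_sheaf_map c w M N \<phi> \<longleftrightarrow>
    (\<forall>e f. e \<ge> 1 \<and> homogeneous e f \<and> along c w f \<noteq> 0 \<longrightarrow>
      inj_on (\<phi> e f) (sections M e f) \<and> \<phi> e f ` sections M e f \<subseteq> sections N e f \<and>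
      (\<forall>j g. \<forall>s\<in>sections M e f. homogeneous (j * e) g \<longrightarrow>
         \<phi> e f (section_smult M e f g j s) = section_smult N e f g j (\<phi> e f s)) \<and>
      (\<forall>e' g. \<forall>s\<in>sections M e f. homogeneous e' g \<and> along c w g \<noteq> 0 \<longrightarrow>
         \<phi> (e + e') (f * g) (section_restrict M e f e' g s) =
           section_restrict N e f e' g (\<phi> e f s)))"

lemma injective_sheaf_mapD:
  assumes "injective_sheaf_map c w M N \<phi>" "1 \<le> e" "homogeneous e f" "along c w f \<noteq> 0"
  shows "inj_on (\<phi> e f) (sections M e f)" "s \<in> sections M e f \<Longrightarrow> \<phi> e f s \<in> sections N e f"
    "s \<in> sections M e f \<Longrightarrow> homogeneous (j * e) g \<Longrightarrow>
      \<phi> e f (section_smult M e f g j s) = section_smult N e f g j (\<phi> e f s)"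
    "s \<in> sections M e f \<Longrightarrow> homogeneous e' g \<Longrightarrow> along c w g \<noteq> 0 \<Longrightarrow>
      \<phi> (e + e') (f * g) (section_restrict M e f e' g s) = section_restrict N e f e' g (\<phi> e f s)"
  using assms unfolding injective_sheaf_map_def by blast+

text \<open>The inverse bijections inherit the compatibilities. The presentation of \<open>M\<close>
  ensures that multiples and restrictions of its sections are again sections, so that the inverse
  can be cancelled on them.\<close>

lemma sheaf_isomorphic_injective_maps:
  fixes M :: "(spoly, 'b) graded_module" and N :: "(spoly, 'c) graded_module"
  assumes iso: "sheaf_isomorphic M N" and M: "split_module M c w a b G"
  shows "\<exists>\<phi>. injective_sheaf_map c w M N \<phi>" "\<exists>\<psi>. injective_sheaf_map c w N M \<psi>"
proof -
  interpret M: split_module M c w a b G by (rule M)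
  obtain \<phi> :: "nat \<Rightarrow> spoly \<Rightarrow> ('b \<times> nat) set \<Rightarrow> ('c \<times> nat) set" where all:
    "\<forall>e f. e \<ge> 1 \<and> homogeneous e f \<longrightarrow>
      bij_betw (\<phi> e f) (sections M e f) (sections N e f) \<and>
      (\<forall>s\<in>sections M e f. \<forall>t\<in>sections M e f.
         \<phi> e f (section_add M e f s t) = section_add N e f (\<phi> e f s) (\<phi> e f t)) \<and>
      (\<forall>j g. \<forall>s\<in>sections M e f. homogeneous (j * e) g \<longrightarrow>
         \<phi> e f (section_smult M e f g j s) = section_smult N e f g j (\<phi> e f s)) \<and>
      (\<forall>e' g. \<forall>s\<in>sections M e f. homogeneous e' g \<longrightarrow>
         \<phi> (e + e') (f * g) (section_restrict M e f e' g s) =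
           section_restrict N e f e' g (\<phi> e f s))"
    using iso[unfolded sheaf_isomorphic_def] by (rule exE)
  have \<phi>:
    "\<And>e f. e \<ge> 1 \<Longrightarrow> homogeneous e f \<Longrightarrow> bij_betw (\<phi> e f) (sections M e f) (sections N e f)"
    "\<And>e f j g s. e \<ge> 1 \<Longrightarrow> homogeneous e f \<Longrightarrow> s \<in> sections M e f \<Longrightarrow> homogeneous (j * e) g \<Longrightarrow>
       \<phi> e f (section_smult M e f g j s) = section_smult N e f g j (\<phi> e f s)"
    "\<And>e f e' g s. e \<ge> 1 \<Longrightarrow> homogeneous e f \<Longrightarrow> s \<in> sections M e f \<Longrightarrow> homogeneous e' g \<Longrightarrow>
       \<phi> (e + e') (f * g) (section_restrict M e f e' g s) = section_restrict N e f e' g (\<phi> e f s)"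
    using all by blast+
  show "\<exists>\<phi>. injective_sheaf_map c w M N \<phi>"
    unfolding injective_sheaf_map_def using \<phi> by (intro exI[of _ \<phi>]) (auto simp: bij_betw_def)
  define \<psi> where "\<psi> e f = inv_into (sections M e f) (\<phi> e f)" for e f
  have \<psi>: "\<psi> e f (\<phi> e f s) = s" if "e \<ge> 1" "homogeneous e f" "s \<in> sections M e f" for e f s
    unfolding \<psi>_def using \<phi>(1)[OF that(1,2)] that(3) by (simp add: bij_betw_def inv_into_f_f)
  have cover: "\<exists>s\<in>sections M e f. t = \<phi> e f s" if "e \<ge> 1" "homogeneous e f" "t \<in> sections N e f" for e f t
    using \<phi>(1)[OF that(1,2)] that(3) by (auto simp: bij_betw_def)
  have "injective_sheaf_map c w N M \<psi>"
    unfolding injective_sheaf_map_def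
  proof (intro allI impI conjI ballI)
    fix e f assume ef: "1 \<le> e \<and> homogeneous e f \<and> along c w f \<noteq> 0"
    then have bij: "bij_betw (\<psi> e f) (sections N e f) (sections M e f)"
      unfolding \<psi>_def by (intro bij_betw_inv_into \<phi>(1)) auto
    show "inj_on (\<psi> e f) (sections N e f)" using bij by (simp add: bij_betw_def)
    show "\<psi> e f ` sections N e f \<subseteq> sections M e f" using bij by (simp add: bij_betw_def)
    fix t assume t: "t \<in> sections N e f"
    then obtain s where s: "s \<in> sections M e f" "t = \<phi> e f s" using cover ef by blast
    obtain p q k where pq: "s = fraction M e f (G p q) k" "(G p q, k) \<in> fractions M e"
      using M.sections_cases[OF s(1)] by blast
    show "\<psi> e f (section_smult N e f g j t) = section_smult M e f g j (\<psi> e f t)"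
      if g: "homogeneous (j * e) g" for j g
    proof -
      have "section_smult M e f g j s \<in> sections M e f"
        unfolding pq(1) using M.section_smult_fraction[OF _ pq(2) g, of f] ef
        by (simp add: M.fraction_in_sections[OF M.fractions_smult[OF pq(2) g]])
      moreover have "section_smult N e f g j t = \<phi> e f (section_smult M e f g j s)"
        using \<phi>(2)[OF _ _ s(1) g] ef s(2) by simp
      ultimately show ?thesis using \<psi> ef s by simp
    qed
    show "\<psi> (e + e') (f * g) (section_restrict N e f e' g t) = section_restrict M e f e' g (\<psi> e f t)"
      if g: "homogeneous e' g \<and> along c w g \<noteq> 0" for e' g
    proof -
      have g': "homogeneous e' g" and fg: "along c w (f * g) \<noteq> 0" using g ef by auto
      have "section_restrict M e f e' g s \<in> sections M (e + e') (f * g)"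
        unfolding pq(1) M.section_restrict_fraction[OF fg pq(2) g']
        by (rule M.fraction_in_sections[OF M.fractions_restrict[OF pq(2) g']])
      moreover have "section_restrict N e f e' g t = \<phi> (e + e') (f * g) (section_restrict M e f e' g s)"
        using \<phi>(3)[OF _ _ s(1) g'] ef s(2) by simp
      moreover have "homogeneous (e + e') (f * g)" using ef g' by (intro homogeneous_mult) auto
      ultimately show ?thesis using \<psi>[of "e + e'" "f * g"] \<psi>[of e f s] ef s by simp
    qed
  qed
  then show "\<exists>\<psi>. injective_sheaf_map c w N M \<psi>" by blast
qed

text \<open>There is no nonzero map from \<open>O(-a)\<close> to \<open>O(-a')\<close> on a projective line if \<open>a < a'\<close>. On two standard
  open sets, the image of the generator is given by \<open>P / F^k\<close> and \<open>P' / H^l\<close>, and compatibility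
  forces a power of \<open>F\<close> exceeding its degree to divide \<open>P\<close>.\<close>

lemma no_section:
  assumes eq: "(F * H) ^ l * (F ^ (2 * a) * (H ^ k * P)) = (F * H) ^ (a + k) * (F ^ l * P')"
    and F: "F = linear_form u" "u \<noteq> 0" and H: "H \<noteq> 0" "\<not> F dvd H"
    and P: "shifted_homogeneous a' k P" "a < a'"
  shows "P = 0"
proof (rule ccontr)
  assume nz: "P \<noteq> 0"
  have F0: "F \<noteq> 0" using F by simp
  have k: "a' \<le> k" and hP: "homogeneous (k - a') P" using P(1) nz by (auto simp: shifted_homogeneous_def split: if_splits)
  have two: "F ^ (2 * a) = F ^ a * F ^ a" by (simp add: mult_2 power_add)
  have "F ^ (l + a) * H ^ k * (F ^ a * (H ^ l * P)) = (F * H) ^ l * (F ^ (2 * a) * (H ^ k * P))"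
    unfolding two by (simp add: power_mult_distrib power_add mult_ac)
  also have "\<dots> = F ^ (l + a) * H ^ k * (F ^ k * (H ^ a * P'))"
    unfolding eq by (simp add: power_mult_distrib power_add mult_ac)
  finally have "F ^ a * (H ^ l * P) = F ^ k * (H ^ a * P')"
    using F0 H(1) by simp
  moreover have "F ^ k = F ^ a * F ^ (k - a)" using k P(2) by (simp flip: power_add)
  ultimately have "F ^ a * (H ^ l * P) = F ^ a * (F ^ (k - a) * (H ^ a * P'))" by (simp only: mult.assoc)
  then have e: "H ^ l * P = F ^ (k - a) * (H ^ a * P')" using F0 by simp
  have dvd: "F ^ n dvd R" if "F ^ n dvd H ^ l * R" for n R
    using that
  proof (induction n arbitrary: R)
    case (Suc n)
    have "\<not> F dvd H ^ l"
      by (induction l) (use H(2) F linear_form_not_unit linear_form_dvd_mult_iff[OF F(2)] in auto)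
    moreover have "F dvd H ^ l * R" using Suc.prems by (auto elim: dvd_mult_left)
    ultimately have "F dvd R" using linear_form_dvd_mult_iff[OF F(2)] F(1) by blast
    then obtain R' where R': "R = F * R'" by blast
    have "F * F ^ n dvd F * (H ^ l * R')" using Suc.prems by (simp add: R' mult.left_commute)
    then have "F ^ n dvd H ^ l * R'" using F0 by simp
    then have "F ^ n dvd R'" by (rule Suc.IH)
    then show ?case by (simp add: R')
  qed simp
  obtain R where R: "P = F ^ (k - a) * R" using dvd[of "k - a" P] e by auto
  have "homogeneous (k - a) (F ^ (k - a))"
    using homogeneous_power[of "Suc 0" F "k - a"] F by simp
  then have "shifted_homogeneous (k - a) (k - a') R"
    using homogeneous_mult_cancel[of "k - a'" "F ^ (k - a)" R] hP R F0 by simp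
  then have "R = 0" using k P(2) by (simp add: shifted_homogeneous_def)
  then show False using nz R by simp
qed

text \<open>The generator of \<open>O(-a)\<close> gives sections \<open>1 / f^a\<close> and
  \<open>1 / g^a\<close> on two standard open sets, related on the overlap by a transition function.
  If \<open>a\<close> were below both target degrees, \<open>no_section\<close> would annihilate
  both components of the first image, contradicting injectivity.\<close>

lemma split_module_degree_le:
  assumes M: "split_module M c w a b G" and N: "split_module N c w a' b' H"
    and \<phi>: "injective_sheaf_map c w M N \<phi>" and le: "a' \<le> b'"
  shows "a' \<le> a"
proof (rule ccontr)
  assume "\<not> a' \<le> a"
  then have lt: "a < a'" "a < b'" using le by auto
  interpret M: split_module M c w a b G by (rule M)
  interpret N: split_module N c w a' b' H by (rule N)
  have c0: "c \<noteq> 0" using M.c_w by (auto simp: vdot_simps)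
  \<comment> \<open>Two coordinates whose restrictions to the line are independent, so that their
    standard open sets cover it.\<close>
  obtain i j where ij: "det3 c (axis i 1) (axis j 1) \<noteq> 0" using ex_det3_axis[OF c0] by blast
  define f where "f = linear_form (axis i 1)"
  define g where "g = linear_form (axis j 1)"
  define u where "u = axis i 1 - vdot (axis i 1) w *s c"
  define v where "v = axis j 1 - vdot (axis j 1) w *s c"
  have Ff: "M.\<sigma> f = linear_form u" and Fg: "M.\<sigma> g = linear_form v"
    by (simp_all add: f_def g_def u_def v_def along_linear_form)
  have "det3 c u v \<noteq> 0" using ij by (simp add: u_def v_def det3_simps)
  then have uv: "vcross u v \<noteq> 0" "u \<noteq> 0" "v \<noteq> 0" by (auto simp: det3_def vdot_simps vcross_simps)
  have F0: "M.\<sigma> f \<noteq> 0" "M.\<sigma> g \<noteq> 0" "M.\<sigma> (f * g) \<noteq> 0" using uv by (simp_all add: Ff Fg)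
  have hf: "homogeneous (Suc 0) f" "homogeneous (Suc 0) g" by (simp_all add: f_def g_def)
  have hfg: "homogeneous (Suc (Suc 0)) (f * g)" using homogeneous_mult[OF hf] by simp
  have gen: "(G 1 0, a) \<in> fractions M (Suc 0)"
    unfolding M.in_fractions by (intro exI[of _ 1] exI[of _ 0]) (simp add: shifted_homogeneous_def)
  define s where "s = fraction M (Suc 0) f (G 1 0) a"
  define t where "t = fraction M (Suc 0) g (G 1 0) a"
  have s: "s \<in> sections M (Suc 0) f" and t: "t \<in> sections M (Suc 0) g"
    unfolding s_def t_def by (rule M.fraction_in_sections[OF gen])+
  have rs: "section_restrict M (Suc 0) f (Suc 0) g s = fraction M (Suc (Suc 0)) (f * g) (G (g ^ a) 0) a"
    unfolding s_def using M.section_restrict_fraction[OF F0(3) gen hf(2)] by simp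
  have rt: "section_restrict M (Suc 0) g (Suc 0) f t = fraction M (Suc (Suc 0)) (f * g) (G (f ^ a) 0) a"
    unfolding t_def using M.section_restrict_fraction[of g f, OF _ gen hf(1)] F0
    by (simp add: mult.commute[of g f])
  have fr1: "(G (g ^ a) 0, a) \<in> fractions M (Suc (Suc 0))" and fr2: "(G (f ^ a) 0, a) \<in> fractions M (Suc (Suc 0))"
    using M.fractions_restrict[OF gen hf(2)] M.fractions_restrict[OF gen hf(1)] by simp_all
  \<comment> \<open>The regular function \<open>f^(2 * a) / (f * g)^a\<close> is the transition
    function \<open>f^a / g^a\<close>, written with the denominator that
    \<open>section_smult\<close> expects.\<close>
  have hpow: "homogeneous (a * Suc (Suc 0)) (f ^ (2 * a))"
    using homogeneous_power[OF hf(1), of "2 * a"] by (simp add: mult_2)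
  have "section_smult M (Suc (Suc 0)) (f * g) (f ^ (2 * a)) a (fraction M (Suc (Suc 0)) (f * g) (G (g ^ a) 0) a) =
      fraction M (Suc (Suc 0)) (f * g) (G (f ^ (2 * a) * g ^ a) 0) (a + a)"
    using M.section_smult_fraction[OF F0(3) fr1 hpow] by simp
  also have "\<dots> = fraction M (Suc (Suc 0)) (f * g) (G (f ^ a) 0) a"
  proof -
    have "(G (f ^ (2 * a) * g ^ a) 0, a + a) \<in> fractions M (Suc (Suc 0))"
      using M.fractions_smult[OF fr1 hpow] by simp
    moreover have "M.\<sigma> f ^ (2 * a) = M.\<sigma> f ^ a * M.\<sigma> f ^ a" by (simp add: mult_2 power_add)
    then have "M.\<sigma> (f * g) ^ a * M.\<sigma> (f ^ (2 * a) * g ^ a) = M.\<sigma> (f * g) ^ (a + a) * M.\<sigma> (f ^ a)"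
      unfolding along_simps M.\<sigma>_power by (simp only: power_mult_distrib power_add mult_ac)
    ultimately show ?thesis
      using M.fraction_eq_iff[OF F0(3) _ fr2, of "f ^ (2 * a) * g ^ a" 0 "a + a"] by simp
  qed
  finally have key: "section_smult M (Suc (Suc 0)) (f * g) (f ^ (2 * a)) a (section_restrict M (Suc 0) f (Suc 0) g s) = section_restrict M (Suc 0) g (Suc 0) f t"
    by (simp only: rs rt)
  have one_le: "1 \<le> Suc 0" "1 \<le> Suc (Suc 0)" by simp_all
  note D = injective_sheaf_mapD[OF \<phi>]
  have \<phi>s: "\<phi> (Suc 0) f s \<in> sections N (Suc 0) f" by (rule D(2)[OF one_le(1) hf(1) F0(1) s])
  obtain p q k where pq: "\<phi> (Suc 0) f s = fraction N (Suc 0) f (H p q) k" "(H p q, k) \<in> fractions N (Suc 0)"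
    "shifted_homogeneous a' (k * Suc 0) p" "shifted_homogeneous b' (k * Suc 0) q"
    by (rule N.sections_cases[OF \<phi>s])
  have \<phi>t: "\<phi> (Suc 0) g t \<in> sections N (Suc 0) g" by (rule D(2)[OF one_le(1) hf(2) F0(2) t])
  obtain p' q' l where pq': "\<phi> (Suc 0) g t = fraction N (Suc 0) g (H p' q') l" "(H p' q', l) \<in> fractions N (Suc 0)"
    "shifted_homogeneous a' (l * Suc 0) p'" "shifted_homogeneous b' (l * Suc 0) q'"
    by (rule N.sections_cases[OF \<phi>t])
  have rs_in: "section_restrict M (Suc 0) f (Suc 0) g s \<in> sections M (Suc (Suc 0)) (f * g)"
    unfolding rs by (rule M.fraction_in_sections[OF fr1])
  have "\<phi> (Suc (Suc 0)) (f * g) (section_restrict M (Suc 0) g (Suc 0) f t) = section_restrict N (Suc 0) g (Suc 0) f (\<phi> (Suc 0) g t)"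
    using D(4)[OF one_le(1) hf(2) F0(2) t hf(1) F0(1)] by (simp add: mult.commute[of g f])
  also have "\<dots> = fraction N (Suc (Suc 0)) (f * g) (H (f ^ l * p') (f ^ l * q')) l"
    unfolding pq'(1) using N.section_restrict_fraction[of g f, OF _ pq'(2) hf(1)] F0
    by (simp add: mult.commute[of g f])
  finally have e1: "\<phi> (Suc (Suc 0)) (f * g) (section_restrict M (Suc 0) g (Suc 0) f t) = fraction N (Suc (Suc 0)) (f * g) (H (f ^ l * p') (f ^ l * q')) l" .
  have fN: "(H (g ^ k * p) (g ^ k * q), k) \<in> fractions N (Suc (Suc 0))" and fN': "(H (f ^ l * p') (f ^ l * q'), l) \<in> fractions N (Suc (Suc 0))"
    using N.fractions_restrict[OF pq(2) hf(2)] N.fractions_restrict[OF pq'(2) hf(1)] by simp_all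
  have "\<phi> (Suc (Suc 0)) (f * g) (section_smult M (Suc (Suc 0)) (f * g) (f ^ (2 * a)) a (section_restrict M (Suc 0) f (Suc 0) g s)) =
      section_smult N (Suc (Suc 0)) (f * g) (f ^ (2 * a)) a (\<phi> (Suc (Suc 0)) (f * g) (section_restrict M (Suc 0) f (Suc 0) g s))"
    by (rule D(3)[OF one_le(2) hfg F0(3) rs_in hpow])
  also have "\<phi> (Suc (Suc 0)) (f * g) (section_restrict M (Suc 0) f (Suc 0) g s) = section_restrict N (Suc 0) f (Suc 0) g (\<phi> (Suc 0) f s)"
    using D(4)[OF one_le(1) hf(1) F0(1) s hf(2) F0(2)] by simp
  also have "\<dots> = fraction N (Suc (Suc 0)) (f * g) (H (g ^ k * p) (g ^ k * q)) k"
    unfolding pq(1) using N.section_restrict_fraction[OF F0(3) pq(2) hf(2)] by simp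
  also have "section_smult N (Suc (Suc 0)) (f * g) (f ^ (2 * a)) a \<dots> =
      fraction N (Suc (Suc 0)) (f * g) (H (f ^ (2 * a) * (g ^ k * p)) (f ^ (2 * a) * (g ^ k * q))) (a + k)"
    by (rule N.section_smult_fraction[OF F0(3) fN hpow])
  finally have "fraction N (Suc (Suc 0)) (f * g) (H (f ^ (2 * a) * (g ^ k * p)) (f ^ (2 * a) * (g ^ k * q))) (a + k) =
      fraction N (Suc (Suc 0)) (f * g) (H (f ^ l * p') (f ^ l * q')) l"
    unfolding key e1 by simp
  then have "M.\<sigma> (f * g) ^ l * M.\<sigma> (f ^ (2 * a) * (g ^ k * p)) = M.\<sigma> (f * g) ^ (a + k) * M.\<sigma> (f ^ l * p')"
    "M.\<sigma> (f * g) ^ l * M.\<sigma> (f ^ (2 * a) * (g ^ k * q)) = M.\<sigma> (f * g) ^ (a + k) * M.\<sigma> (f ^ l * q')"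
    using N.fraction_eq_iff[OF F0(3) N.fractions_smult[OF fN hpow] fN'] by blast+
  then have 1: "(M.\<sigma> f * M.\<sigma> g) ^ l * (M.\<sigma> f ^ (2 * a) * (M.\<sigma> g ^ k * M.\<sigma> p)) = (M.\<sigma> f * M.\<sigma> g) ^ (a + k) * (M.\<sigma> f ^ l * M.\<sigma> p')"
    "(M.\<sigma> f * M.\<sigma> g) ^ l * (M.\<sigma> f ^ (2 * a) * (M.\<sigma> g ^ k * M.\<sigma> q)) = (M.\<sigma> f * M.\<sigma> g) ^ (a + k) * (M.\<sigma> f ^ l * M.\<sigma> q')"
    unfolding along_simps M.\<sigma>_power by blast+
  have sh: "shifted_homogeneous d k (M.\<sigma> r)" if "shifted_homogeneous d (k * Suc 0) r" for d r
    using that by (auto simp: shifted_homogeneous_def homogeneous_along split: if_splits)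
  have ndvd: "\<not> M.\<sigma> f dvd M.\<sigma> g"
    unfolding Ff Fg using linear_form_dvd_linear_form_iff[OF uv(2)] uv(1) by simp
  have "M.\<sigma> p = 0" by (rule no_section[OF 1(1) Ff uv(2) F0(2) ndvd sh[OF pq(3)] lt(1)])
  moreover have "M.\<sigma> q = 0" by (rule no_section[OF 1(2) Ff uv(2) F0(2) ndvd sh[OF pq(4)] lt(2)])
  ultimately have "H p q = H 0 0" by (simp add: N.eq_iff)
  then have img: "\<phi> (Suc 0) f s = fraction N (Suc 0) f (H 0 0) k" "(H 0 0, k) \<in> fractions N (Suc 0)" using pq by simp_all
  \<comment> \<open>Multiplication by the zero function fixes the image, which is zero. By
    injectivity it also fixes the section \<open>1 / f^a\<close>, so that this section would be
    zero.\<close>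
  have h0: "homogeneous (0 * Suc 0) (0::spoly)" by simp
  have "\<phi> (Suc 0) f (section_smult M (Suc 0) f 0 0 s) = section_smult N (Suc 0) f 0 0 (\<phi> (Suc 0) f s)"
    by (rule D(3)[OF one_le(1) hf(1) F0(1) s h0])
  also have "\<dots> = \<phi> (Suc 0) f s"
    unfolding img(1) using N.section_smult_fraction[OF F0(1) img(2) h0] by simp
  finally have "\<phi> (Suc 0) f (section_smult M (Suc 0) f 0 0 s) = \<phi> (Suc 0) f s" .
  moreover have "section_smult M (Suc 0) f 0 0 s = fraction M (Suc 0) f (G 0 0) a"
    unfolding s_def using M.section_smult_fraction[OF F0(1) gen h0] by simp
  moreover have fr0: "(G 0 0, a) \<in> fractions M (Suc 0)" using M.fractions_smult[OF gen h0] by simp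
  ultimately have "fraction M (Suc 0) f (G 0 0) a = fraction M (Suc 0) f (G 1 0) a"
    using D(1)[OF one_le(1) hf(1) F0(1)] s M.fraction_in_sections[OF fr0, of f] unfolding s_def by (auto dest: inj_onD)
  then have "M.\<sigma> f ^ a = 0"
    using M.fraction_eq_iff[OF F0(1) fr0 gen] by simp
  then show False using F0(1) by simp
qed

lemma sheaf_isomorphic_split_modules:
  assumes "sheaf_isomorphic M N" "split_module M c w a b G" "split_module N c w a' b' H" "a \<le> b" "a' \<le> b'"
  shows "a = a'"
proof -
  obtain \<phi> \<psi> where "injective_sheaf_map c w M N \<phi>" "injective_sheaf_map c w N M \<psi>"
    using sheaf_isomorphic_injective_maps[OF assms(1,2)] by blast
  then show ?thesis
    using split_module_degree_le[OF assms(2,3) _ assms(5)] split_module_degree_le[OF assms(3,2) _ assms(4)] by force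
qed

section \<open>The splitting type of a free arrangement\<close>

text \<open>Modulo the Euler vector, \<open>x\<close> and \<open>y\<close> are a basis with
  coefficients unique by \<open>saito_indep\<close>; reduction modulo the line makes them unique
  modulo \<open>c\<close>. So a free arrangement splits with its exponents on every line.\<close>

lemma (in arrangement) split_module_restrict_D:
  assumes s: "saito C x y" and hx: "vhomogeneous a x" and hy: "vhomogeneous b y" and cw: "vdot c w = 1"
  shows "\<exists>G. split_module (restrict_to_line D c) c w a b G"
proof -
  have LD: "x \<in> log_vectors C" "y \<in> log_vectors C" using s by (auto simp: saito_def)
  interpret D: smodule D by (rule smodule_D)
  have lin: "linear_form c \<odot>\<^bsub>D\<^esub> cl z = cl (linear_form c *s z)" if "z \<in> log_vectors C" for z using cl_smult that .
  interpret Q: squotient D "(\<lambda>m. linear_form c \<odot>\<^bsub>D\<^esub> m) ` carrier D"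
  proof (intro squotient.intro squotient_axioms.intro smodule_D)
    show "(\<lambda>m. linear_form c \<odot>\<^bsub>D\<^esub> m) ` carrier D \<subseteq> carrier D" using D.smult_closed by blast
    show "\<zero>\<^bsub>D\<^esub> \<in> (\<lambda>m. linear_form c \<odot>\<^bsub>D\<^esub> m) ` carrier D"
      unfolding cl_zero cl_carrier using lin[OF log_vectors_0] log_vectors_0 by (intro image_eqI[of _ _ "cl 0"]) auto
    fix X assume "X \<in> (\<lambda>m. linear_form c \<odot>\<^bsub>D\<^esub> m) ` carrier D"
    then obtain z where z: "z \<in> log_vectors C" "X = cl (linear_form c *s z)" unfolding cl_carrier using lin by auto
    have mem: "cl (linear_form c *s z') \<in> (\<lambda>m. linear_form c \<odot>\<^bsub>D\<^esub> m) ` carrier D" if "z' \<in> log_vectors C" for z'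
      unfolding cl_carrier using lin[OF that] that by (intro image_eqI[of _ _ "cl z'"]) auto
    show "a \<odot>\<^bsub>D\<^esub> X \<in> (\<lambda>m. linear_form c \<odot>\<^bsub>D\<^esub> m) ` carrier D" for a
    proof -
      have "a *s (linear_form c *s z) = linear_form c *s (a *s z)" by (simp add: vec_eq_iff mult_ac)
      then show ?thesis unfolding z(2) using cl_smult[OF log_vectors_scale[OF z(1)], of a "linear_form c"] mem[OF log_vectors_scale[OF z(1)]] by simp
    qed
    have "- z \<in> log_vectors C" using log_vectors_diff[OF log_vectors_0 z(1)] by simp
    moreover have "linear_form c *s (- z) + linear_form c *s z = 0" by (simp add: vec_eq_iff)
    ultimately show "\<exists>Z\<in>(\<lambda>m. linear_form c \<odot>\<^bsub>D\<^esub> m) ` carrier D. Z \<oplus>\<^bsub>D\<^esub> X = \<zero>\<^bsub>D\<^esub>"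
      unfolding z(2) cl_zero using mem z(1) cl_add log_vectors_scale by (metis (no_types, lifting))
    fix Z assume "Z \<in> (\<lambda>m. linear_form c \<odot>\<^bsub>D\<^esub> m) ` carrier D"
    then obtain z' where z': "z' \<in> log_vectors C" "Z = cl (linear_form c *s z')" unfolding cl_carrier using lin by auto
    have "linear_form c *s z + linear_form c *s z' = linear_form c *s (z + z')" by (simp add: vec_eq_iff algebra_simps)
    then show "X \<oplus>\<^bsub>D\<^esub> Z \<in> (\<lambda>m. linear_form c \<odot>\<^bsub>D\<^esub> m) ` carrier D"
      unfolding z(2) z'(2) using cl_add[OF log_vectors_scale[OF z(1)] log_vectors_scale[OF z'(1)]] mem[OF log_vectors_add[OF z(1) z'(1)]] by simp
  qed
  have R: "restrict_to_line D c = Q.Q" by (simp add: restrict_to_line_def)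
  define G where "G p q = Q.cls (cl (p *s x + q *s y))" for p q
  have inLD: "p *s x + q *s y \<in> log_vectors C" for p q using LD by (intro log_vectors_add log_vectors_scale)
  have incar: "cl (p *s x + q *s y) \<in> carrier D" for p q unfolding cl_carrier using inLD by blast
  have "split_module (restrict_to_line D c) c w a b G"
  proof
    show "vdot c w = 1" by (rule cw)
    show "f \<odot>\<^bsub>restrict_to_line D c\<^esub> G p q = G (f * p) (f * q)" for f p q
    proof -
      have "f *s (p *s x + q *s y) = (f * p) *s x + (f * q) *s y" by (simp add: vec_eq_iff algebra_simps)
      then show ?thesis unfolding R G_def Q.cls_smult[OF incar] cl_smult[OF inLD] by simp
    qed
    show "G p q = G p' q' \<longleftrightarrow> along c w p = along c w p' \<and> along c w q = along c w q'" for p q p' q'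
    proof -
      have "G p q = G p' q' \<longleftrightarrow> (\<exists>n\<in>(\<lambda>m. linear_form c \<odot>\<^bsub>D\<^esub> m) ` carrier D. cl (p *s x + q *s y) = n \<oplus>\<^bsub>D\<^esub> cl (p' *s x + q' *s y))"
        unfolding G_def by (rule Q.cls_eq_iff[OF incar incar])
      also have "\<dots> \<longleftrightarrow> (\<exists>z\<in>log_vectors C. cl (p *s x + q *s y) = cl (linear_form c *s z) \<oplus>\<^bsub>D\<^esub> cl (p' *s x + q' *s y))"
        unfolding cl_carrier using lin by simp
      also have "\<dots> \<longleftrightarrow> (\<exists>z\<in>log_vectors C. \<exists>h. p *s x + q *s y = h *s euler_vec + (linear_form c *s z + (p' *s x + q' *s y)))"
        using cl_add[OF log_vectors_scale inLD] cl_eq_iff[OF inLD log_vectors_add[OF log_vectors_scale inLD]] by metis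
      also have "\<dots> \<longleftrightarrow> linear_form c dvd p - p' \<and> linear_form c dvd q - q'"
      proof
        assume "\<exists>z\<in>log_vectors C. \<exists>h. p *s x + q *s y = h *s euler_vec + (linear_form c *s z + (p' *s x + q' *s y))"
        then obtain z h where z: "z \<in> log_vectors C" "p *s x + q *s y = h *s euler_vec + (linear_form c *s z + (p' *s x + q' *s y))" by blast
        obtain h1 p1 q1 where z1: "z = h1 *s euler_vec + p1 *s x + q1 *s y" using saito_span[OF reduced s z(1)] by blast
        have "(- h - linear_form c * h1) *s euler_vec + (p - p' - linear_form c * p1) *s x + (q - q' - linear_form c * q1) *s y = 0"
          using z(2) unfolding z1 by (simp add: vec_eq_iff algebra_simps)
        then have "p - p' - linear_form c * p1 = 0" "q - q' - linear_form c * q1 = 0"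
          using saito_indep(2,3)[OF reduced s] by blast+
        then show "linear_form c dvd p - p' \<and> linear_form c dvd q - q'" by simp
      next
        assume "linear_form c dvd p - p' \<and> linear_form c dvd q - q'"
        then obtain p1 q1 where pq: "p - p' = linear_form c * p1" "q - q' = linear_form c * q1" by blast
        have "p = linear_form c * p1 + p'" "q = linear_form c * q1 + q'" using pq by (simp_all add: algebra_simps)
        then have "p *s x + q *s y = 0 *s euler_vec + (linear_form c *s (p1 *s x + q1 *s y) + (p' *s x + q' *s y))"
          by (simp add: vec_eq_iff algebra_simps)
        then show "\<exists>z\<in>log_vectors C. \<exists>h. p *s x + q *s y = h *s euler_vec + (linear_form c *s z + (p' *s x + q' *s y))"
          using inLD by blast
      qed
      also have "\<dots> \<longleftrightarrow> along c w p = along c w p' \<and> along c w q = along c w q'"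
        by (simp add: dvd_iff_along[OF cw])
      finally show ?thesis .
    qed
    show "component (restrict_to_line D c) d = {G p q | p q. shifted_homogeneous a d p \<and> shifted_homogeneous b d q}" for d
      unfolding R Q.quotient_component cl_component
    proof (intro equalityI subsetI)
      fix X assume "X \<in> Q.cls ` cl ` {x \<in> log_vectors C. vhomogeneous d x}"
      then obtain z where z: "z \<in> log_vectors C" "vhomogeneous d z" "X = Q.cls (cl z)" by blast
      obtain h p q where z1: "z = h *s euler_vec + p *s x + q *s y" "shifted_homogeneous a d p" "shifted_homogeneous b d q"
        using saito_span_homogeneous[OF reduced s hx hy z(1,2)] by blast
      have "cl z = cl (p *s x + q *s y)"
        by (rule iffD2[OF cl_eq_iff[OF z(1) inLD]]) (simp add: z1(1) add.assoc exI[of _ h])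
      then show "X \<in> {G p q | p q. shifted_homogeneous a d p \<and> shifted_homogeneous b d q}"
        using z(3) z1(2,3) by (auto simp: G_def)
    next
      fix X assume "X \<in> {G p q | p q. shifted_homogeneous a d p \<and> shifted_homogeneous b d q}"
      then obtain p q where pq: "X = G p q" "shifted_homogeneous a d p" "shifted_homogeneous b d q" by blast
      have "vhomogeneous d (p *s x + q *s y)"
        by (intro vhomogeneous_add vhomogeneous_scale[OF hx pq(2)] vhomogeneous_scale[OF hy pq(3)])
      then show "X \<in> Q.cls ` cl ` {x \<in> log_vectors C. vhomogeneous d x}" unfolding pq(1) G_def using inLD by blast
    qed
  qed
  then show ?thesis by blast
qed

lemma split_module_line_bundles:
  assumes cw: "vdot c w = 1"
  shows "\<exists>G. split_module (direct_sum (line_bundle c a) (line_bundle c b)) c w a b G"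
proof -
  interpret P: smodule poly_module
  proof (rule smodule.intro)
    show "abelian_group poly_module"
    proof (rule abelian_groupI)
      fix x assume "x \<in> carrier poly_module"
      show "\<exists>y\<in>carrier poly_module. y \<oplus>\<^bsub>poly_module\<^esub> x = \<zero>\<^bsub>poly_module\<^esub>"
        by (rule bexI[of _ "- x"]) (auto simp: poly_module_def)
    qed (auto simp: poly_module_def add_ac)
  qed (auto simp: poly_module_def algebra_simps)
  interpret Q: squotient poly_module "(\<lambda>m. linear_form c \<odot>\<^bsub>poly_module\<^esub> m) ` carrier poly_module"
  proof (intro squotient.intro squotient_axioms.intro P.smodule_axioms)
    let ?N = "(\<lambda>m. linear_form c \<odot>\<^bsub>poly_module\<^esub> m) ` carrier poly_module"
    have N: "?N = {p. linear_form c dvd p}" by (auto simp: poly_module_def)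
    show "?N \<subseteq> carrier poly_module" by (simp add: poly_module_def)
    show "\<zero>\<^bsub>poly_module\<^esub> \<in> ?N" unfolding N by (simp add: poly_module_def)
    show "\<exists>y\<in>?N. y \<oplus>\<^bsub>poly_module\<^esub> x = \<zero>\<^bsub>poly_module\<^esub>" if "x \<in> ?N" for x
      using that unfolding N by (intro bexI[of _ "- x"]) (auto simp: poly_module_def)
    show "x \<oplus>\<^bsub>poly_module\<^esub> y \<in> ?N" if "x \<in> ?N" "y \<in> ?N" for x y
      using that unfolding N by (auto simp: poly_module_def)
    show "f \<odot>\<^bsub>poly_module\<^esub> x \<in> ?N" if "x \<in> ?N" for f x
      using that unfolding N by (auto simp: poly_module_def)
  qed
  have R: "restrict_to_line poly_module c = Q.Q" by (simp add: restrict_to_line_def)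
  have car: "p \<in> carrier poly_module" for p by (simp add: poly_module_def)
  have eq: "Q.cls p = Q.cls q \<longleftrightarrow> along c w p = along c w q" for p q
  proof -
    have "Q.cls p = Q.cls q \<longleftrightarrow> (\<exists>r. p = linear_form c * r + q)"
      unfolding Q.cls_eq_iff[OF car car] by (auto simp: poly_module_def)
    also have "\<dots> \<longleftrightarrow> linear_form c dvd p - q" by (auto simp: dvd_def algebra_simps)
    finally show ?thesis by (simp add: dvd_iff_along[OF cw])
  qed
  have sm: "f \<odot>\<^bsub>line_bundle c n\<^esub> Q.cls p = Q.cls (f * p)" for f n p
    using Q.cls_smult[OF car, of f p] by (simp add: line_bundle_def twist_down_def R) (simp add: poly_module_def)
  have comp: "component (line_bundle c n) d = Q.cls ` {p. shifted_homogeneous n d p}" for n d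
  proof -
    have z0: "\<zero>\<^bsub>poly_module\<^esub> = 0" and pc: "component poly_module e = {p. homogeneous e p}" for e
      by (simp_all add: poly_module_def)
    have z: "\<zero>\<^bsub>Q.Q\<^esub> = Q.cls 0" unfolding Q.quotient_zero z0 ..
    have "component (line_bundle c n) d = (if n \<le> d then component Q.Q (d - n) else {\<zero>\<^bsub>Q.Q\<^esub>})"
      unfolding line_bundle_def twist_down_def R by simp
    also have "\<dots> = Q.cls ` {p. shifted_homogeneous n d p}"
      unfolding z Q.quotient_component pc by (simp add: shifted_homogeneous_def)
    finally show ?thesis .
  qed
  define G where "G p q = (Q.cls p, Q.cls q)" for p q
  have "split_module (direct_sum (line_bundle c a) (line_bundle c b)) c w a b G"
  proof
    show "f \<odot>\<^bsub>direct_sum (line_bundle c a) (line_bundle c b)\<^esub> G p q = G (f * p) (f * q)" for f p q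
      by (simp add: direct_sum_def G_def sm)
    show "component (direct_sum (line_bundle c a) (line_bundle c b)) d =
        {G p q | p q. shifted_homogeneous a d p \<and> shifted_homogeneous b d q}" for d
      by (auto simp: direct_sum_def G_def comp)
  qed (auto simp: cw G_def eq)
  then show ?thesis by blast
qed

lemma ex_general_line:
  assumes "for_general_line P"
  shows "\<exists>c. c \<noteq> 0 \<and> P c"
proof -
  obtain d F where F: "F \<noteq> 0" "\<And>c. c \<noteq> 0 \<Longrightarrow> poly_eval F c \<noteq> 0 \<Longrightarrow> P c"
    using assms by (auto simp: for_general_line_def)
  have "var 1 \<noteq> 0" using poly_eval_var[of 1 1] by (metis poly_eval_0 one_index zero_neq_one)
  \<comment> \<open>The factor \<open>var 1\<close> keeps the chosen point away from the zero
    vector, where a constant \<open>F\<close> would not vanish either.\<close>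
  then have "F * var 1 \<noteq> 0" using F(1) by simp
  then obtain c where "poly_eval (F * var 1) c \<noteq> 0" using spoly_eq_0I by blast
  then have "poly_eval F c \<noteq> 0" "c \<noteq> 0" by auto
  then show ?thesis using F(2) by blast
qed

text \<open>One line from the open set that defines the splitting type suffices, because the
  decomposition by the exponents is available on any line.\<close>

lemma (in arrangement) splitting_type_free_with:
  assumes "free_with C a b" "a \<le> b" "splitting_type (line ` C) a1 a2"
  shows "a1 = a"
proof -
  obtain x y where xy: "saito C x y" "vhomogeneous a x" "vhomogeneous b y"
    using assms(1) by (auto simp: free_with_def)
  have le: "a1 \<le> a2" using assms(3) by (simp add: splitting_type_def)
  obtain c where c: "c \<noteq> 0" "sheaf_isomorphic (restrict_to_line D c) (direct_sum (line_bundle c a1) (line_bundle c a2))"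
    using assms(3) ex_general_line unfolding splitting_type_def by blast
  obtain w where w: "vdot c w = 1" using ex_vdot_1[OF c(1)] by blast
  obtain G where G: "split_module (restrict_to_line D c) c w a b G" using split_module_restrict_D[OF xy w] by blast
  obtain H where H: "split_module (direct_sum (line_bundle c a1) (line_bundle c a2)) c w a1 a2 H"
    using split_module_line_bundles[OF w] by blast
  show ?thesis using sheaf_isomorphic_split_modules[OF c(2) G H assms(2) le] by simp
qed

section \<open>Combinatorics of the intersection lattice and of the dual points\<close>

section \<open>Intersection lattices\<close>

lemma line_arrangement_representatives:
  assumes "line_arrangement A"
  obtains C where "reduced C" "A = line ` C"
proof -
  define r where "r H = (SOME c. c \<noteq> 0 \<and> H = line c)" for H
  have r: "r H \<noteq> 0 \<and> H = line (r H)" if "H \<in> A" for H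
    unfolding r_def by (rule someI_ex) (use assms that in \<open>auto simp: line_arrangement_def\<close>)
  have "reduced (r ` A)"
    unfolding reduced_def
  proof (intro conjI ballI impI)
    show "finite (r ` A)" using assms by (simp add: line_arrangement_def)
    show "0 \<notin> r ` A" using r by force
    fix c k assume "c \<in> r ` A" "k \<in> r ` A" "c \<noteq> k"
    then obtain H K where HK: "H \<in> A" "K \<in> A" "c = r H" "k = r K" "H \<noteq> K" by blast
    then have "line c \<noteq> line k" using r[OF HK(1)] r[OF HK(2)] by metis
    moreover have "c \<noteq> 0" "k \<noteq> 0" using r[OF HK(1)] r[OF HK(2)] HK(3,4) by simp_all
    ultimately show "vcross c k \<noteq> 0" using line_eq_iff[of c k] by simp
  qed
  moreover have "A = line ` r ` A" using r by (force simp: image_iff)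
  ultimately show thesis using that by blast
qed

lemma line_inj_on: "reduced C \<Longrightarrow> inj_on line C"
  by (rule inj_onI) (use line_eq_iff reduced_nonzero reduced_vcross in metis)

lemma line_not_UNIV:
  assumes "c \<noteq> 0"
  shows "line c \<noteq> UNIV"
proof -
  obtain w where "vdot c w = 1" using ex_vdot_1 assms by blast
  moreover have "w \<noteq> 0" using calculation by (auto simp: vdot_simps)
  ultimately show ?thesis using proj_point_in_line[of w c] by auto
qed

text \<open>The common point is \<open>vcross c k\<close>. This expresses concurrency through the
  order of the lattice.\<close>

lemma lines_inter_subset_iff:
  assumes ck: "vcross c k \<noteq> 0"
  shows "line c \<inter> line k \<subseteq> line l \<longleftrightarrow> det3 c k l = 0"
proof
  assume *: "line c \<inter> line k \<subseteq> line l"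
  have "proj_point (vcross c k) \<in> line c \<inter> line k" by (simp add: proj_point_in_line[OF ck])
  then have "vdot l (vcross c k) = 0" using * proj_point_in_line[OF ck] by blast
  then show "det3 c k l = 0" by (simp add: det3_rotate vdot_commute)
next
  assume "det3 c k l = 0"
  then obtain a b where "l = a *s c + b *s k" using coplanar_span[OF ck] by blast
  then show "line c \<inter> line k \<subseteq> line l" by (auto simp: line_def vdot_simps)
qed

locale lattice_iso =
  fixes C D :: "(complex^3) set" and \<phi> :: "proj_plane set \<Rightarrow> proj_plane set"
  assumes redC: "reduced C" and redD: "reduced D"
    and bij: "bij_betw \<phi> (intersection_lattice (line ` C)) (intersection_lattice (line ` D))"
    and order: "X \<in> intersection_lattice (line ` C) \<Longrightarrow> Z \<in> intersection_lattice (line ` C) \<Longrightarrow>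
      X \<subseteq> Z \<longleftrightarrow> \<phi> X \<subseteq> \<phi> Z"
begin

abbreviation A where "A \<equiv> line ` C"
abbreviation B where "B \<equiv> line ` D"
abbreviation LA where "LA \<equiv> intersection_lattice A"
abbreviation LB where "LB \<equiv> intersection_lattice B"

lemma LA_Inter: "F \<subseteq> A \<Longrightarrow> \<Inter>F \<in> LA" and LB_Inter: "F' \<subseteq> B \<Longrightarrow> \<Inter>F' \<in> LB"
  by (auto simp: intersection_lattice_def)

lemma A_LA: "H \<in> A \<Longrightarrow> H \<in> LA" and B_LB: "K \<in> B \<Longrightarrow> K \<in> LB"
  using LA_Inter[of "{H}"] LB_Inter[of "{K}"] by auto

lemma \<phi>_LB: "X \<in> LA \<Longrightarrow> \<phi> X \<in> LB"
  using bij by (auto simp: bij_betw_def)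

lemma \<phi>_surj: "Z \<in> LB \<Longrightarrow> \<exists>X\<in>LA. Z = \<phi> X"
  using bij by (auto simp: bij_betw_def)

lemma \<phi>_UNIV: "\<phi> UNIV = UNIV"
proof -
  have U: "UNIV \<in> LA" "UNIV \<in> LB" using LA_Inter[of "{}"] LB_Inter[of "{}"] by auto
  then obtain X where X: "X \<in> LA" "UNIV = \<phi> X" using \<phi>_surj by blast
  then have "\<phi> X \<subseteq> \<phi> UNIV" using order[OF X(1) U(1)] by simp
  then show ?thesis using X(2) by blast
qed

lemma below_line_A:
  assumes "X \<in> LA" "X \<noteq> UNIV"
  shows "\<exists>H\<in>A. X \<subseteq> H"
  using assms by (auto simp: intersection_lattice_def)

lemma below_line_B:
  assumes "X \<in> LB" "X \<noteq> UNIV"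
  shows "\<exists>H\<in>B. X \<subseteq> H"
  using assms by (auto simp: intersection_lattice_def)

lemma line_antichain:
  assumes "reduced C'" "H \<in> line ` C'" "K \<in> line ` C'" "H \<subseteq> K"
  shows "H = K"
proof -
  obtain c k where "c \<in> C'" "k \<in> C'" "H = line c" "K = line k" using assms by blast
  then show ?thesis
    using line_subset_iff[of c k] reduced_vcross[OF assms(1), of c k] reduced_nonzero[OF assms(1)] assms(4) by metis
qed

lemma not_UNIV: "reduced C' \<Longrightarrow> H \<in> line ` C' \<Longrightarrow> H \<noteq> UNIV"
  using line_not_UNIV reduced_nonzero by blast

lemma \<phi>_inj: "X \<in> LA \<Longrightarrow> Z \<in> LA \<Longrightarrow> \<phi> X = \<phi> Z \<Longrightarrow> X = Z"
  using bij by (auto simp: bij_betw_def dest: inj_onD)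

lemma UNIV_LA: "UNIV \<in> LA"
  using LA_Inter[of "{}"] by simp

text \<open>Lines are the maximal elements below the whole plane, and an order isomorphism preserves
  the top and such elements.\<close>

lemma \<phi>_line:
  assumes H: "H \<in> A"
  shows "\<phi> H \<in> B"
proof -
  have "H \<noteq> UNIV" using not_UNIV[OF redC H] .
  then have "\<phi> H \<noteq> UNIV" using \<phi>_inj[OF A_LA[OF H] UNIV_LA] \<phi>_UNIV by metis
  then obtain K where K: "K \<in> B" "\<phi> H \<subseteq> K" using below_line_B[OF \<phi>_LB[OF A_LA[OF H]]] by metis
  then obtain X where X: "X \<in> LA" "K = \<phi> X" using \<phi>_surj B_LB by blast
  have "X \<noteq> UNIV" using not_UNIV[OF redD K(1)] X(2) \<phi>_UNIV by metis
  then obtain H' where H': "H' \<in> A" "X \<subseteq> H'" using below_line_A X(1) by blast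
  have "H \<subseteq> X" using order[OF A_LA[OF H] X(1)] K(2) X(2) by simp
  then have "X = H" using line_antichain[OF redC H H'(1)] H'(2) by blast
  then show ?thesis using K(1) X(2) by simp
qed

lemma \<phi>_lines: "\<phi> ` A = B"
proof
  show "\<phi> ` A \<subseteq> B" using \<phi>_line by blast
  show "B \<subseteq> \<phi> ` A"
  proof
    fix K assume K: "K \<in> B"
    then obtain X where X: "X \<in> LA" "K = \<phi> X" using \<phi>_surj B_LB by blast
    have "X \<noteq> UNIV" using not_UNIV[OF redD K] X(2) \<phi>_UNIV by metis
    then obtain H where H: "H \<in> A" "X \<subseteq> H" using below_line_A X(1) by blast
    then have "K \<subseteq> \<phi> H" using order[OF X(1) A_LA[OF H(1)]] X(2) by simp
    then have "K = \<phi> H" using line_antichain[OF redD K \<phi>_line[OF H(1)]] by blast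
    then show "K \<in> \<phi> ` A" using H(1) by blast
  qed
qed

text \<open>Intersections of lines are their greatest lower bounds in the lattice, which order
  isomorphisms preserve.\<close>

lemma \<phi>_Inter:
  assumes F: "F \<subseteq> A"
  shows "\<phi> (\<Inter>F) = \<Inter>(\<phi> ` F)"
proof
  have FA: "\<Inter>F \<in> LA" using LA_Inter F by blast
  show "\<phi> (\<Inter>F) \<subseteq> \<Inter>(\<phi> ` F)"
  proof (rule INT_greatest)
    fix H assume "H \<in> F"
    then show "\<phi> (\<Inter>F) \<subseteq> \<phi> H" using order[OF FA, of H] A_LA F by blast
  qed
  have "\<Inter>(\<phi> ` F) \<in> LB" using LB_Inter[of "\<phi> ` F"] \<phi>_line F by blast
  then obtain X where X: "X \<in> LA" "\<Inter>(\<phi> ` F) = \<phi> X" using \<phi>_surj by blast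
  have "X \<subseteq> \<Inter>F"
  proof (rule Inter_greatest)
    fix H assume H: "H \<in> F"
    then have "\<phi> X \<subseteq> \<phi> H" using X(2) by blast
    then show "X \<subseteq> H" using order[OF X(1), of H] A_LA F H by blast
  qed
  then show "\<Inter>(\<phi> ` F) \<subseteq> \<phi> (\<Inter>F)" using order[OF X(1) FA] X(2) by simp
qed

text \<open>The lattice of a subarrangement consists of the meets of its lines, so the given
  isomorphism restricts once the removed lines correspond.\<close>

lemma lattice_isomorphic_remove:
  assumes H: "H \<in> A"
  shows "lattice_isomorphic (A - {H}) (B - {\<phi> H})"
proof -
  have inj: "inj_on \<phi> A" by (rule inj_onI) (use \<phi>_inj A_LA in blast)
  have sub: "intersection_lattice (A - {H}) \<subseteq> LA" by (auto simp: intersection_lattice_def)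
  have img: "\<phi> ` (A - {H}) = B - {\<phi> H}" 
    using inj_on_image_set_diff[OF inj, of A "{H}"] H by (simp add: \<phi>_lines)
  have "\<phi> ` intersection_lattice (A - {H}) = intersection_lattice (B - {\<phi> H})"
  proof (intro equalityI subsetI)
    fix Z assume "Z \<in> \<phi> ` intersection_lattice (A - {H})"
    then obtain F where F: "F \<subseteq> A - {H}" "Z = \<phi> (\<Inter>F)" by (auto simp: intersection_lattice_def)
    have FA: "F \<subseteq> A" using F(1) by (rule subset_trans) (rule Diff_subset)
    have "\<phi> ` F \<subseteq> B - {\<phi> H}" unfolding img[symmetric] by (rule image_mono[OF F(1)])
    then show "Z \<in> intersection_lattice (B - {\<phi> H})"
      unfolding F(2) \<phi>_Inter[OF FA] intersection_lattice_def by (intro CollectI exI[of _ "\<phi> ` F"] conjI refl)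
  next
    fix Z assume "Z \<in> intersection_lattice (B - {\<phi> H})"
    then obtain F' where F': "F' \<subseteq> \<phi> ` (A - {H})" "Z = \<Inter>F'" unfolding img by (auto simp: intersection_lattice_def)
    then obtain F where F: "F \<subseteq> A - {H}" "F' = \<phi> ` F" by (meson subset_imageE)
    have FA: "F \<subseteq> A" using F(1) by (rule subset_trans) (rule Diff_subset)
    have "Z = \<phi> (\<Inter>F)" unfolding F'(2) F(2) by (rule \<phi>_Inter[OF FA, symmetric])
    moreover have "\<Inter>F \<in> intersection_lattice (A - {H})"
      unfolding intersection_lattice_def using F(1) by (intro CollectI exI[of _ F] conjI refl)
    ultimately show "Z \<in> \<phi> ` intersection_lattice (A - {H})" by (rule image_eqI)
  qed
  then have "bij_betw \<phi> (intersection_lattice (A - {H})) (intersection_lattice (B - {\<phi> H}))"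
    using bij_betw_subset[OF bij sub] by (simp add: bij_betw_def)
  then show ?thesis unfolding lattice_isomorphic_def using order sub by blast
qed

definition \<beta> :: "complex^3 \<Rightarrow> complex^3" where
  "\<beta> c = (THE d. d \<in> D \<and> line d = \<phi> (line c))"

lemma \<beta>:
  assumes "c \<in> C"
  shows "\<beta> c \<in> D" "line (\<beta> c) = \<phi> (line c)"
proof -
  have "\<phi> (line c) \<in> line ` D" using \<phi>_line assms by blast
  then have "\<exists>!d. d \<in> D \<and> line d = \<phi> (line c)" using line_inj_on[OF redD] by (auto simp: inj_on_def)
  then have "\<beta> c \<in> D \<and> line (\<beta> c) = \<phi> (line c)" unfolding \<beta>_def by (rule theI')
  then show "\<beta> c \<in> D" "line (\<beta> c) = \<phi> (line c)" by auto
qed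

lemma inj_\<beta>: "inj_on \<beta> C"
proof (rule inj_onI)
  fix c k assume ck: "c \<in> C" "k \<in> C" "\<beta> c = \<beta> k"
  then have "\<phi> (line c) = \<phi> (line k)" using \<beta> by metis
  then have "line c = line k" using \<phi>_inj A_LA ck by blast
  then show "c = k" using line_inj_on[OF redC] ck by (auto dest: inj_onD)
qed

text \<open>Concurrency says that the meet of two lines lies below the third, a statement about the
  order. For equal first lines both determinants vanish.\<close>

lemma combinatorial_iso_\<beta>: "combinatorial_iso \<beta> C D"
  unfolding combinatorial_iso_def
proof (intro conjI ballI)
  have "\<beta> ` C = D"
  proof
    show "D \<subseteq> \<beta> ` C"
    proof
      fix d assume d: "d \<in> D"
      then obtain c where c: "c \<in> C" "line d = \<phi> (line c)" using \<phi>_lines by blast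
      then have "line (\<beta> c) = line d" using \<beta> by metis
      then have "\<beta> c = d" using line_inj_on[OF redD] \<beta>(1)[OF c(1)] d by (auto dest: inj_onD)
      then show "d \<in> \<beta> ` C" using c(1) by blast
    qed
  qed (use \<beta> in blast)
  then show "bij_betw \<beta> C D" using inj_\<beta> by (simp add: bij_betw_def)
  fix c k l assume ckl: "c \<in> C" "k \<in> C" "l \<in> C"
  show "det3 c k l = 0 \<longleftrightarrow> det3 (\<beta> c) (\<beta> k) (\<beta> l) = 0"
  proof (cases "c = k")
    case False
    then have ne: "\<beta> c \<noteq> \<beta> k" using inj_\<beta> ckl by (auto dest: inj_onD)
    have sub: "{line c, line k} \<subseteq> A" using ckl by blast
    have "det3 c k l = 0 \<longleftrightarrow> \<Inter>{line c, line k} \<subseteq> line l"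
      using lines_inter_subset_iff[OF reduced_vcross[OF redC ckl(1,2) False]] by simp
    also have "\<dots> \<longleftrightarrow> \<phi> (\<Inter>{line c, line k}) \<subseteq> \<phi> (line l)"
      using ckl by (intro order LA_Inter[OF sub] A_LA) blast
    also have "\<dots> \<longleftrightarrow> line (\<beta> c) \<inter> line (\<beta> k) \<subseteq> line (\<beta> l)"
      unfolding \<phi>_Inter[OF sub] using \<beta>(2) ckl by simp
    also have "\<dots> \<longleftrightarrow> det3 (\<beta> c) (\<beta> k) (\<beta> l) = 0"
      by (rule lines_inter_subset_iff[OF reduced_vcross[OF redD \<beta>(1)[OF ckl(1)] \<beta>(1)[OF ckl(2)] ne]])
    finally show ?thesis .
  qed (simp add: det3_simps)
qed

end

section \<open>The dual point set\<close>

lemma proj_point_eq_iff: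
  assumes "c \<noteq> 0" "k \<noteq> 0"
  shows "proj_point c = proj_point k \<longleftrightarrow> vcross c k = 0"
proof
  assume "proj_point c = proj_point k"
  then have "vec.span {c} = vec.span {k}" using subspace_of_proj_point assms by metis
  then have "k \<in> vec.span {c}" by (simp add: vec.span_base)
  then show "vcross c k = 0" by (auto simp: in_span_singleton vcross_simps)
next
  assume "vcross c k = 0"
  then obtain t where t: "k = t *s c" using vcross_eq_0_iff[OF assms(1)] by blast
  then have "t \<noteq> 0" using assms(2) by auto
  then have "c = inverse t *s k" using t by (simp add: vector_smult_assoc)
  then have "vec.span {c} = vec.span {k}"
    using t by (intro vec.span_eq[THEN iffD2]) (auto simp: in_span_singleton)
  then show "proj_point c = proj_point k" by (simp add: proj_point_def)
qed

lemma dual_points_eq: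
  assumes "reduced C"
  shows "dual_points (line ` C) = proj_point ` C"
proof (intro equalityI subsetI)
  fix P assume "P \<in> dual_points (line ` C)"
  then obtain c k where c: "c \<noteq> 0" "P = proj_point c" "k \<in> C" "line c = line k" by (auto simp: dual_points_def)
  then have "proj_point c = proj_point k"
    using line_eq_iff[of c k] proj_point_eq_iff[of c k] reduced_nonzero[OF assms] by blast
  then show "P \<in> proj_point ` C" using c by blast
next
  fix P assume "P \<in> proj_point ` C"
  then show "P \<in> dual_points (line ` C)" using reduced_nonzero[OF assms] by (auto simp: dual_points_def)
qed

lemma proj_point_inj_on: "reduced C \<Longrightarrow> inj_on proj_point C"
  by (rule inj_onI) (use proj_point_eq_iff reduced_nonzero reduced_vcross in metis)

lemma in_proj_span:
  assumes "vcross c k \<noteq> 0" "u \<noteq> 0"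
  shows "proj_point u \<in> proj_span (proj_point c) (proj_point k) \<longleftrightarrow> det3 c k u = 0"
proof -
  have ck: "c \<noteq> 0" "k \<noteq> 0" using assms(1) by (auto simp: vcross_simps)
  let ?S = "vec.span (vec.span {c} \<union> vec.span {k})"
  have S: "x \<in> ?S \<longleftrightarrow> (\<exists>a b. x = a *s c + b *s k)" for x
    unfolding vec.span_Un vec.span_span by (auto simp: in_span_singleton)
  have "proj_point u \<in> proj_span (proj_point c) (proj_point k) \<longleftrightarrow> vec.span {u} \<subseteq> ?S"
    by (simp add: proj_span_def subspace_of_proj_point ck assms(2))
  also have "\<dots> \<longleftrightarrow> u \<in> ?S"
  proof
    assume "u \<in> ?S"
    then show "vec.span {u} \<subseteq> ?S" by (intro vec.span_minimal) auto
  qed (use vec.span_base[of u "{u}"] in blast)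
  also have "\<dots> \<longleftrightarrow> det3 c k u = 0"
    unfolding S
  proof
    assume "det3 c k u = 0"
    then obtain a b where "u = a *s c + b *s k" by (rule coplanar_span[OF assms(1)])
    then show "\<exists>a b. u = a *s c + b *s k" by blast
  qed (auto simp: det3_simps)
  finally show ?thesis .
qed

lemma proj_span_eq_iff:
  assumes "vcross c k \<noteq> 0" "vcross c l \<noteq> 0"
  shows "proj_span (proj_point c) (proj_point k) = proj_span (proj_point c) (proj_point l) \<longleftrightarrow> det3 c k l = 0"
proof
  have l: "l \<noteq> 0" using assms(2) by (auto simp: vcross_simps)
  assume "proj_span (proj_point c) (proj_point k) = proj_span (proj_point c) (proj_point l)"
  then show "det3 c k l = 0"
    using in_proj_span[OF assms(1) l] in_proj_span[OF assms(2) l] by (simp add: det3_simps)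
next
  assume "det3 c k l = 0"
  then obtain a b where ab: "l = a *s c + b *s k" using coplanar_span[OF assms(1)] by blast
  then have b: "b \<noteq> 0" using assms(2) by (auto simp: vcross_simps)
  have det: "det3 c l u = b * det3 c k u" for u unfolding ab by (simp add: det3_simps)
  show "proj_span (proj_point c) (proj_point k) = proj_span (proj_point c) (proj_point l)"
  proof (rule Set.set_eqI)
    fix P
    obtain u where u: "u \<noteq> 0" "P = proj_point u" using proj_plane_cases by blast
    show "P \<in> proj_span (proj_point c) (proj_point k) \<longleftrightarrow> P \<in> proj_span (proj_point c) (proj_point l)"
      unfolding u(2) in_proj_span[OF assms(1) u(1)] in_proj_span[OF assms(2) u(1)] det using b by simp
  qed
qed

text \<open>Dually, lines joining the point of \<open>c\<close> to other points are the points of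
  the arrangement on the line \<open>c\<close>; \<open>R\<close> selects one element for
  each.\<close>

lemma card_joining_lines:
  assumes red: "reduced C" and c: "c \<in> C" and R: "transversal C c R"
  shows "card (joining_lines (proj_point c) (proj_point ` C)) = card R"
proof -
  define s where "s k = proj_span (proj_point c) (proj_point k)" for k
  have RC: "R \<subseteq> C - {c}" using R by (simp add: transversal_def)
  have nz: "vcross c k \<noteq> 0" if "k \<in> C - {c}" for k using reduced_vcross[OF red c] that by auto
  have eq: "s k = s l \<longleftrightarrow> det3 c k l = 0" if "k \<in> C - {c}" "l \<in> C - {c}" for k l
    unfolding s_def using proj_span_eq_iff[OF nz nz] that by blast
  have "proj_point ` C - {proj_point c} = proj_point ` (C - {c})"
    using proj_point_inj_on[OF red] c by (auto dest: inj_onD)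
  then have "joining_lines (proj_point c) (proj_point ` C) = s ` (C - {c})"
    by (auto simp: joining_lines_def s_def)
  also have "\<dots> = s ` R"
  proof (intro equalityI subsetI)
    fix X assume "X \<in> s ` (C - {c})"
    then obtain k where k: "k \<in> C - {c}" "X = s k" by blast
    then obtain r where r: "r \<in> R" "det3 c r k = 0" using R unfolding transversal_def by blast
    then have "s r = s k" using eq[of r k] k(1) RC by blast
    then show "X \<in> s ` R" using r(1) k(2) by (metis imageI)
  qed (use RC in blast)
  finally have 1: "joining_lines (proj_point c) (proj_point ` C) = s ` R" .
  have "inj_on s R"
  proof (rule inj_onI)
    fix k l assume kl: "k \<in> R" "l \<in> R" "s k = s l"
    then have "det3 c k l = 0" using eq[of k l] RC by blast
    then show "k = l" using R kl unfolding transversal_def by blast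
  qed
  then show ?thesis unfolding 1 by (rule card_image)
qed

lemma free_D0_iff: "reduced C \<Longrightarrow> C \<noteq> {} \<Longrightarrow> free_module poly_ring (D0 (line ` C)) \<longleftrightarrow> (\<exists>x y. saito C x y)"
  using arrangement.free_iff_saito[OF arrangement.intro] .

theorem theorem9p11:
  fixes A B :: "proj_plane set set" and a\<^sub>1 a\<^sub>2 :: nat
  assumes "line_arrangement A" and "line_arrangement B"
    and "lattice_isomorphic A B"
    and "free_module poly_ring (D0 A)" and "splitting_type A a\<^sub>1 a\<^sub>2"
    and "\<not> free_module poly_ring (D0 B)"
    and "\<not> (\<exists>L\<in>A. \<exists>L'\<in>B. counterexample (A - {L}) (B - {L'}))"
  shows "\<forall>P\<in>dual_points A.
    card (joining_lines P (dual_points A)) \<le> a\<^sub>1 \<and>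
    int a\<^sub>1 \<le> \<lfloor>(real (card (dual_points A)) - 1) / 2\<rfloor>"
proof
  fix P assume P: "P \<in> dual_points A"
  obtain C where C: "reduced C" "A = line ` C" using line_arrangement_representatives[OF assms(1)] by blast
  obtain D where D: "reduced D" "B = line ` D" using line_arrangement_representatives[OF assms(2)] by blast
  obtain c where c: "c \<in> C" "P = proj_point c" using P dual_points_eq[OF C(1)] C(2) by blast
  obtain \<phi> where \<phi>: "bij_betw \<phi> (intersection_lattice A) (intersection_lattice B)"
    "\<forall>X\<in>intersection_lattice A. \<forall>Z\<in>intersection_lattice A. X \<subseteq> Z \<longleftrightarrow> \<phi> X \<subseteq> \<phi> Z"
    using assms(3) by (auto simp: lattice_isomorphic_def)
  interpret I: lattice_iso C D \<phi>
    by (rule lattice_iso.intro) (use C D \<phi> in auto)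
  have iso: "combinatorial_iso I.\<beta> C D" by (rule I.combinatorial_iso_\<beta>)
  have Cne: "C \<noteq> {}" and Dne: "D \<noteq> {}" using c I.\<beta> by blast+
  obtain x0 y0 where "saito C x0 y0" using free_D0_iff[OF C(1) Cne] assms(4) C(2) by blast
  then obtain a' b' where "free_with C a' b'" using saito_homogeneous[OF C(1)] by (metis free_with_def)
  \<comment> \<open>The exponents are ordered so that the smaller one can be compared with the first
    entry of the splitting type.\<close>
  then obtain a b where ab: "free_with C a b" "a \<le> b"
    using free_with_swap by (metis linear)
  have a: "a\<^sub>1 = a"
    using arrangement.splitting_type_free_with[OF arrangement.intro[OF C(1)] ab] assms(5) C(2) by blast
  obtain R where R: "transversal C c R" using ex_transversal reduced_finite[OF C(1)] by blast
  have "card R \<le> a"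
  proof (rule minimal_counterexample_bound[OF C(1) D(1) iso ab _ _ c(1) R])
    show "\<not> (\<exists>x y. saito D x y)" using free_D0_iff[OF D(1) Dne] assms(6) D(2) by blast
    fix k e e' assume k: "k \<in> C" "C \<noteq> {k}" "free_with (C - {k}) e e'"
    have red: "reduced (C - {k})" "reduced (D - {I.\<beta> k})"
      using reduced_subset C(1) D(1) by blast+
    have ne: "C - {k} \<noteq> {}" using k by blast
    have remC: "A - {line k} = line ` (C - {k})"
      using line_inj_on[OF C(1)] k(1) unfolding C(2) by (auto dest: inj_onD)
    have remD: "B - {line (I.\<beta> k)} = line ` (D - {I.\<beta> k})"
      using line_inj_on[OF D(1)] I.\<beta>(1)[OF k(1)] unfolding D(2) by (auto dest: inj_onD)
    \<comment> \<open>The removed lines correspond under the lattice isomorphism, so the deletions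
      stay lattice isomorphic; as the first is free, the second has to be.\<close>
    have "\<not> counterexample (A - {line k}) (B - {line (I.\<beta> k)})"
      using assms(7) k(1) I.\<beta>(1)[OF k(1)] C(2) D(2) by blast
    moreover have "lattice_isomorphic (A - {line k}) (B - {line (I.\<beta> k)})"
      using I.lattice_isomorphic_remove[of "line k"] k(1) C(2) D(2) I.\<beta>(2)[OF k(1)] by simp
    moreover have "free_module poly_ring (D0 (A - {line k}))"
      unfolding remC using free_D0_iff[OF red(1) ne] k(3) by (auto simp: free_with_def)
    ultimately have free: "free_module poly_ring (D0 (line ` (D - {I.\<beta> k})))"
      unfolding counterexample_def remD by blast
    have "D - {I.\<beta> k} \<noteq> {}"
    proof -
      obtain l where l: "l \<in> C - {k}" using ne by blast
      then have "I.\<beta> l \<in> D - {I.\<beta> k}" using I.\<beta>(1) I.inj_\<beta> k(1) by (auto dest: inj_onD)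
      then show ?thesis by blast
    qed
    then show "\<exists>x y. saito (D - {I.\<beta> k}) x y" using free_D0_iff[OF red(2)] free by blast
  qed
  then have 1: "card (joining_lines P (dual_points A)) \<le> a\<^sub>1"
    using card_joining_lines[OF C(1) c(1) R] a dual_points_eq[OF C(1)] C(2) c(2) by simp
  have "card (dual_points A) = card C"
    unfolding C(2) dual_points_eq[OF C(1)] by (rule card_image[OF proj_point_inj_on[OF C(1)]])
  \<comment> \<open>The exponents add up to one less than the number of lines, and \<open>a\<close>
    is the smaller one.\<close>
  then have "2 * a\<^sub>1 + 1 \<le> card (dual_points A)"
    using free_with_degrees[OF C(1) ab(1)] ab(2) a by linarith
  then have "real (2 * a\<^sub>1 + 1) \<le> real (card (dual_points A))" by (simp only: of_nat_le_iff)
  then have "real a\<^sub>1 \<le> (real (card (dual_points A)) - 1) / 2" by (simp add: field_simps)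
  then have "int a\<^sub>1 \<le> \<lfloor>(real (card (dual_points A)) - 1) / 2\<rfloor>"
    by (simp add: le_floor_iff)
  then show "card (joining_lines P (dual_points A)) \<le> a\<^sub>1 \<and>
    int a\<^sub>1 \<le> \<lfloor>(real (card (dual_points A)) - 1) / 2\<rfloor>"
    using 1 by blast
qed

end
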